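(* Let $\hat T_\varepsilon:\Delta\to\Delta$, $\varepsilon\in V$, be a family of maps of the interval as described in the context. Then the density $\hat h_\varepsilon$ of the map $\hat T_\varepsilon$ is differentiable as a $C^0$ element, that is, there exists $\hat h^*\in C^0$ such that $$\lim_{\varepsilon\to 0}\Big\|\frac{\hat h_\varepsilon-\hat h}{\varepsilon}-\hat h^*\Big\|_{C^0}=0.$$ Moreover, we have the linear response formula $$\hat h^*=(I-\hat L)^{-1}\hat L[A_0\hat h'+B_0\hat h],$$ where $\hat h'$ is the spatial derivative of $\hat h$ and $$A_0=-\left(\frac{\partial_\varepsilon\hat T_\varepsilon}{\hat T'_\varepsilon}\right)\Big|_{\varepsilon=0},\qquad B_0=\left(\frac{\partial_\varepsilon\hat T_\varepsilon\cdot\hat T_\varepsilon''}{(\hat T_\varepsilon')^2}-\frac{\partial_\varepsilon\hat T_\varepsilon'}{\hat T_\varepsilon'}\right)\Big|_{\varepsilon=0}.$$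
   Context: Let $\Delta$ be an interval, $V$ a neighbourhood of $0$, and $\Omega$ a finite or countable set. Primes and superscripts $(j)$ denote derivatives in the space variable $x$. The maps $\hat T_\varepsilon:\Delta\to\Delta$ satisfy: - For each $\varepsilon\in V$ there exists a partition (mod $0$) of $\Delta$ into open intervals $\Delta_{\omega,\varepsilon}$, $\omega\in\Omega$, such that the restriction $\hat T_{\omega,\varepsilon}$ of $\hat T_\varepsilon$ to $\Delta_{\omega,\varepsilon}$ is piecewise $C^3$, onto, and uniformly expanding in the sense that $\inf_\omega\inf_{\Delta_{\omega,\varepsilon}}|\hat T_{\omega,\varepsilon}'|>1$. The inverse branches of $\hat T_\varepsilon$ on $\Delta_{\omega,\varepsilon}$ are denoted $g_{\omega,\varepsilon}$. - For each $\omega\in\Omega$ and $j=0,1,2$ the following partial derivatives exist and satisfy the commutation relation $\partial_\varepsilon g_{\omega,\varepsilon}^{(j)}=(\partial_\varepsilon g_{\omega,\varepsilon})^{(j)}$. - $\displaystyle\sum_{\omega}\sup_{\varepsilon\in V}\sup_{x\in\Delta}|g'_{\omega,\varepsilon}(x)|<\infty$; $\displaystyle\sup_\omega\sup_{\varepsilon\in V}\sup_{x\in\Delta}\left|\frac{g_{\omega,\varepsilon}''(x)}{g_{\omega,\varepsilon}'(x)}\right|<\infty$; and for $i=1,2$, $\displaystyle\sum_\omega\sup_{\varepsilon\in V}\sup_{x\in\Delta}|\partial_\varepsilon g_{\omega,\varepsilon}^{(i)}(x)|<\infty$. $\hat L_\varepsilon$ denotes the Perron-Frobenius operator of $\hat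 T_\varepsilon$: for $\Phi\in L^1(\Delta)$, $\hat L_\varepsilon\Phi(x)=\sum_{\omega\in\Omega}\Phi\circ g_{\omega,\varepsilon}(x)\,g_{\omega,\varepsilon}'(x)$ for a.e. $x\in\Delta$; $\hat L=\hat L_0$. Under these conditions it is well known that $\hat T_\varepsilon$ admits a unique (up to multiplication) invariant absolutely continuous finite measure, whose density is denoted $\hat h_\varepsilon$ (so $\hat L_\varepsilon\hat h_\varepsilon=\hat h_\varepsilon$), and that $\hat L_\varepsilon$ has a spectral gap when acting on $C^k$, $k=1,2$. The density is normalized by $\int_\Delta\hat h_\varepsilon\,dx=1$, and $\hat h=\hat h_0$. The inverse $(I-\hat L)^{-1}$ is taken on the space $C^1_0$ of $C^1$ functions on $\Delta$ with zero average.
   Formalization: The second space derivative of ∂_ε g_{ω,ε} is additionally assumed continuous in x for every ε in V; with mere existence, L[A_0 h'+B_0 h] need not be C^1, so the inverse taken on C^1_0 would be undefined. *)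

theory Defs
  imports "HOL-Analysis.Analysis"
begin

text \<open>
  Spatial derivatives are taken within the interval \<open>\<Delta>\<close>: they are one-sided at an end point that
  belongs to \<open>\<Delta>\<close>, and agree with \<^const>\<open>deriv\<close> in its interior.  Values of functions outside
  \<open>\<Delta>\<close> never matter.
\<close>

definition dx :: "real set \<Rightarrow> (real \<Rightarrow> real) \<Rightarrow> real \<Rightarrow> real" where
  "dx \<Delta> f x = vector_derivative f (at x within \<Delta>)"

definition C_k :: "nat \<Rightarrow> real set \<Rightarrow> (real \<Rightarrow> real) set" where
  "C_k k \<Delta> = {f. (\<forall>j<k. \<forall>x\<in>\<Delta>. (dx \<Delta> ^^ j) f differentiable (at x within \<Delta>))
                \<and> (\<forall>j\<le>k. continuous_on \<Delta> ((dx \<Delta> ^^ j) f))}"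

text \<open>
  The Banach space \<open>C\<^sup>k(\<Delta>)\<close>: finite \<open>C\<^sup>k\<close> norm.  For compact \<open>\<Delta>\<close> boundedness is automatic.
\<close>

definition C_b :: "nat \<Rightarrow> real set \<Rightarrow> (real \<Rightarrow> real) set" where
  "C_b k \<Delta> = {f \<in> C_k k \<Delta>. \<forall>j\<le>k. bounded ((dx \<Delta> ^^ j) f ` \<Delta>)}"

definition C_norm :: "nat \<Rightarrow> real set \<Rightarrow> (real \<Rightarrow> real) \<Rightarrow> real" where
  "C_norm k \<Delta> f = (\<Sum>j\<le>k. SUP x\<in>\<Delta>. \<bar>(dx \<Delta> ^^ j) f x\<bar>)"

text \<open>
  The supremum norm with values in \<open>[0, \<infinity>]\<close>, so that it is meaningful without a boundedness
  assumption.
\<close>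

definition sup_norm :: "real set \<Rightarrow> (real \<Rightarrow> real) \<Rightarrow> ennreal" where
  "sup_norm \<Delta> f = (SUP x\<in>\<Delta>. ennreal \<bar>f x\<bar>)"

text \<open>
  \<open>C\<^sup>1\<close> functions with zero average; extensionality makes a function on \<open>\<Delta>\<close> a unique element.
\<close>

definition C1_zero :: "real set \<Rightarrow> (real \<Rightarrow> real) set" where
  "C1_zero \<Delta> = {f \<in> C_b 1 \<Delta> \<inter> extensional \<Delta>. (LINT x|lebesgue_on \<Delta>. f x) = 0}"

text \<open>
  A map \<open>T\<close> with full branches \<open>P \<omega>\<close> and inverse branches \<open>g \<omega>\<close>.  A monotone branch on an open
  interval has an open image, so ``onto'' means onto the interior of \<open>\<Delta>\<close> (which is \<open>\<Delta>\<close> itself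
  if \<open>\<Delta>\<close> is open).  An end point of \<open>\<Delta>\<close> that belongs to \<open>\<Delta>\<close> is covered by the \<open>C\<^sup>3\<close> extension of
  the inverse branch.
\<close>

definition full_branch_map ::
  "real set \<Rightarrow> 'w set \<Rightarrow> (real \<Rightarrow> real) \<Rightarrow> ('w \<Rightarrow> real set) \<Rightarrow> ('w \<Rightarrow> real \<Rightarrow> real) \<Rightarrow> bool" where
  "full_branch_map \<Delta> \<Omega> T P g \<longleftrightarrow>
     T ` \<Delta> \<subseteq> \<Delta>
   \<and> (\<forall>\<omega>\<in>\<Omega>. open (P \<omega>) \<and> is_interval (P \<omega>) \<and> P \<omega> \<subseteq> \<Delta>)
   \<and> disjoint_family_on P \<Omega>
   \<and> \<Delta> - (\<Union>\<omega>\<in>\<Omega>. P \<omega>) \<in> null_sets lebesgue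
   \<and> (\<forall>\<omega>\<in>\<Omega>. T \<in> C_k 3 (P \<omega>) \<and> T ` P \<omega> = interior \<Delta>)
   \<and> (\<exists>\<kappa>>1. \<forall>\<omega>\<in>\<Omega>. \<forall>x\<in>P \<omega>. \<bar>deriv T x\<bar> \<ge> \<kappa>)
   \<and> (\<forall>\<omega>\<in>\<Omega>. g \<omega> \<in> C_k 3 \<Delta> \<and> g \<omega> ` \<Delta> \<subseteq> \<Delta>
          \<and> (\<forall>x\<in>interior \<Delta>. g \<omega> x \<in> P \<omega> \<and> T (g \<omega> x) = x))"

text \<open>
  Existence of \<open>\<partial>\<^sub>\<epsilon> g\<^sup>(\<^sup>j\<^sup>)\<close> and its equality with \<open>(\<partial>\<^sub>\<epsilon> g)\<^sup>(\<^sup>j\<^sup>)\<close> for \<open>j = 0, 1, 2\<close>.  The derivative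
  \<open>(\<partial>\<^sub>\<epsilon> g)''\<close> is understood in the \<open>C\<^sup>2\<close> sense, i.e. continuous in \<open>x\<close>: otherwise the function
  to which \<open>(I - L)\<^sup>-\<^sup>1\<close> is applied need not be \<open>C\<^sup>1\<close>.
\<close>

definition eps_derivs_commute ::
  "real set \<Rightarrow> real set \<Rightarrow> 'w set \<Rightarrow> (real \<Rightarrow> 'w \<Rightarrow> real \<Rightarrow> real) \<Rightarrow> bool" where
  "eps_derivs_commute \<Delta> V \<Omega> g \<longleftrightarrow>
     (\<forall>\<omega>\<in>\<Omega>. \<forall>\<epsilon>\<in>V.
        (\<lambda>x. deriv (\<lambda>e. g e \<omega> x) \<epsilon>) \<in> C_k 2 \<Delta>
      \<and> (\<forall>j\<le>2. \<forall>x\<in>\<Delta>.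
            (\<lambda>e. (dx \<Delta> ^^ j) (g e \<omega>) x) differentiable (at \<epsilon>)
          \<and> deriv (\<lambda>e. (dx \<Delta> ^^ j) (g e \<omega>) x) \<epsilon>
              = (dx \<Delta> ^^ j) (\<lambda>y. deriv (\<lambda>e. g e \<omega> y) \<epsilon>) x))"

definition uniform_branch_bounds ::
  "real set \<Rightarrow> real set \<Rightarrow> 'w set \<Rightarrow> (real \<Rightarrow> 'w \<Rightarrow> real \<Rightarrow> real) \<Rightarrow> bool" where
  "uniform_branch_bounds \<Delta> V \<Omega> g \<longleftrightarrow>
     (\<Sum>\<^sub>\<infinity>\<omega>\<in>\<Omega>. SUP \<epsilon>\<in>V. SUP x\<in>\<Delta>. ennreal \<bar>dx \<Delta> (g \<epsilon> \<omega>) x\<bar>) < \<infinity>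
   \<and> (SUP \<omega>\<in>\<Omega>. SUP \<epsilon>\<in>V. SUP x\<in>\<Delta>.
        ennreal \<bar>(dx \<Delta> ^^ 2) (g \<epsilon> \<omega>) x / dx \<Delta> (g \<epsilon> \<omega>) x\<bar>) < \<infinity>
   \<and> (\<forall>i\<in>{1,2}. (\<Sum>\<^sub>\<infinity>\<omega>\<in>\<Omega>. SUP \<epsilon>\<in>V. SUP x\<in>\<Delta>.
        ennreal \<bar>deriv (\<lambda>e. (dx \<Delta> ^^ i) (g e \<omega>) x) \<epsilon>\<bar>) < \<infinity>)"

text \<open>
  The Perron-Frobenius operator in terms of the inverse branches; the absolute value accounts for
  orientation-reversing branches and disappears if all branches are increasing.
\<close>

definition PF :: "real set \<Rightarrow> 'w set \<Rightarrow> ('w \<Rightarrow> real \<Rightarrow> real) \<Rightarrow> (real \<Rightarrow> real) \<Rightarrow> real \<Rightarrow> real" where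
  "PF \<Delta> \<Omega> g f x = (\<Sum>\<^sub>\<infinity>\<omega>\<in>\<Omega>. f (g \<omega> x) * \<bar>dx \<Delta> (g \<omega>) x\<bar>)"

definition invariant_density :: "real set \<Rightarrow> (real \<Rightarrow> real) \<Rightarrow> (real \<Rightarrow> real) \<Rightarrow> bool" where
  "invariant_density \<Delta> T h \<longleftrightarrow>
     h \<in> borel_measurable (lebesgue_on \<Delta>) \<and> (\<forall>x\<in>\<Delta>. 0 \<le> h x)
   \<and> integrable (lebesgue_on \<Delta>) h \<and> (LINT x|lebesgue_on \<Delta>. h x) = 1
   \<and> (let \<mu> = density (lebesgue_on \<Delta>) (\<lambda>x. ennreal (h x))
      in T \<in> \<mu> \<rightarrow>\<^sub>M \<mu> \<and> distr \<mu> \<mu> T = \<mu>)"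

text \<open>
  Spectral gap on \<open>C\<^sup>k(\<Delta>)\<close> for an operator with leading eigenvalue 1: 1 is a simple eigenvalue,
  with spectral projection \<open>f \<mapsto> l f \<cdot> u\<close>, and the rest of the spectrum lies in a disc of radius
  less than 1.  Continuity of \<open>L\<close> and \<open>l\<close> on \<open>C\<^sup>k\<close> follows from the last estimate at \<open>n = 1\<close>
  and \<open>n = 0\<close>.

  For the Perron-Frobenius operators considered here the gap on \<open>C\<^sup>1\<close> follows from
  \<^term>\<open>uniform_branch_bounds\<close>.  The gap on \<open>C\<^sup>2\<close> involves \<open>g'''\<close>, which those bounds do not
  control when there are infinitely many branches, so it is a separate property.
\<close>

definition spectral_gap :: "nat \<Rightarrow> real set \<Rightarrow> ((real \<Rightarrow> real) \<Rightarrow> real \<Rightarrow> real) \<Rightarrow> bool" where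
  "spectral_gap k \<Delta> L \<longleftrightarrow>
     (\<forall>f\<in>C_b k \<Delta>. L f \<in> C_b k \<Delta>)
   \<and> (\<exists>u\<in>C_b k \<Delta>. \<exists>l :: (real \<Rightarrow> real) \<Rightarrow> real. \<exists>C \<theta>.
        (\<forall>x\<in>\<Delta>. L u x = u x) \<and> l u = 1
      \<and> (\<forall>f\<in>C_b k \<Delta>. l (L f) = l f)
      \<and> (\<forall>f\<in>C_b k \<Delta>. \<forall>f'\<in>C_b k \<Delta>. \<forall>c. l (\<lambda>x. f x + c * f' x) = l f + c * l f')
      \<and> 0 \<le> \<theta> \<and> \<theta> < 1
      \<and> (\<forall>f\<in>C_b k \<Delta>. \<forall>n. C_norm k \<Delta> (\<lambda>x. (L ^^ n) f x - l f * u x) \<le> C * \<theta> ^ n * C_norm k \<Delta> f))"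

definition I_minus :: "real set \<Rightarrow> ((real \<Rightarrow> real) \<Rightarrow> real \<Rightarrow> real) \<Rightarrow> (real \<Rightarrow> real) \<Rightarrow> real \<Rightarrow> real" where
  "I_minus \<Delta> L f = restrict (\<lambda>x. f x - L f x) \<Delta>"

text \<open>
  The coefficients are only meaningful on the open branch domains \<open>\<Delta>\<^sub>\<omega>\<^sub>,\<^sub>0\<close>, where the spatial
  derivatives of \<open>T\<close> are two-sided.
\<close>

definition A0 :: "(real \<Rightarrow> real \<Rightarrow> real) \<Rightarrow> real \<Rightarrow> real" where
  "A0 T x = - (deriv (\<lambda>e. T e x) 0 / deriv (T 0) x)"

definition B0 :: "(real \<Rightarrow> real \<Rightarrow> real) \<Rightarrow> real \<Rightarrow> real" where
  "B0 T x = deriv (\<lambda>e. T e x) 0 * deriv (deriv (T 0)) x / (deriv (T 0) x)\<^sup>2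
            - deriv (\<lambda>e. deriv (T e) x) 0 / deriv (T 0) x"

end

theory Submission
  imports Defs
begin

text \<open>
  Positive functions with \<open>f x \<le> exp (a |x - y|) f y\<close> form a cone which every transfer operator
  \<open>L\<^sub>\<epsilon>\<close> maps into a smaller cone of the same kind.  Splitting off a fixed fraction of the mean at each
  step, one finds that \<open>L\<^sub>\<epsilon>\<^sup>n\<close> contracts Lipschitz functions of zero mean exponentially fast in the
  Lipschitz norm, uniformly in \<open>\<epsilon>\<close>.  Consequently
  \<open>(h\<^sub>\<epsilon> - h\<^sub>0) / \<epsilon> = \<Sum>n. L\<^sub>\<epsilon>\<^sup>n ((L\<^sub>\<epsilon> h\<^sub>0 - h\<^sub>0) / \<epsilon>)\<close>.  The spectral gap on \<open>C\<^sup>2\<close> serves only to make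
  \<open>h\<^sub>0\<close> a \<open>C\<^sup>2\<close> function; then the quotients \<open>(L\<^sub>\<epsilon> h\<^sub>0 - h\<^sub>0) / \<epsilon>\<close> are equi-Lipschitz and converge
  pointwise, hence uniformly, to \<open>\<Phi> = \<Sum>\<omega>. \<plusminus> ((h\<^sub>0 \<circ> g\<^sub>\<omega>) \<cdot> \<partial>\<^sub>\<epsilon>g\<^sub>\<omega>)'\<close>, and dominated
  convergence gives the limit \<open>\<Sum>n. L\<^sub>0\<^sup>n \<Phi> = (I - L\<^sub>0)\<^sup>-\<^sup>1 \<Phi>\<close>.  Implicit differentiation of
  \<open>T\<^sub>\<epsilon> (g\<^sub>\<epsilon> x) = x\<close> identifies \<open>\<Phi>\<close> with \<open>L\<^sub>0 (A\<^sub>0 h\<^sub>0' + B\<^sub>0 h\<^sub>0)\<close>.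
\<close>

subsection \<open>Dominated sums over countable sets\<close>

text \<open>The quotient is expanded with powers of L_\<epsilon> acting on h_0, not powers of L_0
  acting on h_\<epsilon>, so that only h_0 has to be smooth; the other densities are merely
  continuous. Three facts that this needs are not among the hypotheses. The contraction rate of the
  inverse branches is given for each \<epsilon> separately; it becomes uniform near 0 because the
  \<epsilon>-derivative of g' is uniformly bounded. No bound is given for the \<epsilon>-derivative
  of g itself; it is recovered from that of g' by comparing lengths. Differentiability of
  T_\<epsilon> in \<epsilon> is not assumed; it follows from the partial derivatives of the inverse
  branches, with estimates of mixed second differences taking the place of joint differentiability.
  Moreover \<Delta> need not be closed, and T (g x) = x is known only in the interior: estimates are
  proved at interior points and carried to the end points by continuity, and uniform convergence
  comes from common Lipschitz constants on a bounded set.\<close>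

lemma summable_on_dominated:
  fixes f b :: "'a \<Rightarrow> real"
  assumes "b summable_on A" "\<And>a. a \<in> A \<Longrightarrow> \<bar>f a\<bar> \<le> b a"
  shows "f summable_on A"
proof -
  have "(\<lambda>a. \<bar>f a\<bar>) summable_on A"
    by (rule summable_on_comparison_test[OF assms(1)]) (use assms in auto)
  then show ?thesis
    using summable_on_iff_abs_summable_on_real by auto
qed

lemma abs_infsum_le:
  fixes f b :: "'a \<Rightarrow> real"
  assumes "b summable_on A" "\<And>a. a \<in> A \<Longrightarrow> \<bar>f a\<bar> \<le> b a"
  shows "\<bar>infsum f A\<bar> \<le> infsum b A"
proof -
  have f: "f summable_on A" "(\<lambda>a. - f a) summable_on A"
    using summable_on_dominated[OF assms(1), of f] summable_on_dominated[OF assms(1), of "\<lambda>a. - f a"]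
      assms(2) by auto
  have "infsum f A \<le> infsum b A"
    by (rule infsum_mono[OF f(1) assms(1)]) (rule abs_le_D1[OF assms(2)])
  moreover have "- infsum f A \<le> infsum b A"
    unfolding infsum_uminus[symmetric]
    by (rule infsum_mono[OF f(2) assms(1)]) (rule abs_le_D2[OF assms(2)])
  ultimately show ?thesis by simp
qed

lemma infsum_diff_real:
  fixes f g :: "'a \<Rightarrow> real"
  assumes "f summable_on A" "g summable_on A"
  shows "(\<Sum>\<^sub>\<infinity>a\<in>A. f a - g a) = infsum f A - infsum g A"
  using infsum_add[of f A "\<lambda>a. - g a"] assms
  by (simp add: infsum_uminus summable_on_uminus)

lemma summable_on_diff_real:
  fixes f g :: "'a \<Rightarrow> real"
  assumes "f summable_on A" "g summable_on A"
  shows "(\<lambda>a. f a - g a) summable_on A"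
  using summable_on_add[of f A "\<lambda>a. - g a"] assms by (simp add: summable_on_uminus)

text \<open>Transports a countable family to \<open>nat\<close>, padded with zeros, so that theorems
  about series apply to unordered sums over finite and infinite index sets alike. The guard matters:
  outside the range of \<open>to_nat_on\<close>, \<open>from_nat_into\<close> returns an arbitrary
  element.\<close>

definition nat_family :: "'a set \<Rightarrow> ('a \<Rightarrow> real) \<Rightarrow> nat \<Rightarrow> real" where
  "nat_family A f n = (if n \<in> to_nat_on A ` A then f (from_nat_into A n) else 0)"

lemma has_sum_nat_family:
  assumes "countable A"
  shows "(nat_family A f has_sum S) UNIV \<longleftrightarrow> (f has_sum S) A"
proof -
  have "(nat_family A f has_sum S) UNIV \<longleftrightarrow> (nat_family A f has_sum S) (to_nat_on A ` A)"
    by (rule has_sum_cong_neutral) (auto simp: nat_family_def)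
  also have "\<dots> \<longleftrightarrow> ((nat_family A f \<circ> to_nat_on A) has_sum S) A"
    by (rule has_sum_reindex) (rule inj_on_to_nat_on[OF assms])
  also have "\<dots> \<longleftrightarrow> (f has_sum S) A"
    by (rule has_sum_cong) (use assms in \<open>auto simp: nat_family_def from_nat_into_to_nat_on\<close>)
  finally show ?thesis .
qed

lemma nat_family_sums:
  assumes "countable A" "f summable_on A"
  shows "nat_family A f sums infsum f A"
  by (rule has_sum_imp_sums) (use assms in \<open>simp add: has_sum_nat_family\<close>)

lemma suminf_nat_family:
  assumes "countable A" "f summable_on A"
  shows "suminf (nat_family A f) = infsum f A"
  using nat_family_sums[OF assms] by (simp add: sums_iff)

lemma summable_nat_family:
  assumes "countable A" "f summable_on A"
  shows "summable (nat_family A f)"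
  using nat_family_sums[OF assms] by (simp add: sums_iff)

text \<open>In the case \<open>mem\<close> one index serves every \<open>f\<close> at once, so
  bounds, limits and derivatives of different families are compared termwise without unfolding the
  encoding.\<close>

lemma nat_family_cases:
  assumes "countable A"
  obtains (mem) a where "a \<in> A" "\<And>f. nat_family A f n = f a"
    | (not_mem) "\<And>f. nat_family A f n = 0"
proof (cases "n \<in> to_nat_on A ` A")
  case True
  then obtain a where "a \<in> A" "n = to_nat_on A a" by auto
  then show ?thesis
    using assms by (intro mem[of a]) (auto simp: nat_family_def)
next
  case False
  then show ?thesis by (intro not_mem) (auto simp: nat_family_def)
qed

text \<open>Tannery's theorem along an arbitrary filter. The majorant is uniform in the index, but
  has to hold only eventually in the parameter.\<close>

lemma tendsto_infsum:
  fixes f :: "'a \<Rightarrow> 'b \<Rightarrow> real"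
  assumes A: "countable A" and b: "b summable_on A"
    and lim: "\<And>a. a \<in> A \<Longrightarrow> (f a \<longlongrightarrow> l a) F"
    and bnd: "\<forall>\<^sub>F t in F. \<forall>a\<in>A. \<bar>f a t\<bar> \<le> b a"
  shows "((\<lambda>t. \<Sum>\<^sub>\<infinity>a\<in>A. f a t) \<longlongrightarrow> infsum l A) F"
proof (cases "F = bot")
  case False
  \<comment> \<open>The limits inherit the majorant, which makes the limiting family summable; this
    uses that the filter is proper.\<close>
  have lb: "\<bar>l a\<bar> \<le> b a" if "a \<in> A" for a
    by (rule tendsto_upperbound[OF tendsto_rabs[OF lim[OF that]] _ False])
      (use bnd that in \<open>auto elim: eventually_mono\<close>)
  have 1: "((\<lambda>t. nat_family A (\<lambda>a. f a t) n) \<longlongrightarrow> nat_family A l n) F" for n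
    by (rule nat_family_cases[OF A, of n]) (use lim in auto)
  have "\<forall>\<^sub>F (n,t) in at_top \<times>\<^sub>F F. norm (nat_family A (\<lambda>a. f a t) n) \<le> nat_family A b n"
  proof -
    have "\<forall>n. norm (nat_family A (\<lambda>a. f a t) n) \<le> nat_family A b n"
      if "\<forall>a\<in>A. \<bar>f a t\<bar> \<le> b a" for t
    proof
      fix n show "norm (nat_family A (\<lambda>a. f a t) n) \<le> nat_family A b n"
        by (rule nat_family_cases[OF A, of n]) (use that in auto)
    qed
    then have "\<forall>\<^sub>F t in F. \<forall>n. norm (nat_family A (\<lambda>a. f a t) n) \<le> nat_family A b n"
      using bnd by (auto elim: eventually_mono)
    then show ?thesis
      unfolding eventually_prod_filter
      by (intro exI[of _ "\<lambda>_. True"] exI[of _ "\<lambda>t. \<forall>n. norm (nat_family A (\<lambda>a. f a t) n) \<le> nat_family A b n"])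
         auto
  qed
  from tannerys_theorem[OF 1 this summable_nat_family[OF A b] False]
  have "((\<lambda>t. \<Sum>n. nat_family A (\<lambda>a. f a t) n) \<longlongrightarrow> suminf (nat_family A l)) F" by blast
  moreover have "suminf (nat_family A l) = infsum l A"
    by (rule suminf_nat_family[OF A summable_on_dominated[OF b lb]])
  moreover have "\<forall>\<^sub>F t in F. (\<Sum>n. nat_family A (\<lambda>a. f a t) n) = (\<Sum>\<^sub>\<infinity>a\<in>A. f a t)"
    using bnd
    by (rule eventually_mono) (intro suminf_nat_family[OF A] summable_on_dominated[OF b], auto)
  ultimately show ?thesis
    by (simp add: tendsto_cong)
qed simp

lemma continuous_on_infsum:
  fixes f :: "'a \<Rightarrow> 'b::topological_space \<Rightarrow> real"
  assumes "b summable_on A" "\<And>a x. a \<in> A \<Longrightarrow> x \<in> S \<Longrightarrow> \<bar>f a x\<bar> \<le> b a"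
    and "\<And>a. a \<in> A \<Longrightarrow> continuous_on S (f a)"
  shows "continuous_on S (\<lambda>x. \<Sum>\<^sub>\<infinity>a\<in>A. f a x)"
proof (rule uniform_limit_theorem)
  show "uniform_limit S (\<lambda>X x. \<Sum>a\<in>X. f a x) (\<lambda>x. \<Sum>\<^sub>\<infinity>a\<in>A. f a x) (finite_subsets_at_top A)"
    using assms by (intro Weierstrass_m_test_general[where M = b]) auto
  show "\<forall>\<^sub>F X in finite_subsets_at_top A. continuous_on S (\<lambda>x. \<Sum>a\<in>X. f a x)"
    by (rule eventually_finite_subsets_at_top_weakI) (use assms in \<open>auto intro!: continuous_intros\<close>)
qed simp

text \<open>The M-test makes the derived series converge uniformly. Working within a convex set
  includes one-sided derivatives at an end point of an interval.\<close>

lemma has_real_derivative_infsum: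
  fixes f f' :: "'a \<Rightarrow> real \<Rightarrow> real"
  assumes A: "countable A" and b: "b summable_on A" and b': "b' summable_on A" and S: "convex S"
    and f: "\<And>a x. a \<in> A \<Longrightarrow> x \<in> S \<Longrightarrow> \<bar>f a x\<bar> \<le> b a"
    and f': "\<And>a x. a \<in> A \<Longrightarrow> x \<in> S \<Longrightarrow> \<bar>f' a x\<bar> \<le> b' a"
    and der: "\<And>a x. a \<in> A \<Longrightarrow> x \<in> S \<Longrightarrow> (f a has_real_derivative f' a x) (at x within S)"
    and x: "x \<in> S"
  shows "((\<lambda>x. \<Sum>\<^sub>\<infinity>a\<in>A. f a x) has_real_derivative (\<Sum>\<^sub>\<infinity>a\<in>A. f' a x)) (at x within S)"
proof -
  let ?F = "\<lambda>n x. nat_family A (\<lambda>a. f a x) n" and ?F' = "\<lambda>n x. nat_family A (\<lambda>a. f' a x) n"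
  have sf: "(\<lambda>a. f a y) summable_on A" "(\<lambda>a. f' a y) summable_on A" if "y \<in> S" for y
    by (rule summable_on_dominated[OF b f[OF _ that]], assumption)
      (rule summable_on_dominated[OF b' f'[OF _ that]])
  have "norm (?F' n y) \<le> nat_family A b' n" if "y \<in> S" for n y
    by (rule nat_family_cases[OF A, of n]) (use A f' that in auto)
  then have "uniform_limit S (\<lambda>n x. \<Sum>i<n. ?F' i x) (\<lambda>x. \<Sum>i. ?F' i x) sequentially"
    by (intro Weierstrass_m_test[OF _ summable_nat_family[OF A b']]) auto
  moreover have "(?F n has_real_derivative ?F' n y) (at y within S)" if "y \<in> S" for n y
    by (rule nat_family_cases[OF A, of n]) (use A der that in auto)
  moreover have "summable (\<lambda>n. ?F n x)"
    by (rule summable_nat_family[OF A sf(1)[OF x]])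
  ultimately obtain G where G: "\<And>y. y \<in> S \<Longrightarrow> (\<lambda>n. ?F n y) sums G y"
      "\<And>y. y \<in> S \<Longrightarrow> (G has_real_derivative (\<Sum>i. ?F' i y)) (at y within S)"
    using has_field_derivative_series[OF S, of ?F ?F' "\<lambda>x. \<Sum>i. ?F' i x" x] x by metis
  have "G y = (\<Sum>\<^sub>\<infinity>a\<in>A. f a y)" if "y \<in> S" for y
    using G(1)[OF that] suminf_nat_family[OF A sf(1)[OF that]] by (simp add: sums_iff)
  then have "((\<lambda>x. \<Sum>\<^sub>\<infinity>a\<in>A. f a x) has_real_derivative (\<Sum>i. ?F' i x)) (at x within S)"
    by (intro has_field_derivative_transform_within[OF G(2)[OF x] zero_less_one x])
  then show ?thesis
    by (simp only: suminf_nat_family[OF A sf(2)[OF x]])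
qed

text \<open>Only the L^1 norms are dominated, which yields convergence almost everywhere;
  summability at every point is a separate assumption, so that \<open>infsum\<close> agrees
  everywhere with the series over \<open>nat\<close>.\<close>

lemma integral_infsum:
  fixes f :: "'a \<Rightarrow> 'b \<Rightarrow> real"
  assumes A: "countable A" and f: "\<And>a. a \<in> A \<Longrightarrow> integrable M (f a)"
    and b: "b summable_on A" "\<And>a. a \<in> A \<Longrightarrow> (LINT x|M. \<bar>f a x\<bar>) \<le> b a"
    and s: "\<And>x. x \<in> space M \<Longrightarrow> (\<lambda>a. f a x) summable_on A"
  shows "integrable M (\<lambda>x. \<Sum>\<^sub>\<infinity>a\<in>A. f a x)"
    and "(LINT x|M. (\<Sum>\<^sub>\<infinity>a\<in>A. f a x)) = (\<Sum>\<^sub>\<infinity>a\<in>A. LINT x|M. f a x)"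
proof -
  let ?F = "\<lambda>n x. nat_family A (\<lambda>a. f a x) n"
  have int: "integrable M (?F n)" for n
    by (rule nat_family_cases[OF A, of n]) (use A f in auto)
  have AE: "AE x in M. summable (\<lambda>n. norm (?F n x))"
  proof (rule AE_I2)
    fix x assume "x \<in> space M"
    from s[OF this] have "(\<lambda>a. \<bar>f a x\<bar>) summable_on A"
      using summable_on_iff_abs_summable_on_real[of "\<lambda>a. f a x" A] by simp
    moreover have "nat_family A (\<lambda>a. \<bar>f a x\<bar>) = (\<lambda>n. norm (?F n x))"
    proof
      fix n show "nat_family A (\<lambda>a. \<bar>f a x\<bar>) n = norm (?F n x)"
        by (rule nat_family_cases[OF A, of n]) auto
    qed
    ultimately show "summable (\<lambda>n. norm (?F n x))"
      using summable_nat_family[OF A] by metis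
  qed
  have sum: "summable (\<lambda>n. LINT x|M. norm (?F n x))"
  proof (rule summable_comparison_test'[OF summable_nat_family[OF A b(1)], of 0])
    fix n show "norm (LINT x|M. norm (?F n x)) \<le> nat_family A b n"
      by (rule nat_family_cases[OF A, of n]) (use A b(2) in auto)
  qed
  have eq: "(\<Sum>n. ?F n x) = (\<Sum>\<^sub>\<infinity>a\<in>A. f a x)" if "x \<in> space M" for x
    by (rule suminf_nat_family[OF A s[OF that]])
  show "integrable M (\<lambda>x. \<Sum>\<^sub>\<infinity>a\<in>A. f a x)"
    using integrable_suminf[OF int AE sum] by (simp add: eq cong: Bochner_Integration.integrable_cong)
  have "(LINT x|M. (\<Sum>\<^sub>\<infinity>a\<in>A. f a x)) = (LINT x|M. (\<Sum>n. ?F n x))"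
    by (rule Bochner_Integration.integral_cong) (auto simp: eq)
  also have "\<dots> = (\<Sum>n. LINT x|M. ?F n x)"
    by (rule integral_suminf[OF int AE sum])
  also have "\<dots> = (\<Sum>n. nat_family A (\<lambda>a. LINT x|M. f a x) n)"
  proof (rule suminf_cong)
    fix n show "(LINT x|M. ?F n x) = nat_family A (\<lambda>a. LINT x|M. f a x) n"
      by (rule nat_family_cases[OF A, of n]) (use A in auto)
  qed
  also have "\<dots> = (\<Sum>\<^sub>\<infinity>a\<in>A. LINT x|M. f a x)"
  proof (rule suminf_nat_family[OF A summable_on_dominated[OF b(1)]])
    fix a assume "a \<in> A"
    then show "\<bar>LINT x|M. f a x\<bar> \<le> b a"
      using integral_abs_bound[of M "f a"] b(2)[of a] by linarith
  qed
  finally show "(LINT x|M. (\<Sum>\<^sub>\<infinity>a\<in>A. f a x)) = (\<Sum>\<^sub>\<infinity>a\<in>A. LINT x|M. f a x)" .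
qed

text \<open>In \<open>ennreal\<close> every family is summable, so finiteness of the sum is the
  whole information. It bounds all finite partial sums, which gives finite terms and real
  summability.\<close>

lemma ennreal_infsum_finiteD:
  fixes F :: "'a \<Rightarrow> ennreal"
  assumes "(\<Sum>\<^sub>\<infinity>a\<in>A. F a) < \<infinity>"
  shows "(\<lambda>a. enn2real (F a)) summable_on A" "a \<in> A \<Longrightarrow> F a = ennreal (enn2real (F a))"
proof -
  have le: "sum F X \<le> (\<Sum>\<^sub>\<infinity>a\<in>A. F a)" if "finite X" "X \<subseteq> A" for X
  proof -
    have "infsum F X \<le> infsum F A"
      by (rule infsum_mono_neutral) (use that in \<open>auto intro: nonneg_summable_on_complete\<close>)
    then show ?thesis using that by simp
  qed
  have fin: "F a < \<infinity>" if "a \<in> A" for a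
    using le[of "{a}"] that assms by (auto simp: le_less_trans)
  then show "a \<in> A \<Longrightarrow> F a = ennreal (enn2real (F a))"
    by (simp add: ennreal_enn2real)
  show "(\<lambda>a. enn2real (F a)) summable_on A"
  proof (rule nonneg_bdd_above_summable_on)
    show "bdd_above (sum (\<lambda>a. enn2real (F a)) ` {X. X \<subseteq> A \<and> finite X})"
    proof (rule bdd_aboveI2)
      fix X assume X: "X \<in> {X. X \<subseteq> A \<and> finite X}"
      have "(\<Sum>a\<in>X. enn2real (F a)) = enn2real (sum F X)"
        using X fin by (subst enn2real_sum) auto
      also have "\<dots> \<le> enn2real (\<Sum>\<^sub>\<infinity>a\<in>A. F a)"
        using le[of X] X assms by (intro enn2real_mono) auto
      finally show "(\<Sum>a\<in>X. enn2real (F a)) \<le> enn2real (\<Sum>\<^sub>\<infinity>a\<in>A. F a)" .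
    qed
  qed simp
qed

subsection \<open>Functions on a bounded interval\<close>

locale bounded_interval =
  fixes \<Delta> :: "real set"
  assumes interval: "is_interval \<Delta>" and bounded_dom: "bounded \<Delta>" and interior_ne: "interior \<Delta> \<noteq> {}"
begin

abbreviation "len \<equiv> measure lebesgue \<Delta>"

lemma convex_dom: "convex \<Delta>"
  using interval by (simp add: is_interval_convex_1)

lemma interior_subset': "x \<in> interior \<Delta> \<Longrightarrow> x \<in> \<Delta>"
  by (rule subsetD[OF interior_subset])

lemma dom_ne: "\<Delta> \<noteq> {}"
  using interior_ne by auto

lemma lmeasurable_dom: "\<Delta> \<in> lmeasurable"
  by (rule measurable_convex[OF convex_dom bounded_dom])

lemma sets_dom [measurable, simp]: "\<Delta> \<in> sets lebesgue"
  by (rule fmeasurableD[OF lmeasurable_dom])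

lemma sets_interior [measurable, simp]: "interior \<Delta> \<in> sets lebesgue"
  by (simp add: borel_open sets_completionI_sets)

lemma len_pos: "len > 0"
proof -
  have "\<not> negligible \<Delta>"
    using interior_ne by (simp add: negligible_convex_interior convex_dom)
  then have "len \<noteq> 0"
    using lmeasurable_dom by (auto simp: negligible_iff_measure)
  then show ?thesis by (simp add: zero_less_measure_iff)
qed

lemma segment_subset:
  assumes "x \<in> \<Delta>" "y \<in> \<Delta>"
  shows "{x..y} \<subseteq> \<Delta>"
proof
  fix z assume "z \<in> {x..y}"
  then show "z \<in> \<Delta>"
    by (intro mem_is_interval_1_I[OF interval assms]) auto
qed

text \<open>Lets the Lebesgue measure of the interval double as its diameter, so that one constant
  serves integrals and Lipschitz estimates.\<close>

lemma dist_le_len: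
  assumes "x \<in> \<Delta>" "y \<in> \<Delta>"
  shows "\<bar>x - y\<bar> \<le> len"
proof -
  have "measure lebesgue {min x y..max x y} \<le> len"
    by (rule measure_mono_fmeasurable[OF segment_subset _ lmeasurable_dom])
      (use assms in \<open>auto simp: min_def max_def\<close>)
  then show ?thesis by (simp add: min_def max_def split: if_splits)
qed

lemma open_segment_interior: "x \<in> \<Delta> \<Longrightarrow> y \<in> \<Delta> \<Longrightarrow> {x<..<y} \<subseteq> interior \<Delta>"
  using segment_subset[of x y] by (intro interior_maximal) auto

lemma dom_subset_closure: "x \<in> \<Delta> \<Longrightarrow> x \<in> closure (interior \<Delta>)"
  using convex_closure_interior[OF convex_dom interior_ne] closure_subset[of \<Delta>] by auto

lemma within_interior_ne_bot: "x \<in> \<Delta> \<Longrightarrow> at x within interior \<Delta> \<noteq> bot"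
proof -
  assume x: "x \<in> \<Delta>"
  have "x islimpt interior \<Delta>"
  proof (cases "x \<in> interior \<Delta>")
    case True
    then show ?thesis using interior_limit_point[of x "interior \<Delta>"] by simp
  next
    case False
    then show ?thesis using dom_subset_closure[OF x] by (simp add: closure_def)
  qed
  then show ?thesis by (simp add: trivial_limit_within)
qed

lemma within_ne_bot: "x \<in> \<Delta> \<Longrightarrow> at x within \<Delta> \<noteq> bot"
  using within_interior_ne_bot[of x] at_le[OF interior_subset[of \<Delta>], of x] le_bot[of "at x within interior \<Delta>"]
  by auto

text \<open>Facts derived from the map \<open>T\<close> are known only at interior points. Each end
  point in \<Delta> is a limit of such points, so closed inequalities between continuous functions
  extend to it.\<close>

lemma nonneg_from_interior:
  assumes "continuous_on \<Delta> f" "\<And>x. x \<in> interior \<Delta> \<Longrightarrow> 0 \<le> f x" "x \<in> \<Delta>"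
  shows "(0::real) \<le> f x"
proof (rule tendsto_lowerbound)
  show "(f \<longlongrightarrow> f x) (at x within interior \<Delta>)"
    by (rule tendsto_within_subset[OF _ interior_subset])
      (use assms(1,3) in \<open>auto simp: continuous_on_def\<close>)
  show "\<forall>\<^sub>F y in at x within interior \<Delta>. 0 \<le> f y"
    using assms(2) by (simp add: eventually_at_filter)
  show "at x within interior \<Delta> \<noteq> bot"
    by (rule within_interior_ne_bot[OF assms(3)])
qed

lemma negligible_boundary: "negligible (\<Delta> - interior \<Delta>)"
proof (rule negligible_subset[OF negligible_convex_frontier[OF convex_dom]])
  show "\<Delta> - interior \<Delta> \<subseteq> frontier \<Delta>"
    using closure_subset by (auto simp: frontier_def)
qed

lemma AE_interior: "AE x in lebesgue_on \<Delta>. x \<in> interior \<Delta>"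
proof -
  have "\<Delta> - interior \<Delta> \<in> null_sets lebesgue"
    using negligible_boundary by (simp add: negligible_iff_null_sets)
  then have "AE x in lebesgue. x \<notin> \<Delta> - interior \<Delta>"
    by (rule AE_not_in)
  then show ?thesis
    by (auto simp: AE_restrict_space_iff)
qed

lemma finite_measure_dom: "finite_measure (lebesgue_on \<Delta>)"
  by (rule finite_measure_lebesgue_on[OF lmeasurable_dom])

lemma integrable_bounded:
  assumes "f \<in> borel_measurable (lebesgue_on \<Delta>)" "\<And>x. x \<in> \<Delta> \<Longrightarrow> \<bar>f x\<bar> \<le> B"
  shows "integrable (lebesgue_on \<Delta>) (f :: real \<Rightarrow> real)"
  by (rule finite_measure.integrable_const_bound[OF finite_measure_dom _ assms(1), of B])
    (use assms(2) in auto)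

lemma integral_const: "(LINT x|lebesgue_on \<Delta>. c) = c * len"
  by (simp add: measure_restrict_space mult.commute)

lemma measure_dom: "measure (lebesgue_on \<Delta>) \<Delta> = len"
  by (simp add: measure_restrict_space)

lemma abs_integral_le:
  assumes "f \<in> borel_measurable (lebesgue_on \<Delta>)" "\<And>x. x \<in> \<Delta> \<Longrightarrow> \<bar>f x\<bar> \<le> B"
  shows "(LINT x|lebesgue_on \<Delta>. \<bar>f x\<bar>) \<le> B * len"
proof -
  have "(LINT x|lebesgue_on \<Delta>. \<bar>f x\<bar>) \<le> (LINT x|lebesgue_on \<Delta>. B)"
    using integrable_bounded[OF assms] finite_measure.integrable_const[OF finite_measure_dom, of B] assms(2)
    by (intro integral_mono) auto
  then show ?thesis by (simp only: integral_const)
qed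

lemma continuous_measurable:
  "continuous_on \<Delta> f \<Longrightarrow> f \<in> borel_measurable (lebesgue_on \<Delta>)" for f :: "real \<Rightarrow> real"
  by (rule continuous_imp_measurable_on_sets_lebesgue) auto

lemma lipschitz_integrable:
  assumes "K-lipschitz_on \<Delta> (f :: real \<Rightarrow> real)"
  shows "integrable (lebesgue_on \<Delta>) f"
proof -
  obtain x0 where x0: "x0 \<in> \<Delta>" using dom_ne by auto
  have "\<bar>f x\<bar> \<le> \<bar>f x0\<bar> + K * len" if "x \<in> \<Delta>" for x
  proof -
    have "\<bar>f x - f x0\<bar> \<le> K * \<bar>x - x0\<bar>"
      using lipschitz_onD[OF assms that x0] by (simp add: dist_real_def)
    also have "\<dots> \<le> K * len"
      using dist_le_len[OF that x0] lipschitz_on_nonneg[OF assms] by (intro mult_left_mono)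
    finally show ?thesis by linarith
  qed
  then show ?thesis
    by (rule integrable_bounded[OF continuous_measurable[OF lipschitz_on_continuous_on[OF assms]]])
qed

lemma lipschitz_bounded:
  assumes "K-lipschitz_on \<Delta> (f :: real \<Rightarrow> real)"
  obtains B where "0 \<le> B" "\<And>x. x \<in> \<Delta> \<Longrightarrow> \<bar>f x\<bar> \<le> B"
proof -
  have "bounded (f ` \<Delta>)"
    by (rule bounded_uniformly_continuous_image[OF lipschitz_on_uniformly_continuous[OF assms] bounded_dom])
  then obtain B where B: "\<And>x. x \<in> \<Delta> \<Longrightarrow> \<bar>f x\<bar> \<le> B"
    by (auto simp: bounded_iff)
  have "0 \<le> B" using B dom_ne by (meson abs_ge_zero ex_in_conv order_trans)
  with B that show ?thesis by blast
qed

text \<open>Otherwise the set of interior points where \<open>f\<close> is negative would be open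
  and nonempty, hence not null.\<close>

lemma nonneg_from_AE:
  assumes "continuous_on \<Delta> f" "AE x in lebesgue_on \<Delta>. 0 \<le> f x" "x \<in> \<Delta>"
  shows "(0::real) \<le> f x"
proof (rule nonneg_from_interior[OF assms(1) _ assms(3)], rule ccontr)
  fix y assume y: "y \<in> interior \<Delta>" "\<not> 0 \<le> f y"
  let ?U = "interior \<Delta> \<inter> f -` {..<0}"
  have "open ?U"
    using continuous_on_subset[OF assms(1) interior_subset] continuous_on_open_vimage[of "interior \<Delta>" f]
    by (metis inf_commute open_interior open_lessThan)
  moreover have "?U \<noteq> {}" using y by auto
  moreover have "negligible ?U"
  proof -
    have "AE x in lebesgue. x \<in> \<Delta> \<longrightarrow> 0 \<le> f x"
      using assms(2) by (simp add: AE_restrict_space_iff)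
    then have "AE x in lebesgue. x \<notin> ?U"
      by eventually_elim (use interior_subset in auto)
    then show ?thesis
      using \<open>open ?U\<close> by (subst negligible_iff_null_sets)
        (auto simp: AE_iff_null_sets borel_open sets_completionI_sets)
  qed
  ultimately show False by (simp add: open_not_negligible)
qed

lemma eq_from_AE:
  assumes "continuous_on \<Delta> f" "continuous_on \<Delta> g" "AE x in lebesgue_on \<Delta>. f x = g x" "x \<in> \<Delta>"
  shows "f x = (g x :: real)"
proof -
  have "AE x in lebesgue_on \<Delta>. 0 \<le> f x - g x" "AE x in lebesgue_on \<Delta>. 0 \<le> g x - f x"
    using assms(3) by (eventually_elim, simp)+
  from nonneg_from_AE[OF continuous_on_diff[OF assms(1,2)] this(1) assms(4)]
    nonneg_from_AE[OF continuous_on_diff[OF assms(2,1)] this(2) assms(4)]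
  have "0 \<le> f x - g x" "0 \<le> g x - f x" .
  then show ?thesis by simp
qed

lemma integral_cong_dom:
  "(\<And>x. x \<in> \<Delta> \<Longrightarrow> f x = g x) \<Longrightarrow> (LINT x|lebesgue_on \<Delta>. f x) = (LINT x|lebesgue_on \<Delta>. g x)"
  by (rule Bochner_Integration.integral_cong) auto

section \<open>Derivatives within the interval and the spaces \<open>C_b\<close>\<close>

lemma dx_eqI:
  "x \<in> \<Delta> \<Longrightarrow> (f has_real_derivative d) (at x within \<Delta>) \<Longrightarrow> dx \<Delta> f x = d"
  unfolding dx_def by (rule vector_derivative_within[OF within_ne_bot])
    (auto simp: has_real_derivative_iff_has_vector_derivative)

lemma dx_works:
  "f differentiable (at x within \<Delta>) \<Longrightarrow> (f has_real_derivative dx \<Delta> f x) (at x within \<Delta>)"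
  by (simp add: dx_def has_real_derivative_iff_has_vector_derivative vector_derivative_works)

lemma differentiable_cong:
  assumes "\<And>x. x \<in> \<Delta> \<Longrightarrow> f x = (f' x :: real)" "x \<in> \<Delta>"
  shows "f differentiable (at x within \<Delta>) \<longleftrightarrow> f' differentiable (at x within \<Delta>)"
  using assms differentiable_transform_within[OF _ zero_less_one assms(2)] by metis

lemma dx_cong:
  assumes "\<And>x. x \<in> \<Delta> \<Longrightarrow> f x = f' x" "x \<in> \<Delta>"
  shows "dx \<Delta> f x = dx \<Delta> f' x"
proof -
  have "(f has_vector_derivative d) (at x within \<Delta>) \<longleftrightarrow> (f' has_vector_derivative d) (at x within \<Delta>)" for d
    using assms by (intro has_vector_derivative_cong_ev) (auto simp: eventually_at_filter)
  then show ?thesis by (simp add: dx_def vector_derivative_def)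
qed

text \<open>Many identities below hold on \<Delta> only; since derivatives within \<Delta> ignore
  values elsewhere, such identities still transfer membership in \<open>C_k\<close> and
  \<open>C_b\<close>.\<close>

lemma dx_funpow_cong:
  assumes "\<And>x. x \<in> \<Delta> \<Longrightarrow> f x = f' x" "x \<in> \<Delta>"
  shows "(dx \<Delta> ^^ j) f x = (dx \<Delta> ^^ j) f' x"
  using assms(2)
proof (induction j arbitrary: x)
  case (Suc j)
  show ?case using Suc.prems by (simp add: dx_cong[OF Suc.IH])
qed (simp add: assms)

lemma C_k_cong:
  assumes "\<And>x. x \<in> \<Delta> \<Longrightarrow> f x = f' x"
  shows "f \<in> C_k k \<Delta> \<longleftrightarrow> f' \<in> C_k k \<Delta>"
proof -
  have "continuous_on \<Delta> ((dx \<Delta> ^^ j) f) \<longleftrightarrow> continuous_on \<Delta> ((dx \<Delta> ^^ j) f')" for j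
    by (rule continuous_on_cong) (use dx_funpow_cong[OF assms] in auto)
  moreover have "(dx \<Delta> ^^ j) f differentiable (at x within \<Delta>) \<longleftrightarrow>
      (dx \<Delta> ^^ j) f' differentiable (at x within \<Delta>)" if "x \<in> \<Delta>" for j x
    by (rule differentiable_cong[OF dx_funpow_cong[OF assms] that])
  ultimately show ?thesis by (simp add: C_k_def)
qed

lemma C_b_cong:
  assumes "\<And>x. x \<in> \<Delta> \<Longrightarrow> f x = f' x"
  shows "f \<in> C_b k \<Delta> \<longleftrightarrow> f' \<in> C_b k \<Delta>"
proof -
  have "(dx \<Delta> ^^ j) f ` \<Delta> = (dx \<Delta> ^^ j) f' ` \<Delta>" for j
    by (rule image_cong) (use dx_funpow_cong[OF assms] in auto)
  then show ?thesis using C_k_cong[OF assms] by (simp add: C_b_def)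
qed

lemma C_k_has_derivative:
  assumes "f \<in> C_k k \<Delta>" "j < k" "x \<in> \<Delta>"
  shows "((dx \<Delta> ^^ j) f has_real_derivative (dx \<Delta> ^^ Suc j) f x) (at x within \<Delta>)"
  using assms by (auto simp: C_k_def intro: dx_works)

lemma C_k_continuous:
  "f \<in> C_k k \<Delta> \<Longrightarrow> j \<le> k \<Longrightarrow> continuous_on \<Delta> ((dx \<Delta> ^^ j) f)"
  by (auto simp: C_k_def)

lemma C_b_bounded:
  assumes "f \<in> C_b k \<Delta>" "j \<le> k"
  obtains B where "0 \<le> B" "\<And>x. x \<in> \<Delta> \<Longrightarrow> \<bar>(dx \<Delta> ^^ j) f x\<bar> \<le> B"
proof -
  have "bounded ((dx \<Delta> ^^ j) f ` \<Delta>)" using assms by (auto simp: C_b_def)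
  then obtain B where B: "\<And>x. x \<in> \<Delta> \<Longrightarrow> \<bar>(dx \<Delta> ^^ j) f x\<bar> \<le> B"
    by (auto simp: bounded_iff)
  have "0 \<le> B" using B dom_ne by (meson abs_ge_zero ex_in_conv order_trans)
  with B that show ?thesis by blast
qed

lemma lipschitz_from_derivative:
  assumes "\<And>x. x \<in> \<Delta> \<Longrightarrow> (f has_real_derivative f' x) (at x within \<Delta>)"
    and "\<And>x. x \<in> \<Delta> \<Longrightarrow> \<bar>f' x\<bar> \<le> B"
  shows "B-lipschitz_on \<Delta> f"
proof (rule lipschitz_onI)
  show "dist (f x) (f y) \<le> B * dist x y" if "x \<in> \<Delta>" "y \<in> \<Delta>" for x y
    using field_differentiable_bound[OF convex_dom assms(1), of B x y] assms(2) that
    by (simp add: dist_real_def)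
  show "0 \<le> B"
    using assms(2) dom_ne by (meson abs_ge_zero ex_in_conv order_trans)
qed

text \<open>Turns the exponential decay of Lipschitz constants into decay of derivatives.\<close>

lemma derivative_le_lipschitz:
  assumes "K-lipschitz_on \<Delta> f" "x \<in> \<Delta>" "(f has_real_derivative d) (at x within \<Delta>)"
  shows "\<bar>d\<bar> \<le> K"
proof (rule tendsto_upperbound)
  show "((\<lambda>y. \<bar>(f y - f x) / (y - x)\<bar>) \<longlongrightarrow> \<bar>d\<bar>) (at x within \<Delta>)"
    using assms(3) by (intro tendsto_rabs) (simp add: has_field_derivative_iff)
  show "\<forall>\<^sub>F y in at x within \<Delta>. \<bar>(f y - f x) / (y - x)\<bar> \<le> K"
    using lipschitz_onD[OF assms(1) _ assms(2)]
    by (auto simp: eventually_at_filter dist_real_def divide_simps)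
  show "at x within \<Delta> \<noteq> bot" by (rule within_ne_bot[OF assms(2)])
qed

lemma all_le_1: "(\<forall>j\<le>Suc 0. Q j) \<longleftrightarrow> Q 0 \<and> Q (Suc 0)"
  by (auto simp: le_Suc_eq)

text \<open>A bound for the derivative suffices: it makes \<open>f\<close> Lipschitz, hence bounded
  on the bounded interval.\<close>

lemma C_b_1I:
  assumes der: "\<And>x. x \<in> \<Delta> \<Longrightarrow> (f has_real_derivative f' x) (at x within \<Delta>)"
    and cont: "continuous_on \<Delta> f'" and bnd: "\<And>x. x \<in> \<Delta> \<Longrightarrow> \<bar>f' x\<bar> \<le> B"
  shows "f \<in> C_b 1 \<Delta>"
proof -
  have dx: "dx \<Delta> f x = f' x" if "x \<in> \<Delta>" for x
    by (rule dx_eqI[OF that der[OF that]])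
  have f: "continuous_on \<Delta> f"
    using der by (rule DERIV_continuous_on)
  have lip: "B-lipschitz_on \<Delta> f" by (rule lipschitz_from_derivative[OF der bnd])
  have bf: "bounded (f ` \<Delta>)"
    by (rule bounded_uniformly_continuous_image[OF lipschitz_on_uniformly_continuous[OF lip] bounded_dom])
  have "bounded (dx \<Delta> f ` \<Delta>)" "continuous_on \<Delta> (dx \<Delta> f)"
    using bnd dx cont by (auto simp: bounded_iff cong: continuous_on_cong)
  moreover have "f differentiable (at x within \<Delta>)" if "x \<in> \<Delta>" for x
    using der[OF that] by (auto simp: has_field_derivative_def differentiable_def)
  ultimately show ?thesis
    using f bf by (simp add: C_b_def C_k_def all_le_1)
qed

lemma C_b_1D:
  assumes "f \<in> C_b 1 \<Delta>"
  shows "x \<in> \<Delta> \<Longrightarrow> (f has_real_derivative dx \<Delta> f x) (at x within \<Delta>)"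
    and "continuous_on \<Delta> (dx \<Delta> f)" and "\<exists>K. K-lipschitz_on \<Delta> f"
    and "\<exists>B. \<forall>x\<in>\<Delta>. \<bar>dx \<Delta> f x\<bar> \<le> B"
proof -
  have ck: "f \<in> C_k 1 \<Delta>" using assms by (simp add: C_b_def)
  have der: "(f has_real_derivative dx \<Delta> f x) (at x within \<Delta>)" if "x \<in> \<Delta>" for x
    using C_k_has_derivative[OF ck, of 0 x] that by simp
  obtain B where B: "\<And>x. x \<in> \<Delta> \<Longrightarrow> \<bar>dx \<Delta> f x\<bar> \<le> B"
    using C_b_bounded[OF assms, of 1] by auto
  show "x \<in> \<Delta> \<Longrightarrow> (f has_real_derivative dx \<Delta> f x) (at x within \<Delta>)" by (rule der)
  show "continuous_on \<Delta> (dx \<Delta> f)" using C_k_continuous[OF ck, of 1] by simp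
  show "\<exists>K. K-lipschitz_on \<Delta> f" using lipschitz_from_derivative[OF der B] by blast
  show "\<exists>B. \<forall>x\<in>\<Delta>. \<bar>dx \<Delta> f x\<bar> \<le> B" using B by blast
qed

lemma C_b_2D:
  assumes "u \<in> C_b 2 \<Delta>"
  shows "x \<in> \<Delta> \<Longrightarrow> (u has_real_derivative dx \<Delta> u x) (at x within \<Delta>)"
    and "x \<in> \<Delta> \<Longrightarrow> (dx \<Delta> u has_real_derivative dx \<Delta> (dx \<Delta> u) x) (at x within \<Delta>)"
    and "continuous_on \<Delta> (dx \<Delta> (dx \<Delta> u))"
    and "\<exists>M\<ge>0. \<forall>x\<in>\<Delta>. \<bar>u x\<bar> \<le> M \<and> \<bar>dx \<Delta> u x\<bar> \<le> M \<and> \<bar>dx \<Delta> (dx \<Delta> u) x\<bar> \<le> M"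
proof -
  have ck: "u \<in> C_k 2 \<Delta>" using assms by (simp add: C_b_def)
  show "x \<in> \<Delta> \<Longrightarrow> (u has_real_derivative dx \<Delta> u x) (at x within \<Delta>)"
    using C_k_has_derivative[OF ck, of 0 x] by simp
  show "x \<in> \<Delta> \<Longrightarrow> (dx \<Delta> u has_real_derivative dx \<Delta> (dx \<Delta> u) x) (at x within \<Delta>)"
    using C_k_has_derivative[OF ck, of 1 x] by simp
  show "continuous_on \<Delta> (dx \<Delta> (dx \<Delta> u))"
    using C_k_continuous[OF ck, of 2] by (simp add: numeral_2_eq_2)
  obtain B0 where B0: "0 \<le> B0" "\<And>x. x \<in> \<Delta> \<Longrightarrow> \<bar>u x\<bar> \<le> B0"
    using C_b_bounded[OF assms, of 0] by auto
  obtain B1 where B1: "0 \<le> B1" "\<And>x. x \<in> \<Delta> \<Longrightarrow> \<bar>dx \<Delta> u x\<bar> \<le> B1"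
    using C_b_bounded[OF assms, of 1] by auto
  obtain B2 where B2: "0 \<le> B2" "\<And>x. x \<in> \<Delta> \<Longrightarrow> \<bar>dx \<Delta> (dx \<Delta> u) x\<bar> \<le> B2"
    using C_b_bounded[OF assms, of 2] by (auto simp: numeral_2_eq_2)
  show "\<exists>M\<ge>0. \<forall>x\<in>\<Delta>. \<bar>u x\<bar> \<le> M \<and> \<bar>dx \<Delta> u x\<bar> \<le> M \<and> \<bar>dx \<Delta> (dx \<Delta> u) x\<bar> \<le> M"
  proof (intro exI[of _ "B0 + B1 + B2"] conjI ballI)
    fix x assume x: "x \<in> \<Delta>"
    show "\<bar>u x\<bar> \<le> B0 + B1 + B2" using B0(2)[OF x] B1(1) B2(1) by linarith
    show "\<bar>dx \<Delta> u x\<bar> \<le> B0 + B1 + B2" using B1(2)[OF x] B0(1) B2(1) by linarith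
    show "\<bar>dx \<Delta> (dx \<Delta> u) x\<bar> \<le> B0 + B1 + B2" using B2(2)[OF x] B0(1) B1(1) by linarith
  qed (use B0(1) B1(1) B2(1) in linarith)
qed

text \<open>A common Lipschitz constant reduces uniform closeness to closeness on a finite net,
  which exists because a bounded interval is totally bounded even when it is not closed.\<close>

lemma uniform_limit_lipschitz:
  fixes f :: "'a \<Rightarrow> real \<Rightarrow> real"
  assumes lip: "\<forall>\<^sub>F t in F. K-lipschitz_on \<Delta> (f t)" and lip': "K-lipschitz_on \<Delta> l"
    and lim: "\<And>x. x \<in> \<Delta> \<Longrightarrow> ((\<lambda>t. f t x) \<longlongrightarrow> l x) F"
  shows "uniform_limit \<Delta> f l F"
proof (rule uniform_limitI)
  fix e :: real assume e: "e > 0"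
  have K: "K \<ge> 0" by (rule lipschitz_on_nonneg[OF lip'])
  \<comment> \<open>The summand 1 keeps the denominator positive when \<open>K\<close> is 0; with
    this radius the oscillation between a point and a nearby net point is at most a third of
    \<open>e\<close>.\<close>
  define r where "r = e / (3 * (K + 1))"
  have r: "r > 0" "K * r \<le> e / 3"
    using e K by (auto simp: r_def field_simps)
  \<comment> \<open>The balls are centred in \<Delta> itself, so that the pointwise limit is
    available at their centres, while compactness is that of the closure.\<close>
  have "closure \<Delta> \<subseteq> (\<Union>x\<in>\<Delta>. ball x r)"
    using closure_approachable[of _ \<Delta>] r(1) by fastforce
  then obtain X where X: "X \<subseteq> \<Delta>" "finite X" "closure \<Delta> \<subseteq> (\<Union>x\<in>X. ball x r)"
    using compactE_image[of "closure \<Delta>" \<Delta> "\<lambda>x. ball x r"] bounded_dom by auto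
  have "\<forall>\<^sub>F t in F. \<forall>x\<in>X. dist (f t x) (l x) < e / 3"
    using X e lim by (intro eventually_ball_finite ballI tendstoD) auto
  then show "\<forall>\<^sub>F t in F. \<forall>x\<in>\<Delta>. dist (f t x) (l x) < e"
    using lip
  proof eventually_elim
    case (elim t)
    show ?case
    proof
      fix x assume x: "x \<in> \<Delta>"
      then obtain y where y: "y \<in> X" "dist y x < r"
        using X(3) closure_subset[of \<Delta>] by fastforce
      then have "y \<in> \<Delta>" using X by auto
      have "dist (f t x) (f t y) \<le> K * r" "dist (l y) (l x) \<le> K * r"
        using lipschitz_onD[OF elim(2) x \<open>y \<in> \<Delta>\<close>] lipschitz_onD[OF lip' \<open>y \<in> \<Delta>\<close> x]
          mult_left_mono[OF less_imp_le[OF y(2)] K] by (auto simp: dist_commute)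
      then have "dist (f t x) (f t y) \<le> e / 3" "dist (l y) (l x) \<le> e / 3"
        using r by auto
      moreover have "dist (f t y) (l y) < e / 3" using elim y by auto
      ultimately show "dist (f t x) (l x) < e"
        unfolding dist_real_def by linarith
    qed
  qed
qed

end

subsection \<open>Exponential decay of the transfer operator on Lipschitz functions of zero mean\<close>

text \<open>The following constants depend on the branches only through the contraction rate \<open>l\<close>, the
  distortion \<open>D\<close> and the length \<open>d\<close> of the interval; hence they are uniform along a family of maps.\<close>

definition cone_exponent :: "real \<Rightarrow> real \<Rightarrow> real" where
  "cone_exponent l D = (D + 1) / (1 - l)"

text \<open>One minus the fraction of the mean that is split off as a constant in each step, the
  fraction of \<open>cone_minus_const\<close> with \<open>a\<close> the cone exponent.\<close>

definition decay_rate :: "real \<Rightarrow> real \<Rightarrow> real \<Rightarrow> real" where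
  "decay_rate l D d = 1 - exp (- 2 * cone_exponent l D * d) / cone_exponent l D"

text \<open>The 2 counts the two cone functions whose difference represents a mean-zero function,
  the exponential comes from \<open>cone_lipschitz\<close>, and the last factor is the cone exponent
  times the common mean of the two functions when the Lipschitz constant is 1.\<close>

definition decay_const :: "real \<Rightarrow> real \<Rightarrow> real \<Rightarrow> real" where
  "decay_const l D d = 2 * exp (2 * cone_exponent l D * d) * (cone_exponent l D * d + 1)"

text \<open>The map itself does not occur: decay comes from contraction and bounded distortion of
  the inverse branches together with preservation of the integral, which
  \<open>integral_PF_bounded\<close> records.\<close>

locale contracting_branches = bounded_interval +
  fixes \<Omega> :: "'w set" and g :: "'w \<Rightarrow> real \<Rightarrow> real" and s :: "'w \<Rightarrow> real" and l D :: real
  assumes countable_index: "countable \<Omega>"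
    and branch_in: "\<omega> \<in> \<Omega> \<Longrightarrow> x \<in> \<Delta> \<Longrightarrow> g \<omega> x \<in> \<Delta>"
    and contraction: "\<omega> \<in> \<Omega> \<Longrightarrow> x \<in> \<Delta> \<Longrightarrow> y \<in> \<Delta> \<Longrightarrow> \<bar>g \<omega> x - g \<omega> y\<bar> \<le> l * \<bar>x - y\<bar>"
    and l_nonneg: "0 \<le> l" and l_less: "l < 1" and D_nonneg: "0 \<le> D"
    and weight_le: "\<omega> \<in> \<Omega> \<Longrightarrow> x \<in> \<Delta> \<Longrightarrow> \<bar>dx \<Delta> (g \<omega>) x\<bar> \<le> s \<omega>"
    and weight_summable: "s summable_on \<Omega>"
    and distortion: "\<omega> \<in> \<Omega> \<Longrightarrow> x \<in> \<Delta> \<Longrightarrow> y \<in> \<Delta> \<Longrightarrow>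
          \<bar>dx \<Delta> (g \<omega>) x\<bar> \<le> exp (D * \<bar>x - y\<bar>) * \<bar>dx \<Delta> (g \<omega>) y\<bar>"
    and integral_PF_bounded: "f \<in> borel_measurable (lebesgue_on \<Delta>) \<Longrightarrow> (\<And>x. x \<in> \<Delta> \<Longrightarrow> \<bar>f x\<bar> \<le> B) \<Longrightarrow>
          (LINT x|lebesgue_on \<Delta>. PF \<Delta> \<Omega> g f x) = (LINT x|lebesgue_on \<Delta>. f x)"
begin

abbreviation "L \<equiv> PF \<Delta> \<Omega> g"
abbreviation "mean f \<equiv> (LINT x|lebesgue_on \<Delta>. f x) / len"
abbreviation "a0 \<equiv> cone_exponent l D"
abbreviation "rate \<equiv> decay_rate l D len"
abbreviation "dconst \<equiv> decay_const l D len"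

lemma a0_ge_1: "1 \<le> a0"
  using l_nonneg l_less D_nonneg by (simp add: cone_exponent_def field_simps)

text \<open>The exponent is the fixed point of \<open>a \<mapsto> l * a + D + 1\<close>: the
  operator improves \<open>a0\<close> to \<open>l * a0 + D\<close>, and the gap of 1 is what
  \<open>cone_minus_const\<close> spends.\<close>

lemma a0_step: "l * a0 + D + 1 = a0"
  using l_less by (simp add: cone_exponent_def field_simps)

lemma rate_nonneg: "0 \<le> rate" and rate_less: "rate < 1"
proof -
  have "exp (- 2 * a0 * len) \<le> 1" using a0_ge_1 len_pos by simp
  then have "exp (- 2 * a0 * len) \<le> a0" using a0_ge_1 by (rule order_trans)
  then show "0 \<le> rate" using a0_ge_1 unfolding decay_rate_def by (simp add: divide_le_eq)
  show "rate < 1" using a0_ge_1 by (simp add: decay_rate_def)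
qed

lemma dconst_nonneg: "0 \<le> dconst"
  using a0_ge_1 len_pos by (simp add: decay_const_def)

section \<open>Elementary properties of the transfer operator\<close>

lemma PF_cong:
  assumes "\<And>x. x \<in> \<Delta> \<Longrightarrow> f x = f' x" "x \<in> \<Delta>"
  shows "L f x = L f' x"
  unfolding PF_def using assms branch_in by (intro infsum_cong) auto

lemma PF_funpow_cong:
  assumes "\<And>x. x \<in> \<Delta> \<Longrightarrow> f x = f' x" "x \<in> \<Delta>"
  shows "(L ^^ n) f x = (L ^^ n) f' x"
  using assms(2)
proof (induction n arbitrary: x)
  case (Suc n)
  then show ?case using PF_cong[OF Suc.IH] by simp
qed (simp add: assms)

lemma PF_summable:
  assumes "\<And>x. x \<in> \<Delta> \<Longrightarrow> \<bar>f x\<bar> \<le> B" "x \<in> \<Delta>"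
  shows "(\<lambda>\<omega>. f (g \<omega> x) * \<bar>dx \<Delta> (g \<omega>) x\<bar>) summable_on \<Omega>"
proof (rule summable_on_dominated)
  show "(\<lambda>\<omega>. B * s \<omega>) summable_on \<Omega>"
    by (rule summable_on_cmult_right[OF weight_summable])
  show "\<bar>f (g \<omega> x) * \<bar>dx \<Delta> (g \<omega>) x\<bar>\<bar> \<le> B * s \<omega>" if "\<omega> \<in> \<Omega>" for \<omega>
    unfolding abs_mult abs_abs
    by (rule mult_mono) (use assms branch_in weight_le that abs_ge_zero order_trans in blast)+
qed

lemma PF_abs_le:
  assumes "\<And>x. x \<in> \<Delta> \<Longrightarrow> \<bar>f x\<bar> \<le> B" "x \<in> \<Delta>"
  shows "\<bar>L f x\<bar> \<le> B * infsum s \<Omega>"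
proof -
  have "\<bar>L f x\<bar> \<le> (\<Sum>\<^sub>\<infinity>\<omega>\<in>\<Omega>. B * s \<omega>)"
    unfolding PF_def
  proof (rule abs_infsum_le)
    show "(\<lambda>\<omega>. B * s \<omega>) summable_on \<Omega>"
      by (rule summable_on_cmult_right[OF weight_summable])
    show "\<bar>f (g \<omega> x) * \<bar>dx \<Delta> (g \<omega>) x\<bar>\<bar> \<le> B * s \<omega>" if "\<omega> \<in> \<Omega>" for \<omega>
      unfolding abs_mult abs_abs
      by (rule mult_mono) (use assms branch_in weight_le that abs_ge_zero order_trans in blast)+
  qed
  then show ?thesis by (simp add: infsum_cmult_right')
qed

lemma PF_linear:
  assumes "\<And>x. x \<in> \<Delta> \<Longrightarrow> \<bar>f x\<bar> \<le> B" "\<And>x. x \<in> \<Delta> \<Longrightarrow> \<bar>f' x\<bar> \<le> B'" "x \<in> \<Delta>"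
  shows "L (\<lambda>x. f x + c * f' x) x = L f x + c * L f' x"
proof -
  have 1: "(\<lambda>\<omega>. f (g \<omega> x) * \<bar>dx \<Delta> (g \<omega>) x\<bar>) summable_on \<Omega>"
    by (rule PF_summable[OF assms(1,3)])
  have 2: "(\<lambda>\<omega>. c * (f' (g \<omega> x) * \<bar>dx \<Delta> (g \<omega>) x\<bar>)) summable_on \<Omega>"
    by (rule summable_on_cmult_right[OF PF_summable[OF assms(2,3)]])
  show ?thesis
    unfolding PF_def infsum_cmult_right'[symmetric] infsum_add[OF 1 2, symmetric]
    by (simp add: algebra_simps)
qed

lemma PF_diff:
  assumes "\<And>x. x \<in> \<Delta> \<Longrightarrow> \<bar>f x\<bar> \<le> B" "\<And>x. x \<in> \<Delta> \<Longrightarrow> \<bar>f' x\<bar> \<le> B'" "x \<in> \<Delta>"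
  shows "L (\<lambda>x. f x - f' x) x = L f x - L f' x"
  using PF_linear[OF assms, where c = "-1"] by simp

lemma lipschitz_near_mean:
  assumes "K-lipschitz_on \<Delta> f" "x \<in> \<Delta>"
  shows "\<bar>f x - mean f\<bar> \<le> K * len"
proof -
  have int: "integrable (lebesgue_on \<Delta>) f" by (rule lipschitz_integrable[OF assms(1)])
  have c: "integrable (lebesgue_on \<Delta>) (\<lambda>_. c :: real)" for c
    by (rule finite_measure.integrable_const[OF finite_measure_dom])
  have "\<bar>f x - f y\<bar> \<le> K * len" if "y \<in> \<Delta>" for y
    using lipschitz_onD[OF assms(1,2) that] dist_le_len[OF assms(2) that] lipschitz_on_nonneg[OF assms(1)]
      mult_left_mono[of "\<bar>x - y\<bar>" len K] by (auto simp: dist_real_def)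
  then have "(LINT y|lebesgue_on \<Delta>. f x - K * len) \<le> (LINT y|lebesgue_on \<Delta>. f y)"
      "(LINT y|lebesgue_on \<Delta>. f y) \<le> (LINT y|lebesgue_on \<Delta>. f x + K * len)"
    by (intro integral_mono int c; fastforce simp: abs_le_iff)+
  then have "f x - K * len \<le> mean f" "mean f \<le> f x + K * len"
    using len_pos unfolding integral_const by (auto simp: field_simps)
  then show ?thesis by (simp add: abs_le_iff)
qed

definition cone :: "real \<Rightarrow> (real \<Rightarrow> real) \<Rightarrow> bool" where
  "cone a f \<longleftrightarrow> (\<forall>x\<in>\<Delta>. 0 \<le> f x) \<and> (\<forall>x\<in>\<Delta>. \<forall>y\<in>\<Delta>. f x \<le> exp (a * \<bar>x - y\<bar>) * f y)"

lemma coneD: "cone a f \<Longrightarrow> x \<in> \<Delta> \<Longrightarrow> y \<in> \<Delta> \<Longrightarrow> f x \<le> exp (a * \<bar>x - y\<bar>) * f y"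
  and cone_nonneg: "cone a f \<Longrightarrow> x \<in> \<Delta> \<Longrightarrow> 0 \<le> f x"
  by (auto simp: cone_def)

lemma cone_oscillation:
  assumes "cone a f" "0 \<le> a" "x \<in> \<Delta>" "y \<in> \<Delta>"
  shows "f x \<le> exp (a * len) * f y"
proof -
  have "exp (a * \<bar>x - y\<bar>) \<le> exp (a * len)"
    using dist_le_len[OF assms(3,4)] assms(2) by (simp add: mult_left_mono)
  then show ?thesis
    using coneD[OF assms(1,3,4)] cone_nonneg[OF assms(1,4)] mult_right_mono order_trans by blast
qed

lemma cone_lipschitz_weak:
  assumes "cone a f" "0 \<le> a" "\<And>x. x \<in> \<Delta> \<Longrightarrow> f x \<le> B"
  shows "(a * exp (a * len) * B)-lipschitz_on \<Delta> f"
proof -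
  have "B \<ge> 0" using dom_ne assms(3) cone_nonneg[OF assms(1)] by (meson ex_in_conv order_trans)
  have *: "f x - f y \<le> a * exp (a * len) * B * \<bar>x - y\<bar>" if "x \<in> \<Delta>" "y \<in> \<Delta>" for x y
  proof -
    let ?t = "a * \<bar>x - y\<bar>"
    have t: "0 \<le> ?t" "?t \<le> a * len"
      using dist_le_len[OF that] assms(2) by (auto intro: mult_left_mono)
    \<comment> \<open>This form gives the linear bound \<open>exp t - 1 \<le> t * exp t\<close>,
      whose exponential is then bounded by its value at the largest distance.\<close>
    have "exp ?t - 1 = exp ?t * (1 - exp (- ?t))"
      by (simp add: algebra_simps flip: exp_add)
    also have "\<dots> \<le> exp (a * len) * ?t"
      using t exp_ge_add_one_self[of "- ?t"] by (intro mult_mono) auto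
    finally have e: "exp ?t - 1 \<le> exp (a * len) * ?t" .
    have "f x - f y \<le> (exp ?t - 1) * f y"
      using coneD[OF assms(1) that] by (simp add: algebra_simps)
    also have "\<dots> \<le> (exp (a * len) * ?t) * B"
      using e t(1) assms(3)[OF that(2)] cone_nonneg[OF assms(1) that(2)] by (intro mult_mono) auto
    finally show ?thesis by (simp add: algebra_simps)
  qed
  show ?thesis
  proof (rule lipschitz_onI)
    show "dist (f x) (f y) \<le> a * exp (a * len) * B * dist x y" if "x \<in> \<Delta>" "y \<in> \<Delta>" for x y
      using *[OF that] *[OF that(2,1)] by (auto simp: dist_real_def abs_le_iff abs_minus_commute)
    show "0 \<le> a * exp (a * len) * B" using assms(2) \<open>B \<ge> 0\<close> by simp
  qed
qed

lemma cone_lipschitz_ex: "cone a f \<Longrightarrow> 0 \<le> a \<Longrightarrow> \<exists>K. K-lipschitz_on \<Delta> f"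
proof -
  assume f: "cone a f" "0 \<le> a"
  obtain x0 where "x0 \<in> \<Delta>" using dom_ne by auto
  then show ?thesis
    using cone_lipschitz_weak[OF f cone_oscillation[OF f]] by blast
qed

text \<open>Integrating the oscillation bound in one of its two variables replaces a point value by
  the mean.\<close>

lemma cone_mean:
  assumes "cone a f" "0 \<le> a" "y \<in> \<Delta>"
  shows "exp (- (a * len)) * mean f \<le> f y" "f y \<le> exp (a * len) * mean f"
proof -
  have int: "integrable (lebesgue_on \<Delta>) f"
    using cone_lipschitz_ex[OF assms(1,2)] lipschitz_integrable by blast
  have c: "integrable (lebesgue_on \<Delta>) (\<lambda>_. c :: real)" for c
    by (rule finite_measure.integrable_const[OF finite_measure_dom])
  have "(LINT x|lebesgue_on \<Delta>. f x) \<le> (LINT x|lebesgue_on \<Delta>. exp (a * len) * f y)"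
    by (intro integral_mono int c) (use cone_oscillation[OF assms(1,2) _ assms(3)] in auto)
  then have "mean f \<le> exp (a * len) * f y"
    unfolding integral_const using len_pos by (simp add: field_simps)
  then have "exp (- (a * len)) * mean f \<le> exp (- (a * len)) * (exp (a * len) * f y)"
    by (rule mult_left_mono) simp
  then show "exp (- (a * len)) * mean f \<le> f y"
    by (simp add: mult.assoc[symmetric] flip: exp_add)
  have "(LINT x|lebesgue_on \<Delta>. f y) \<le> (LINT x|lebesgue_on \<Delta>. exp (a * len) * f x)"
    by (intro integral_mono integrable_mult_right int c)
      (use cone_oscillation[OF assms(1,2,3)] in auto)
  then show "f y \<le> exp (a * len) * mean f"
    unfolding integral_const using len_pos int by (simp add: field_simps)
qed

lemma mean_nonneg: "cone a f \<Longrightarrow> 0 \<le> mean f"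
  using len_pos by (auto intro!: divide_nonneg_pos integral_nonneg_AE AE_I2 dest: cone_nonneg)

lemma cone_lipschitz:
  assumes "cone a f" "0 \<le> a"
  shows "(a * exp (2 * a * len) * mean f)-lipschitz_on \<Delta> f"
proof -
  have e: "exp (2 * a * len) = exp (a * len) * exp (a * len)"
    by (simp flip: exp_add)
  have "a * exp (2 * a * len) * mean f = a * exp (a * len) * (exp (a * len) * mean f)"
    unfolding e by (simp only: mult.assoc)
  then show ?thesis
    using cone_lipschitz_weak[OF assms cone_mean(2)[OF assms]] by (simp only:)
qed

text \<open>Along a branch the contraction shrinks the exponent from \<open>a\<close> to
  \<open>l * a\<close>, and the distortion of the weight adds \<open>D\<close>. The resulting factor
  does not depend on the branch, so it survives summation.\<close>

lemma cone_PF: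
  assumes "cone a f" "0 \<le> a"
  shows "cone (l * a + D) (L f)"
proof -
  obtain B where B: "\<And>x. x \<in> \<Delta> \<Longrightarrow> \<bar>f x\<bar> \<le> B"
    using cone_lipschitz_ex[OF assms] lipschitz_bounded by metis
  have "L f x \<le> exp ((l * a + D) * \<bar>x - y\<bar>) * L f y" if xy: "x \<in> \<Delta>" "y \<in> \<Delta>" for x y
    unfolding PF_def infsum_cmult_right'[symmetric]
  proof (rule infsum_mono[OF PF_summable[OF B xy(1)] summable_on_cmult_right[OF PF_summable[OF B xy(2)]]])
    fix \<omega> assume w: "\<omega> \<in> \<Omega>"
    have "f (g \<omega> x) \<le> exp (a * \<bar>g \<omega> x - g \<omega> y\<bar>) * f (g \<omega> y)"
      by (rule coneD[OF assms(1)]) (use w xy branch_in in auto)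
    also have "\<dots> \<le> exp (l * a * \<bar>x - y\<bar>) * f (g \<omega> y)"
      using mult_left_mono[OF contraction[OF w xy] assms(2)] cone_nonneg[OF assms(1) branch_in[OF w xy(2)]]
      by (intro mult_right_mono) (auto simp: algebra_simps)
    finally have "f (g \<omega> x) * \<bar>dx \<Delta> (g \<omega>) x\<bar>
        \<le> (exp (l * a * \<bar>x - y\<bar>) * f (g \<omega> y)) * (exp (D * \<bar>x - y\<bar>) * \<bar>dx \<Delta> (g \<omega>) y\<bar>)"
      using distortion[OF w xy] cone_nonneg[OF assms(1) branch_in[OF w xy(2)]]
      by (intro mult_mono) auto
    then show "f (g \<omega> x) * \<bar>dx \<Delta> (g \<omega>) x\<bar>
        \<le> exp ((l * a + D) * \<bar>x - y\<bar>) * (f (g \<omega> y) * \<bar>dx \<Delta> (g \<omega>) y\<bar>)"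
      by (simp add: distrib_right exp_add algebra_simps)
  qed
  moreover have "0 \<le> L f x" if "x \<in> \<Delta>" for x
    unfolding PF_def using cone_nonneg[OF assms(1) branch_in[OF _ that]]
    by (intro infsum_nonneg) auto
  ultimately show ?thesis by (simp add: cone_def)
qed

text \<open>This minorization is where the factor \<^term>\<open>decay_rate\<close> \<open>< 1\<close> of each iteration comes from.\<close>
lemma cone_minus_const:
  assumes f: "cone a' f" and a: "a' + 1 \<le> a" "0 \<le> a'"
  shows "cone a (\<lambda>x. f x - exp (- 2 * a * len) / a * mean f)"
proof -
  define m where "m = mean f"
  define c where "c = exp (- 2 * a * len) / a * m"
  have m: "0 \<le> m" unfolding m_def by (rule mean_nonneg[OF f])
  have a1: "1 \<le> a" "0 \<le> a" using a by auto
  have c: "0 \<le> c" using m a1 by (simp add: c_def)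
  have fa: "exp (- (a * len)) * m \<le> f y" if "y \<in> \<Delta>" for y
  proof -
    have "exp (- (a * len)) \<le> exp (- (a' * len))" using a len_pos by simp
    from mult_right_mono[OF this m] show ?thesis
      using cone_mean(1)[OF f a(2) that] by (simp add: m_def)
  qed
  \<comment> \<open>The constant is chosen to make \<open>c * a * exp (a * len)\<close> equal to the
    lower bound \<open>fa\<close> for the values of \<open>f\<close>.\<close>
  have ca: "c * a * exp (a * len) = exp (- (a * len)) * m"
    using a1 by (simp add: c_def flip: exp_add)
  have "c \<le> f y" if "y \<in> \<Delta>" for y
  proof -
    have "c * 1 \<le> c * (a * exp (a * len))"
      using c a1 len_pos mult_mono[of 1 a 1 "exp (a * len)"] by (intro mult_left_mono) auto
    also have "\<dots> = exp (- (a * len)) * m" using ca by (simp add: mult.assoc)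
    finally show ?thesis using fa[OF that] by simp
  qed
  moreover have "f x - c \<le> exp (a * \<bar>x - y\<bar>) * (f y - c)" if xy: "x \<in> \<Delta>" "y \<in> \<Delta>" for x y
  proof -
    define t where "t = \<bar>x - y\<bar>"
    have t: "0 \<le> t" "t \<le> len" using dist_le_len[OF xy] by (auto simp: t_def)
    have "exp (a * t) - 1 = exp (a * t) * (1 - exp (- (a * t)))"
      by (simp add: algebra_simps flip: exp_add)
    also have "\<dots> \<le> exp (a * len) * (a * t)"
      using t a1 exp_ge_add_one_self[of "- (a * t)"]
      by (intro mult_mono) (auto intro: mult_left_mono)
    finally have "c * (exp (a * t) - 1) \<le> c * (exp (a * len) * (a * t))"
      using c by (rule mult_left_mono)
    also have "\<dots> = exp (- (a * len)) * m * t" using ca by (simp add: algebra_simps)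
    also have "\<dots> \<le> f y * t" using fa[OF xy(2)] t by (intro mult_right_mono)
    \<comment> \<open>The surplus of at least 1 in the exponent provides a slack of at least
      \<open>t\<close>, enough to absorb the subtracted constant.\<close>
    also have "\<dots> \<le> f y * (exp (a * t) - exp (a' * t))"
    proof (rule mult_left_mono[OF _ cone_nonneg[OF f xy(2)]])
      have "1 * t \<le> (a - a') * t" using a t by (intro mult_right_mono) auto
      also have "\<dots> \<le> exp ((a - a') * t) - 1" using exp_ge_add_one_self[of "(a - a') * t"] by linarith
      also have "\<dots> \<le> exp (a' * t) * (exp ((a - a') * t) - 1)"
        using mult_right_mono[of 1 "exp (a' * t)" "exp ((a - a') * t) - 1"] a t by auto
      also have "\<dots> = exp (a * t) - exp (a' * t)"
        by (simp add: algebra_simps flip: exp_add)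
      finally show "t \<le> exp (a * t) - exp (a' * t)" by simp
    qed
    finally have "c * (exp (a * t) - 1) \<le> f y * (exp (a * t) - exp (a' * t))" .
    moreover have "f x \<le> exp (a' * t) * f y" using coneD[OF f xy] by (simp add: t_def)
    ultimately show ?thesis unfolding t_def[symmetric] by (simp add: algebra_simps)
  qed
  ultimately show ?thesis
    unfolding cone_def c_def m_def by auto
qed

text \<open>After the shift the function is at least \<open>K / a0\<close>; with Lipschitz constant
  \<open>K\<close> its logarithm then has slope at most \<open>a0\<close>.\<close>

lemma lipschitz_plus_const_cone:
  assumes "K-lipschitz_on \<Delta> f" "\<And>x. x \<in> \<Delta> \<Longrightarrow> \<bar>f x\<bar> \<le> B"
  shows "cone a0 (\<lambda>x. f x + (B + K / a0))"
proof -
  have a: "a0 > 0" using a0_ge_1 by simp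
  have K: "K \<ge> 0" by (rule lipschitz_on_nonneg[OF assms(1)])
  have lower: "K / a0 \<le> f x + (B + K / a0)" if "x \<in> \<Delta>" for x using assms(2)[OF that] by auto
  have "f x + (B + K / a0) \<le> exp (a0 * \<bar>x - y\<bar>) * (f y + (B + K / a0))" if "x \<in> \<Delta>" "y \<in> \<Delta>" for x y
  proof -
    have "f x - f y \<le> K * \<bar>x - y\<bar>"
      using lipschitz_onD[OF assms(1) that] by (auto simp: dist_real_def)
    also have "\<dots> = (a0 * \<bar>x - y\<bar>) * (K / a0)" using a by simp
    also have "\<dots> \<le> (exp (a0 * \<bar>x - y\<bar>) - 1) * (f y + (B + K / a0))"
    proof (rule mult_mono)
      show "a0 * \<bar>x - y\<bar> \<le> exp (a0 * \<bar>x - y\<bar>) - 1"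
        using exp_ge_add_one_self[of "a0 * \<bar>x - y\<bar>"] by linarith
    qed (use lower[OF that(2)] a K in auto)
    finally show ?thesis by (simp add: algebra_simps)
  qed
  moreover have "0 \<le> f x + (B + K / a0)" if "x \<in> \<Delta>" for x
    using lower[OF that] K a by (meson divide_nonneg_pos order_trans)
  ultimately show ?thesis by (auto simp: cone_def)
qed

lemma const_cone: "0 \<le> c \<Longrightarrow> cone a0 (\<lambda>_. c)"
  using a0_ge_1 mult_right_mono[of 1 _ c] by (fastforce simp: cone_def)

text \<open>The shifted function and the shift both lie in the cone, whose members are sent to
  Lipschitz functions; by linearity the difference of the two images is \<open>L f\<close>.\<close>

lemma PF_lipschitz_ex:
  assumes "K-lipschitz_on \<Delta> f"
  shows "\<exists>K'. K'-lipschitz_on \<Delta> (L f)"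
proof -
  obtain B where B: "0 \<le> B" "\<And>x. x \<in> \<Delta> \<Longrightarrow> \<bar>f x\<bar> \<le> B" using lipschitz_bounded[OF assms] by metis
  define R where "R = B + K / a0"
  have R: "0 \<le> R" using B a0_ge_1 lipschitz_on_nonneg[OF assms] by (simp add: R_def)
  have "\<exists>K'. K'-lipschitz_on \<Delta> (L F)" if "cone a0 F" for F
    using cone_lipschitz_ex[OF cone_PF[OF that]] a0_ge_1 l_nonneg D_nonneg by simp
  then obtain K1 K2 where "K1-lipschitz_on \<Delta> (L (\<lambda>x. f x + R))" "K2-lipschitz_on \<Delta> (L (\<lambda>_. R))"
    using lipschitz_plus_const_cone[OF assms B(2)] const_cone[OF R] unfolding R_def by blast
  then have "(K1 + K2)-lipschitz_on \<Delta> (\<lambda>x. L (\<lambda>x. f x + R) x - L (\<lambda>_. R) x)"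
    by (rule lipschitz_on_diff)
  moreover have "L (\<lambda>x. f x + R) x - L (\<lambda>_. R) x = L f x" if "x \<in> \<Delta>" for x
  proof -
    have "L (\<lambda>x. f x + 1 * R) x = L f x + 1 * L (\<lambda>_. R) x"
      by (rule PF_linear[OF B(2) _ that, where B' = R]) (use R in auto)
    then show ?thesis by simp
  qed
  ultimately show ?thesis
    using lipschitz_on_transform by (metis (no_types, lifting))
qed

lemma PF_funpow_lipschitz_ex:
  assumes "K-lipschitz_on \<Delta> f"
  shows "\<exists>K'. K'-lipschitz_on \<Delta> ((L ^^ n) f)"
proof (induction n)
  case 0
  then show ?case using assms by auto
next
  case (Suc n)
  then show ?case using PF_lipschitz_ex by auto
qed

lemma integral_PF:
  assumes "K-lipschitz_on \<Delta> f"
  shows "(LINT x|lebesgue_on \<Delta>. L f x) = (LINT x|lebesgue_on \<Delta>. f x)"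
  using lipschitz_bounded[OF assms]
    integral_PF_bounded[OF continuous_measurable[OF lipschitz_on_continuous_on[OF assms]]] by metis

text \<open>One application leaves exponent \<open>l * a0 + D\<close>, so subtracting the constant
  leads back to the original cone by \<open>a0_step\<close>, while the mean loses the corresponding
  fraction.\<close>

lemma PF_cone_split:
  assumes "cone a0 F"
  defines "c \<equiv> exp (- 2 * a0 * len) / a0 * mean F"
  shows "cone a0 (\<lambda>x. L F x - c)" "mean (\<lambda>x. L F x - c) = rate * mean F"
proof -
  have a: "0 \<le> a0" "0 \<le> l * a0 + D" using a0_ge_1 l_nonneg D_nonneg by auto
  obtain K where K: "K-lipschitz_on \<Delta> F" using cone_lipschitz_ex[OF assms(1) a(1)] by blast
  obtain K' where K': "K'-lipschitz_on \<Delta> (L F)" using PF_lipschitz_ex[OF K] by blast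
  have mean: "mean (L F) = mean F" using integral_PF[OF K] by simp
  show "cone a0 (\<lambda>x. L F x - c)"
    using cone_minus_const[OF cone_PF[OF assms(1) a(1)], of a0] a a0_step mean by (simp add: c_def)
  have "(LINT x|lebesgue_on \<Delta>. L F x - c) = (LINT x|lebesgue_on \<Delta>. F x) - c * len"
    using lipschitz_integrable[OF K'] finite_measure.integrable_const[OF finite_measure_dom]
    by (subst Bochner_Integration.integral_diff) (auto simp: integral_const[symmetric] integral_PF[OF K] simp del: lebesgue_integral_const)
  then show "mean (\<lambda>x. L F x - c) = rate * mean F"
    using len_pos by (simp add: c_def decay_rate_def field_simps)
qed

text \<open>A coupling argument: equal means make the same constant be subtracted from both
  functions at every step, so it cancels in the difference, while the common mean shrinks by
  \<open>rate\<close>.\<close>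

lemma PF_funpow_cone_diff:
  assumes "cone a0 F" "cone a0 G" "mean F = m" "mean G = m"
  shows "\<exists>F' G'. cone a0 F' \<and> cone a0 G' \<and> mean F' = rate ^ n * m \<and> mean G' = rate ^ n * m \<and>
    (\<forall>x\<in>\<Delta>. (L ^^ n) (\<lambda>x. F x - G x) x = F' x - G' x)"
proof (induction n)
  case 0
  then show ?case using assms by auto
next
  case (Suc n)
  then obtain F' G' where IH: "cone a0 F'" "cone a0 G'" "mean F' = rate ^ n * m" "mean G' = rate ^ n * m"
    "\<And>x. x \<in> \<Delta> \<Longrightarrow> (L ^^ n) (\<lambda>x. F x - G x) x = F' x - G' x" by blast
  define c where "c = exp (- 2 * a0 * len) / a0 * (rate ^ n * m)"
  have a: "0 \<le> a0" using a0_ge_1 by simp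
  obtain B B' where B: "\<And>x. x \<in> \<Delta> \<Longrightarrow> \<bar>F' x\<bar> \<le> B" "\<And>x. x \<in> \<Delta> \<Longrightarrow> \<bar>G' x\<bar> \<le> B'"
    using cone_lipschitz_ex[OF IH(1) a] cone_lipschitz_ex[OF IH(2) a] lipschitz_bounded by metis
  have 1: "(L ^^ Suc n) (\<lambda>x. F x - G x) x = (L F' x - c) - (L G' x - c)" if "x \<in> \<Delta>" for x
    using PF_cong[OF IH(5) that] PF_diff[OF B that] by simp
  have 2: "cone a0 (\<lambda>x. L F' x - c)" "mean (\<lambda>x. L F' x - c) = rate ^ Suc n * m"
    using PF_cone_split[OF IH(1)] IH(3) by (auto simp: c_def)
  have 3: "cone a0 (\<lambda>x. L G' x - c)" "mean (\<lambda>x. L G' x - c) = rate ^ Suc n * m"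
    using PF_cone_split[OF IH(2)] IH(4) by (auto simp: c_def)
  show ?case
    by (rule exI[of _ "\<lambda>x. L F' x - c"], rule exI[of _ "\<lambda>x. L G' x - c"])
      (intro conjI ballI 1 2 3)
qed

text \<open>A mean-zero \<open>f\<close> is the difference of the cone functions
  \<open>f + R\<close> and \<open>R\<close>, both of mean \<open>R\<close>. After \<open>n\<close>
  coupled steps both means are \<open>rate ^ n * R\<close>, and a cone function is controlled by its
  mean.\<close>

theorem PF_decay:
  assumes K: "K-lipschitz_on \<Delta> f" and zero: "(LINT x|lebesgue_on \<Delta>. f x) = 0"
  shows "(dconst * rate ^ n * K)-lipschitz_on \<Delta> ((L ^^ n) f)"
    and "\<And>x. x \<in> \<Delta> \<Longrightarrow> \<bar>(L ^^ n) f x\<bar> \<le> dconst * rate ^ n * K"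
proof -
  have a: "1 \<le> a0" "0 \<le> a0" using a0_ge_1 by auto
  have K0: "0 \<le> K" by (rule lipschitz_on_nonneg[OF K])
  \<comment> \<open>\<open>K * len\<close> dominates \<open>f\<close> because its mean vanishes, and
    \<open>K / a0\<close> is the extra height required by
    \<open>lipschitz_plus_const_cone\<close>.\<close>
  define R where "R = K * len + K / a0"
  have R: "0 \<le> R" "R = K * (a0 * len + 1) / a0" using K0 len_pos a by (auto simp: R_def field_simps)
  have bnd: "\<bar>f x\<bar> \<le> K * len" if "x \<in> \<Delta>" for x
    using lipschitz_near_mean[OF K that] zero by simp
  have F: "cone a0 (\<lambda>x. f x + R)"
    using lipschitz_plus_const_cone[OF K bnd] by (simp add: R_def)
  have G: "cone a0 (\<lambda>_. R)" by (rule const_cone[OF R(1)])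
  have mG: "mean (\<lambda>_. R) = R" using len_pos by (simp add: measure_dom)
  have mF: "mean (\<lambda>x. f x + R) = R"
    using lipschitz_integrable[OF K] finite_measure.integrable_const[OF finite_measure_dom, of R]
      len_pos
    by (subst Bochner_Integration.integral_add) (auto simp: zero measure_dom)
  obtain F' G' where FG: "cone a0 F'" "cone a0 G'" "mean F' = rate ^ n * R" "mean G' = rate ^ n * R"
      "\<And>x. x \<in> \<Delta> \<Longrightarrow> (L ^^ n) f x = F' x - G' x"
    using PF_funpow_cone_diff[OF F G mF mG, of n] by auto
  let ?M = "rate ^ n * R"
  have M: "0 \<le> ?M" by (rule mult_nonneg_nonneg[OF zero_le_power[OF rate_nonneg] R(1)])
  have eq: "a0 * exp (2 * a0 * len) * ?M + a0 * exp (2 * a0 * len) * ?M = dconst * rate ^ n * K"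
  proof -
    have Ra: "a0 * R = K * (a0 * len + 1)" using a R(2) by simp
    have "a0 * exp (2 * a0 * len) * ?M + a0 * exp (2 * a0 * len) * ?M
        = 2 * exp (2 * a0 * len) * rate ^ n * (a0 * R)"
      by (simp add: algebra_simps)
    then show ?thesis unfolding Ra by (simp add: decay_const_def algebra_simps)
  qed
  have "(a0 * exp (2 * a0 * len) * ?M + a0 * exp (2 * a0 * len) * ?M)-lipschitz_on \<Delta> (\<lambda>x. F' x - G' x)"
    using cone_lipschitz[OF FG(1) a(2)] cone_lipschitz[OF FG(2) a(2)]
    by (intro lipschitz_on_diff) (simp_all add: FG)
  then show "(dconst * rate ^ n * K)-lipschitz_on \<Delta> ((L ^^ n) f)"
    unfolding eq by (rule lipschitz_on_transform) (simp add: FG(5))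
  fix x assume x: "x \<in> \<Delta>"
  have "exp (a0 * len) * ?M \<le> (a0 * exp (2 * a0 * len)) * ?M"
  proof (rule mult_right_mono[OF _ M])
    have "exp (a0 * len) \<le> exp (2 * a0 * len)" using a len_pos by simp
    also have "\<dots> \<le> a0 * exp (2 * a0 * len)" using a by simp
    finally show "exp (a0 * len) \<le> a0 * exp (2 * a0 * len)" .
  qed
  moreover have "0 \<le> a0 * exp (2 * a0 * len) * ?M" using a M by simp
  moreover have "0 \<le> F' x" "0 \<le> G' x" "F' x \<le> exp (a0 * len) * ?M" "G' x \<le> exp (a0 * len) * ?M"
    using cone_nonneg[OF FG(1) x] cone_nonneg[OF FG(2) x]
      cone_mean(2)[OF FG(1) a(2) x] cone_mean(2)[OF FG(2) a(2) x] FG(3,4) by auto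
  ultimately show "\<bar>(L ^^ n) f x\<bar> \<le> dconst * rate ^ n * K"
    unfolding FG(5)[OF x] eq[symmetric] by linarith
qed

text \<open>Geometric decay makes the Lipschitz constants of the iterates summable, so the series
  inverts I - L on Lipschitz functions of mean zero, with a Lipschitz bound that depends on the
  branches only through \<open>l\<close>, \<open>D\<close> and the length.\<close>

lemma
  assumes K: "K-lipschitz_on \<Delta> f" and zero: "(LINT x|lebesgue_on \<Delta>. f x) = 0"
  defines "S \<equiv> \<lambda>x. \<Sum>n. (L ^^ n) f x"
  shows PF_neumann_summable: "x \<in> \<Delta> \<Longrightarrow> summable (\<lambda>n. (L ^^ n) f x)"
    and PF_neumann_tail: "x \<in> \<Delta> \<Longrightarrow> \<bar>S x - (\<Sum>n<N. (L ^^ n) f x)\<bar> \<le> dconst * K / (1 - rate) * rate ^ N"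
    and PF_neumann_lipschitz: "(dconst * K / (1 - rate))-lipschitz_on \<Delta> S"
    and PF_neumann_mean: "(LINT x|lebesgue_on \<Delta>. S x) = 0"
    and PF_neumann_eq: "x \<in> \<Delta> \<Longrightarrow> L S x = S x - f x"
proof -
  have r: "0 \<le> rate" "rate < 1" by (rule rate_nonneg rate_less)+
  have K0: "0 \<le> K" by (rule lipschitz_on_nonneg[OF K])
  \<comment> \<open>Written with a shift so that one geometric series serves convergence
    (\<open>N = 0\<close>) and the tail estimates.\<close>
  have geo: "(\<lambda>n. dconst * K * (rate ^ N * rate ^ n)) sums (dconst * K / (1 - rate) * rate ^ N)" for N
    using sums_mult[OF sums_mult[OF geometric_sums[of rate]], of "dconst * K" "rate ^ N"] r by simp
  have b: "\<bar>(L ^^ (n + N)) f x\<bar> \<le> dconst * K * (rate ^ N * rate ^ n)" if "x \<in> \<Delta>" for x n N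
    using PF_decay(2)[OF K zero that, of "n + N"] by (simp add: power_add mult_ac)
  show sm: "summable (\<lambda>n. (L ^^ n) f x)" if "x \<in> \<Delta>" for x
    by (rule summable_comparison_test'[OF sums_summable[OF geo[of 0]], of 0])
      (use b[OF that, of _ 0] in simp)
  show tail: "\<bar>S x - (\<Sum>n<N. (L ^^ n) f x)\<bar> \<le> dconst * K / (1 - rate) * rate ^ N" if "x \<in> \<Delta>" for x N
  proof -
    have "S x - (\<Sum>n<N. (L ^^ n) f x) = (\<Sum>n. (L ^^ (n + N)) f x)"
      using suminf_split_initial_segment[OF sm[OF that], of N] by (simp add: S_def)
    moreover have "\<bar>\<Sum>n. (L ^^ (n + N)) f x\<bar> \<le> (\<Sum>n. dconst * K * (rate ^ N * rate ^ n))"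
      unfolding real_norm_def[symmetric]
      by (rule norm_suminf_le[OF _ sums_summable[OF geo]]) (unfold real_norm_def, rule b[OF that])
    ultimately show ?thesis using sums_unique[OF geo] by simp
  qed
  have partial: "(dconst * K / (1 - rate))-lipschitz_on \<Delta> (\<lambda>x. \<Sum>n<N. (L ^^ n) f x)" for N
  proof -
    have "(\<Sum>n<N. dconst * rate ^ n * K)-lipschitz_on \<Delta> (\<lambda>x. \<Sum>n<N. (L ^^ n) f x)"
    proof (induction N)
      case (Suc N)
      then show ?case using PF_decay(1)[OF K zero, of N] by (simp add: lipschitz_on_add)
    qed (simp add: lipschitz_on_constant)
    moreover have "(\<Sum>n<N. dconst * rate ^ n * K) \<le> dconst * K / (1 - rate)"
    proof -
      have "(\<Sum>n<N. dconst * rate ^ n * K) = (\<Sum>n<N. dconst * K * (rate ^ 0 * rate ^ n))"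
        by (simp add: mult_ac)
      also have "\<dots> \<le> (\<Sum>n. dconst * K * (rate ^ 0 * rate ^ n))"
        by (rule sum_le_suminf[OF sums_summable[OF geo]]) (use K0 r dconst_nonneg in auto)
      finally show ?thesis using sums_unique[OF geo[of 0]] by simp
    qed
    ultimately show ?thesis using lipschitz_on_leI lipschitz_on_mono by blast
  qed
  have lim: "(\<lambda>N. \<Sum>n<N. (L ^^ n) f x) \<longlonglongrightarrow> S x" if "x \<in> \<Delta>" for x
    using summable_LIMSEQ[OF sm[OF that]] by (simp add: S_def)
  show lipS: "(dconst * K / (1 - rate))-lipschitz_on \<Delta> S"
  proof (rule lipschitz_onI)
    show "dist (S x) (S y) \<le> dconst * K / (1 - rate) * dist x y" if "x \<in> \<Delta>" "y \<in> \<Delta>" for x y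
      by (rule LIMSEQ_le_const2[OF tendsto_dist[OF lim[OF that(1)] lim[OF that(2)]]])
        (use lipschitz_onD[OF partial that] in auto)
    show "0 \<le> dconst * K / (1 - rate)" using K0 r dconst_nonneg by simp
  qed
  have tend0: "(\<lambda>N. c * rate ^ N) \<longlonglongrightarrow> 0" for c
    using tendsto_mult_right_zero[OF LIMSEQ_realpow_zero[OF r], of c] by simp
  have intn: "integrable (lebesgue_on \<Delta>) ((L ^^ n) f)" "(LINT x|lebesgue_on \<Delta>. (L ^^ n) f x) = 0" for n
  proof -
    show "integrable (lebesgue_on \<Delta>) ((L ^^ n) f)"
      using PF_funpow_lipschitz_ex[OF K] lipschitz_integrable by blast
    show "(LINT x|lebesgue_on \<Delta>. (L ^^ n) f x) = 0"
    proof (induction n)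
      case (Suc n)
      obtain K' where "K'-lipschitz_on \<Delta> ((L ^^ n) f)" using PF_funpow_lipschitz_ex[OF K] by blast
      from integral_PF[OF this] show ?case using Suc by simp
    qed (simp add: zero)
  qed
  have int_partial: "(LINT x|lebesgue_on \<Delta>. (\<Sum>n<N. (L ^^ n) f x)) = 0" for N
    using intn by (subst Bochner_Integration.integral_sum) auto
  let ?c = "dconst * K / (1 - rate)"
  have "\<bar>LINT x|lebesgue_on \<Delta>. S x\<bar> \<le> ?c * len * rate ^ N" for N
  proof -
    have "(LINT x|lebesgue_on \<Delta>. S x) = (LINT x|lebesgue_on \<Delta>. S x - (\<Sum>n<N. (L ^^ n) f x))"
      using int_partial[of N] lipschitz_integrable[OF lipS] lipschitz_integrable[OF partial[of N]] by simp
    also have "\<bar>\<dots>\<bar> \<le> (LINT x|lebesgue_on \<Delta>. \<bar>S x - (\<Sum>n<N. (L ^^ n) f x)\<bar>)"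
      by (rule integral_abs_bound)
    also have "\<dots> \<le> ?c * rate ^ N * len"
      using lipschitz_on_continuous_on[OF lipS] lipschitz_on_continuous_on[OF partial[of N]]
      by (intro abs_integral_le continuous_measurable continuous_on_diff tail)
    finally show ?thesis by (simp add: mult_ac)
  qed
  then have "\<bar>LINT x|lebesgue_on \<Delta>. S x\<bar> \<le> 0"
    by (intro LIMSEQ_le_const[OF tend0[of "?c * len"]]) auto
  moreover have "L S x = S x - f x" if x: "x \<in> \<Delta>" for x
  proof -
    \<comment> \<open>Applying \<open>L\<close> shifts the indices of the partial sum by one, so
      only the initial term \<open>f\<close> is lost.\<close>
    have LS: "L (\<lambda>x. \<Sum>n<N. (L ^^ n) f x) x = (\<Sum>n<Suc N. (L ^^ n) f x) - f x" for N
    proof (induction N)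
      case 0
      then show ?case by (simp add: PF_def)
    next
      case (Suc N)
      obtain B B' where "\<And>x. x \<in> \<Delta> \<Longrightarrow> \<bar>(\<Sum>n<N. (L ^^ n) f x)\<bar> \<le> B" "\<And>x. x \<in> \<Delta> \<Longrightarrow> \<bar>(L ^^ N) f x\<bar> \<le> B'"
        using lipschitz_bounded[OF partial[of N]] PF_decay(2)[OF K zero] by metis
      from PF_linear[OF this x, where c = 1] Suc show ?case by simp
    qed
    \<comment> \<open>In the sup norm \<open>L\<close> is bounded by
      \<open>infsum s \<Omega>\<close>, so the tail estimate survives one application; this
      exchanges \<open>L\<close> with the infinite sum.\<close>
    have bound: "\<bar>L S x - ((\<Sum>n<Suc N. (L ^^ n) f x) - f x)\<bar> \<le> ?c * infsum s \<Omega> * rate ^ N" for N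
    proof -
      obtain B B' where B: "\<And>x. x \<in> \<Delta> \<Longrightarrow> \<bar>S x\<bar> \<le> B" "\<And>x. x \<in> \<Delta> \<Longrightarrow> \<bar>(\<Sum>n<N. (L ^^ n) f x)\<bar> \<le> B'"
        using lipschitz_bounded[OF partial[of N]] lipschitz_bounded[OF lipS] by metis
      have "\<bar>L (\<lambda>x. S x - (\<Sum>n<N. (L ^^ n) f x)) x\<bar> \<le> (?c * rate ^ N) * infsum s \<Omega>"
        by (rule PF_abs_le[OF tail x])
      also have "L (\<lambda>x. S x - (\<Sum>n<N. (L ^^ n) f x)) x = L S x - ((\<Sum>n<Suc N. (L ^^ n) f x) - f x)"
        unfolding LS[symmetric] by (rule PF_diff[OF B x])
      finally show ?thesis by (simp only: mult_ac)
    qed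
    have "(\<lambda>N. L S x - ((\<Sum>n<Suc N. (L ^^ n) f x) - f x)) \<longlonglongrightarrow> 0"
      by (rule Lim_null_comparison[OF always_eventually tend0[of "?c * infsum s \<Omega>"]])
        (unfold real_norm_def, intro allI bound)
    from tendsto_diff[OF tendsto_const[of "L S x"] this]
    have "(\<lambda>N. (\<Sum>n<Suc N. (L ^^ n) f x) - f x) \<longlonglongrightarrow> L S x"
      by (simp del: sum.lessThan_Suc)
    moreover have "(\<lambda>N. (\<Sum>n<Suc N. (L ^^ n) f x) - f x) \<longlonglongrightarrow> S x - f x"
      by (rule tendsto_diff[OF LIMSEQ_Suc[OF lim[OF x]] tendsto_const])
    ultimately show ?thesis by (rule LIMSEQ_unique)
  qed
  ultimately show "(LINT x|lebesgue_on \<Delta>. S x) = 0" "x \<in> \<Delta> \<Longrightarrow> L S x = S x - f x"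
    by auto
qed

section \<open>Convergence of iterates to the invariant density\<close>

lemma PF_funpow_linear:
  assumes "K-lipschitz_on \<Delta> f" "K'-lipschitz_on \<Delta> f'" "x \<in> \<Delta>"
  shows "(L ^^ n) (\<lambda>x. f x + c * f' x) x = (L ^^ n) f x + c * (L ^^ n) f' x"
  using assms(3)
proof (induction n arbitrary: x)
  case (Suc n)
  obtain B B' where B: "\<And>x. x \<in> \<Delta> \<Longrightarrow> \<bar>(L ^^ n) f x\<bar> \<le> B" "\<And>x. x \<in> \<Delta> \<Longrightarrow> \<bar>(L ^^ n) f' x\<bar> \<le> B'"
    using PF_funpow_lipschitz_ex[OF assms(1), of n] PF_funpow_lipschitz_ex[OF assms(2), of n]
      lipschitz_bounded by metis
  show ?case
    using PF_cong[OF Suc.IH Suc.prems] PF_linear[OF B Suc.prems] by simp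
qed simp

text \<open>Reduces convergence of the iterates of \<open>f\<close> to a Neumann series:
  \<open>L f - f\<close> has mean zero even when \<open>f\<close> does not.\<close>

lemma PF_funpow_telescope:
  assumes "K-lipschitz_on \<Delta> f" "x \<in> \<Delta>"
  shows "(L ^^ N) f x = f x + (\<Sum>n<N. (L ^^ n) (\<lambda>x. L f x - f x) x)"
proof -
  have *: "(L ^^ n) (\<lambda>x. L f x - f x) y = (L ^^ Suc n) f y - (L ^^ n) f y" if "y \<in> \<Delta>" for n y
    using that
  proof (induction n arbitrary: y)
    case (Suc n)
    obtain B B' where B: "\<And>x. x \<in> \<Delta> \<Longrightarrow> \<bar>(L ^^ Suc n) f x\<bar> \<le> B" "\<And>x. x \<in> \<Delta> \<Longrightarrow> \<bar>(L ^^ n) f x\<bar> \<le> B'"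
      using PF_funpow_lipschitz_ex[OF assms(1), of "Suc n"] PF_funpow_lipschitz_ex[OF assms(1), of n]
        lipschitz_bounded by metis
    show ?case
      using PF_cong[OF Suc.IH Suc.prems] PF_diff[OF B Suc.prems] by simp
  qed simp
  show ?thesis
    by (induction N) (simp_all add: *[OF assms(2)])
qed

lemma (in -) invariant_density_measurable:
  assumes "invariant_density \<Delta> T h"
  shows "T \<in> lebesgue_on \<Delta> \<rightarrow>\<^sub>M lebesgue_on \<Delta>"
proof -
  have "T \<in> density (lebesgue_on \<Delta>) (\<lambda>x. ennreal (h x)) \<rightarrow>\<^sub>M density (lebesgue_on \<Delta>) (\<lambda>x. ennreal (h x))"
    using assms by (simp add: invariant_density_def Let_def)
  then show ?thesis by (simp cong: measurable_cong_sets)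
qed

text \<open>The Lipschitz regularizations \<open>x \<mapsto> inf\<^sub>y (h y + k |x - y|)\<close> increase to the continuous density
  \<open>h\<close>; since they are dominated by \<open>h\<close>, a one-sided comparison of \<open>h\<close> with the limit of \<open>L\<^sup>n f\<close>
  suffices, because both have integral 1.\<close>
lemma invariant_density_eq:
  assumes inv: "invariant_density \<Delta> T h" and cont: "continuous_on \<Delta> h"
    and koopman: "\<And>A f K. A \<in> sets (lebesgue_on \<Delta>) \<Longrightarrow> K-lipschitz_on \<Delta> f \<Longrightarrow>
      (LINT x|lebesgue_on \<Delta>. indicator A (T x) * f x) = (LINT x|lebesgue_on \<Delta>. indicator A x * L f x)"
    and f: "K-lipschitz_on \<Delta> f" "(LINT x|lebesgue_on \<Delta>. f x) = 1"
    and x: "x \<in> \<Delta>"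
  shows "h x = f x + (\<Sum>n. (L ^^ n) (\<lambda>x. L f x - f x) x)"
proof -
  let ?M = "lebesgue_on \<Delta>"
  have h0: "\<And>x. x \<in> \<Delta> \<Longrightarrow> 0 \<le> h x" and h_int: "integrable ?M h" "(LINT x|?M. h x) = 1"
    using inv by (auto simp: invariant_density_def)
  have T [measurable]: "T \<in> ?M \<rightarrow>\<^sub>M ?M" by (rule invariant_density_measurable[OF inv])
  have ind_int: "integrable ?M (\<lambda>x. indicator A x * F x)"
    if "A \<in> sets ?M" "integrable ?M F" for A and F :: "real \<Rightarrow> real"
    using integrable_mult_indicator[OF that] by simp
  have invA: "(LINT x|?M. indicator (T -` A \<inter> \<Delta>) x * h x) = (LINT x|?M. indicator A x * h x)"
    if A: "A \<in> sets ?M" for A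
  proof -
    have "emeasure (distr (density ?M h) (density ?M h) T) A = emeasure (density ?M h) A"
      using inv by (simp add: invariant_density_def Let_def)
    then have pres: "emeasure (density ?M h) (T -` A \<inter> \<Delta>) = emeasure (density ?M h) A"
      using A T by (subst (asm) emeasure_distr) (auto cong: measurable_cong_sets)
    have em: "emeasure (density ?M h) B = ennreal (LINT x|?M. indicator B x * h x)"
      if B: "B \<in> sets ?M" for B
    proof -
      have "emeasure (density ?M h) B = (\<integral>\<^sup>+ x. ennreal (h x) * indicator B x \<partial>?M)"
        using B h_int by (intro emeasure_density) auto
      also have "\<dots> = (\<integral>\<^sup>+ x. ennreal (indicator B x * h x) \<partial>?M)"
        by (intro nn_integral_cong) (auto simp: indicator_def)
      also have "\<dots> = ennreal (LINT x|?M. indicator B x * h x)"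
        by (rule nn_integral_eq_integral[OF ind_int[OF B h_int(1)]]) (auto intro!: AE_I2 h0 simp: indicator_def)
      finally show ?thesis .
    qed
    have TA: "T -` A \<inter> \<Delta> \<in> sets ?M" using measurable_sets[OF T A] by simp
    have "0 \<le> (LINT x|?M. indicator B x * h x)" for B
      by (rule integral_nonneg_AE) (auto intro!: AE_I2 h0 simp: indicator_def)
    then show ?thesis using pres unfolding em[OF A] em[OF TA] by (subst (asm) ennreal_inj)
  qed
  \<comment> \<open>Preimages are intersected with \<Delta> at every step, since values of
    \<open>T\<close> elsewhere are arbitrary.\<close>
  define pre where "pre n A = ((\<lambda>A. T -` A \<inter> \<Delta>) ^^ n) A" for n A
  have pre_sets: "pre n A \<in> sets ?M" if "A \<in> sets ?M" for n A
    using that measurable_sets[OF T] by (induction n) (simp_all add: pre_def)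
  have pre_h: "(LINT x|?M. indicator (pre n A) x * h x) = (LINT x|?M. indicator A x * h x)"
    if "A \<in> sets ?M" for n A
  proof (induction n)
    case (Suc n)
    then show ?case using invA[OF pre_sets[OF that, of n]] by (simp add: pre_def)
  qed (simp add: pre_def)
  have pre_L: "(LINT x|?M. indicator (pre n A) x * F x) = (LINT x|?M. indicator A x * (L ^^ n) F x)"
    if A: "A \<in> sets ?M" and F: "K-lipschitz_on \<Delta> F" for n A F K
    using F
  proof (induction n arbitrary: F K)
    case (Suc n)
    obtain K' where K': "K'-lipschitz_on \<Delta> (L F)" using PF_lipschitz_ex[OF Suc.prems] by blast
    have "(LINT x|?M. indicator (pre (Suc n) A) x * F x) = (LINT x|?M. indicator (pre n A) (T x) * F x)"
      by (rule integral_cong_dom) (auto simp: pre_def indicator_def)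
    also have "\<dots> = (LINT x|?M. indicator (pre n A) x * L F x)"
      by (rule koopman[OF pre_sets[OF A] Suc.prems])
    also have "\<dots> = (LINT x|?M. indicator A x * (L ^^ Suc n) F x)"
      unfolding Suc.IH[OF K'] by (simp add: funpow_swap1)
    finally show ?case .
  qed (simp add: pre_def)

  define \<phi> where "\<phi> = (\<lambda>x. L f x - f x)"
  \<comment> \<open>The candidate for the density: the pointwise limit of the iterates of
    \<open>f\<close>, in the telescoped form that shows it to be Lipschitz.\<close>
  define v where "v = (\<lambda>x. f x + (\<Sum>n. (L ^^ n) \<phi> x))"
  obtain K1 where K1: "K1-lipschitz_on \<Delta> (L f)" using PF_lipschitz_ex[OF f(1)] by blast
  have \<phi>: "(K1 + K)-lipschitz_on \<Delta> \<phi>" unfolding \<phi>_def by (rule lipschitz_on_diff[OF K1 f(1)])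
  have \<phi>0: "(LINT x|?M. \<phi> x) = 0"
    unfolding \<phi>_def using lipschitz_integrable[OF K1] lipschitz_integrable[OF f(1)] integral_PF[OF f(1)] by simp
  obtain Kv where Kv: "Kv-lipschitz_on \<Delta> v"
    unfolding v_def using lipschitz_on_add[OF f(1) PF_neumann_lipschitz[OF \<phi> \<phi>0]] by blast
  have v_int: "integrable ?M v" "(LINT x|?M. v x) = 1"
  proof -
    show "integrable ?M v" by (rule lipschitz_integrable[OF Kv])
    show "(LINT x|?M. v x) = 1"
      unfolding v_def using PF_neumann_mean[OF \<phi> \<phi>0] f(2) lipschitz_integrable[OF f(1)]
        lipschitz_integrable[OF PF_neumann_lipschitz[OF \<phi> \<phi>0]] by simp
  qed
  have f_conv: "(\<lambda>n. (L ^^ n) f x) \<longlonglongrightarrow> v x" if "x \<in> \<Delta>" for x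
    unfolding PF_funpow_telescope[OF f(1) that] v_def \<phi>_def[symmetric]
    by (intro tendsto_add tendsto_const summable_LIMSEQ PF_neumann_summable[OF \<phi> \<phi>0 that])
  have f_bound: "\<exists>B. \<forall>n. \<forall>x\<in>\<Delta>. \<bar>(L ^^ n) f x\<bar> \<le> B"
  proof -
    let ?C = "dconst * (K1 + K) / (1 - rate)"
    obtain B where B: "\<And>x. x \<in> \<Delta> \<Longrightarrow> \<bar>v x\<bar> \<le> B" using lipschitz_bounded[OF Kv] by metis
    have C: "0 \<le> ?C" using dconst_nonneg rate_less lipschitz_on_nonneg[OF \<phi>] by simp
    have "\<bar>(L ^^ n) f x\<bar> \<le> B + ?C" if "x \<in> \<Delta>" for n x
    proof -
      have "\<bar>v x - (L ^^ n) f x\<bar> \<le> ?C * rate ^ n"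
        unfolding PF_funpow_telescope[OF f(1) that] v_def \<phi>_def[symmetric]
        using PF_neumann_tail[OF \<phi> \<phi>0 that, of n] by simp
      also have "\<dots> \<le> ?C"
        using mult_left_mono[OF power_le_one[OF rate_nonneg less_imp_le[OF rate_less], of n] C] by simp
      finally show ?thesis using B[OF that] by linarith
    qed
    then show ?thesis by blast
  qed
  \<comment> \<open>Removing the multiple of \<open>f\<close> with the same integral leaves a
    mean-zero function, whose iterates decay; what remains converges to that multiple of
    \<open>v\<close>.\<close>
  have conv: "(\<lambda>n. LINT x|?M. indicator A x * (L ^^ n) F x) \<longlonglongrightarrow> (LINT x|?M. F x) * (LINT x|?M. indicator A x * v x)"
    if F: "K'-lipschitz_on \<Delta> F" and A: "A \<in> sets ?M" for F K' A
  proof -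
    define c where "c = (LINT x|?M. F x)"
    define G where "G = (\<lambda>x. F x + (- c) * f x)"
    obtain K2 where K2: "K2-lipschitz_on \<Delta> G"
      unfolding G_def using lipschitz_on_add[OF F lipschitz_on_cmult_real[OF f(1), of "- c"]] by blast
    have G0: "(LINT x|?M. G x) = 0"
      unfolding G_def using lipschitz_integrable[OF F] lipschitz_integrable[OF f(1)] f(2)
      by (subst Bochner_Integration.integral_add) (auto simp: c_def)
    have split: "(L ^^ n) F x = (L ^^ n) G x + c * (L ^^ n) f x" if "x \<in> \<Delta>" for n x
      using PF_funpow_linear[OF K2 f(1) that, of n c] by (simp add: G_def)
    obtain B where B: "\<And>n x. x \<in> \<Delta> \<Longrightarrow> \<bar>(L ^^ n) f x\<bar> \<le> B" using f_bound by blast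
    have K20: "0 \<le> dconst * K2" using dconst_nonneg lipschitz_on_nonneg[OF K2] by simp
    have G_bound: "\<bar>(L ^^ n) G x\<bar> \<le> dconst * K2 * rate ^ n" if "x \<in> \<Delta>" for n x
      using PF_decay(2)[OF K2 G0 that, of n] by (simp add: mult_ac)
    have lim: "(\<lambda>n. (L ^^ n) F x) \<longlonglongrightarrow> 0 + c * v x" if "x \<in> \<Delta>" for x
      unfolding split[OF that]
    proof (intro tendsto_add tendsto_mult tendsto_const f_conv that)
      have "(\<lambda>n. dconst * K2 * rate ^ n) \<longlonglongrightarrow> 0"
        using tendsto_mult_right_zero[OF LIMSEQ_realpow_zero[OF rate_nonneg rate_less]] by simp
      then show "(\<lambda>n. (L ^^ n) G x) \<longlonglongrightarrow> 0"
        by (rule Lim_null_comparison[rotated]) (use G_bound[OF that] in auto)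
    qed
    have bnd: "\<bar>(L ^^ n) F x\<bar> \<le> dconst * K2 + \<bar>c\<bar> * B" if "x \<in> \<Delta>" for n x
    proof -
      have "\<bar>(L ^^ n) F x\<bar> \<le> \<bar>(L ^^ n) G x\<bar> + \<bar>c\<bar> * \<bar>(L ^^ n) f x\<bar>"
        unfolding split[OF that] by (metis abs_mult abs_triangle_ineq)
      also have "\<dots> \<le> dconst * K2 + \<bar>c\<bar> * B"
        using G_bound[OF that, of n] B[OF that, of n] K20
          mult_left_mono[OF power_le_one[OF rate_nonneg less_imp_le[OF rate_less], of n] K20]
        by (intro add_mono mult_left_mono) auto
      finally show ?thesis .
    qed
    have "(\<lambda>n. LINT x|?M. indicator A x * (L ^^ n) F x) \<longlonglongrightarrow> (LINT x|?M. indicator A x * (c * v x))"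
    proof (rule integral_dominated_convergence[where w = "\<lambda>_. dconst * K2 + \<bar>c\<bar> * B"])
      show "(\<lambda>x. indicator A x * (c * v x)) \<in> borel_measurable ?M"
        using ind_int[OF A, of "\<lambda>x. c * v x"] v_int(1) by simp
      show "(\<lambda>x. indicator A x * (L ^^ n) F x) \<in> borel_measurable ?M" for n
        using ind_int[OF A] PF_funpow_lipschitz_ex[OF F, of n] lipschitz_integrable by blast
      show "integrable ?M (\<lambda>_. dconst * K2 + \<bar>c\<bar> * B)"
        by (rule finite_measure.integrable_const[OF finite_measure_dom])
      show "AE x in ?M. (\<lambda>n. indicator A x * (L ^^ n) F x) \<longlonglongrightarrow> indicator A x * (c * v x)"
        using lim by (intro AE_I2 tendsto_mult tendsto_const) auto
      show "AE x in ?M. norm (indicator A x * (L ^^ n) F x) \<le> dconst * K2 + \<bar>c\<bar> * B" for n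
        using order_trans[OF abs_ge_zero bnd] by (intro AE_I2) (auto simp: indicator_def bnd)
    qed
    moreover have "(LINT x|?M. indicator A x * (c * v x)) = c * (LINT x|?M. indicator A x * v x)"
      by (subst integral_mult_right_zero[symmetric]) (simp add: mult_ac)
    ultimately show ?thesis by (simp add: c_def)
  qed

  \<comment> \<open>\<open>h\<close> need not be Lipschitz, and if \<Delta> is not closed it may
    even be unbounded, so the decay estimate does not apply to it directly.\<close>
  define hk where "hk k x = (INF y\<in>\<Delta>. h y + real k * \<bar>x - y\<bar>)" for k x
  have bdd: "bdd_below ((\<lambda>y. h y + real k * \<bar>x - y\<bar>) ` \<Delta>)" for k x
    by (rule bdd_belowI2[of _ 0]) (use h0 in auto)
  have hk_le: "hk k x \<le> h y + real k * \<bar>x - y\<bar>" if "y \<in> \<Delta>" for k x y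
    unfolding hk_def by (rule cINF_lower[OF bdd that])
  have hk_ge: "c \<le> hk k x" if "\<And>y. y \<in> \<Delta> \<Longrightarrow> c \<le> h y + real k * \<bar>x - y\<bar>" for c k x
    unfolding hk_def by (rule cINF_greatest[OF dom_ne that])
  have hk0: "0 \<le> hk k x" for k x by (rule hk_ge) (use h0 in auto)
  have hk_h: "hk k x \<le> h x" if "x \<in> \<Delta>" for k x using hk_le[OF that, of k x] by simp
  have hk_lip: "(real k)-lipschitz_on \<Delta> (hk k)" for k
  proof (rule lipschitz_onI)
    have *: "hk k x - hk k z \<le> real k * \<bar>x - z\<bar>" for x z
    proof -
      have "hk k x - real k * \<bar>x - z\<bar> \<le> hk k z"
      proof (rule hk_ge)
        fix y assume y: "y \<in> \<Delta>"
        have "real k * \<bar>x - y\<bar> \<le> real k * (\<bar>z - y\<bar> + \<bar>x - z\<bar>)" by (intro mult_left_mono) auto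
        then show "hk k x - real k * \<bar>x - z\<bar> \<le> h y + real k * \<bar>z - y\<bar>"
          using hk_le[OF y, of k x] by (simp add: distrib_left)
      qed
      then show ?thesis by simp
    qed
    show "dist (hk k x) (hk k z) \<le> real k * dist x z" for x z
      using *[of x z] *[of z x] by (simp add: dist_real_def abs_le_iff abs_minus_commute)
  qed simp
  have hk_lim: "(\<lambda>k. hk k x) \<longlonglongrightarrow> h x" if x: "x \<in> \<Delta>" for x
  proof (rule LIMSEQ_I)
    fix e :: real assume e: "e > 0"
    obtain r where r: "r > 0" "\<And>y. y \<in> \<Delta> \<Longrightarrow> dist y x < r \<Longrightarrow> dist (h y) (h x) < e / 2"
      using cont x e unfolding continuous_on_iff by (meson half_gt_zero)
    \<comment> \<open>From this slope on, the penalty at distance \<open>r\<close> or more exceeds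
      \<open>h x\<close>, so only points near \<open>x\<close> compete in the infimum.\<close>
    obtain N :: nat where N: "h x / r < real N" using reals_Archimedean2 by blast
    have "norm (hk k x - h x) < e" if k: "k \<ge> N" for k
    proof -
      have "h x - e / 2 \<le> hk k x"
      proof (rule hk_ge)
        fix y assume y: "y \<in> \<Delta>"
        show "h x - e / 2 \<le> h y + real k * \<bar>x - y\<bar>"
        proof (cases "dist y x < r")
          case True
          then have "h x - e / 2 \<le> h y" using r(2)[OF y True] by (auto simp: dist_real_def abs_if split: if_splits)
          then show ?thesis by (simp add: add_increasing2)
        next
          case False
          have "h x \<le> real N * r" using N r(1) by (simp add: field_simps)
          also have "\<dots> \<le> real k * \<bar>x - y\<bar>"
            using False k r(1) by (intro mult_mono) (auto simp: dist_real_def abs_minus_commute)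
          finally show ?thesis using h0[OF y] e by simp
        qed
      qed
      then show ?thesis using hk_h[OF x, of k] e by (simp add: abs_if)
    qed
    then show "\<exists>N. \<forall>k\<ge>N. norm (hk k x - h x) < e" by blast
  qed
  have hk_int: "(\<lambda>k. LINT x|?M. hk k x) \<longlonglongrightarrow> 1"
    unfolding h_int(2)[symmetric]
  proof (rule integral_dominated_convergence[where w = h])
    show "AE x in ?M. (\<lambda>k. hk k x) \<longlonglongrightarrow> h x" using hk_lim by (intro AE_I2) simp
    show "AE x in ?M. norm (hk k x) \<le> h x" for k using hk_h hk0 by (intro AE_I2) simp
  qed (use h_int lipschitz_integrable[OF hk_lip] in auto)
  \<comment> \<open>Invariance moves the mass of \<open>h\<close> over \<open>A\<close> to the
    \<open>n\<close>-th preimage, where \<open>hk k\<close> lies below \<open>h\<close>; then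
    \<open>n\<close> and afterwards \<open>k\<close> tends to infinity.\<close>
  have ge: "(LINT x|?M. indicator A x * v x) \<le> (LINT x|?M. indicator A x * h x)" if A: "A \<in> sets ?M" for A
  proof -
    have "(LINT x|?M. hk k x) * (LINT x|?M. indicator A x * v x) \<le> (LINT x|?M. indicator A x * h x)" for k
    proof (rule LIMSEQ_le_const2[OF conv[OF hk_lip A]], intro exI allI impI)
      fix n
      have "(LINT x|?M. indicator A x * (L ^^ n) (hk k) x) = (LINT x|?M. indicator (pre n A) x * hk k x)"
        by (rule pre_L[OF A hk_lip, symmetric])
      also have "\<dots> \<le> (LINT x|?M. indicator (pre n A) x * h x)"
        using ind_int[OF pre_sets[OF A] lipschitz_integrable[OF hk_lip]] ind_int[OF pre_sets[OF A] h_int(1)]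
        by (rule integral_mono) (use hk_h in \<open>auto simp: indicator_def\<close>)
      finally show "(LINT x|?M. indicator A x * (L ^^ n) (hk k) x) \<le> (LINT x|?M. indicator A x * h x)"
        by (simp only: pre_h[OF A])
    qed
    then have "1 * (LINT x|?M. indicator A x * v x) \<le> (LINT x|?M. indicator A x * h x)"
      by (intro LIMSEQ_le_const2[OF tendsto_mult[OF hk_int tendsto_const]]) auto
    then show ?thesis by simp
  qed
  define d where "d = (\<lambda>x. h x - v x)"
  have d_int: "integrable ?M d" "(LINT x|?M. d x) = 0"
    using h_int v_int by (simp_all add: d_def)
  \<comment> \<open>Tested on the set where \<open>d\<close> is negative, the one-sided comparison
    forces this set to be null; as \<open>d\<close> has integral 0, it then vanishes almost
    everywhere.\<close>
  define A where "A = {x \<in> \<Delta>. d x < 0}"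
  have A: "A \<in> sets ?M"
  proof -
    have [measurable]: "d \<in> borel_measurable ?M" by (rule borel_measurable_integrable[OF d_int(1)])
    have "{x \<in> space ?M. d x < 0} \<in> sets ?M" by measurable
    then show ?thesis by (simp add: A_def)
  qed
  have "AE x in ?M. - (indicator A x * d x) = 0"
  proof (subst integral_nonneg_eq_0_iff_AE[symmetric])
    have "(LINT x|?M. indicator A x * d x) = (LINT x|?M. indicator A x * h x) - (LINT x|?M. indicator A x * v x)"
      using ind_int[OF A h_int(1)] ind_int[OF A v_int(1)] by (simp add: d_def right_diff_distrib)
    then have "0 \<le> (LINT x|?M. indicator A x * d x)" using ge[OF A] by simp
    moreover have "0 \<le> (LINT x|?M. - (indicator A x * d x))"
      by (rule integral_nonneg_AE) (auto simp: A_def indicator_def)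
    ultimately show "(LINT x|?M. - (indicator A x * d x)) = 0" by simp
  qed (use ind_int[OF A d_int(1)] in \<open>auto simp: A_def indicator_def\<close>)
  then have d_nonneg: "AE x in ?M. 0 \<le> d x"
    using AE_space by eventually_elim (auto simp: A_def indicator_def not_less split: if_splits)
  then have "AE x in ?M. d x = 0"
    using integral_nonneg_eq_0_iff_AE[OF d_int(1)] d_int(2) by simp
  then have "AE x in ?M. h x = v x" by (simp add: d_def)
  from eq_from_AE[OF cont lipschitz_on_continuous_on[OF Kv] this x]
  show ?thesis by (simp add: v_def \<phi>_def)
qed

end

subsection \<open>Change of variables along full branches\<close>

context bounded_interval begin

lemma integrable_iff_absolutely_integrable:
  "S \<in> sets lebesgue \<Longrightarrow> integrable (lebesgue_on S) f \<longleftrightarrow> f absolutely_integrable_on S"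
  for f :: "real \<Rightarrow> real"
  by (simp add: set_integrable_def integrable_restrict_space)

lemma integral_indicator_subset:
  assumes "S \<in> sets lebesgue" "S \<subseteq> \<Delta>"
  shows "(LINT x|lebesgue_on \<Delta>. indicator S x * f x) = (LINT x|lebesgue_on S. f x :: real)"
proof -
  have "(LINT x|lebesgue_on \<Delta>. indicator S x * f x) = (LINT x|lebesgue. indicator \<Delta> x *\<^sub>R (indicator S x * f x))"
    by (rule integral_restrict_space) simp
  also have "\<dots> = (LINT x|lebesgue. indicator S x *\<^sub>R f x)"
    by (rule Bochner_Integration.integral_cong) (use assms(2) in \<open>auto simp: indicator_def\<close>)
  also have "\<dots> = (LINT x|lebesgue_on S. f x)"
    by (rule integral_restrict_space[symmetric]) (use assms(1) in simp)
  finally show ?thesis .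
qed

lemma full_branch_derivative:
  assumes "full_branch_map \<Delta> \<Omega> T P g" "\<omega> \<in> \<Omega>" "y \<in> P \<omega>"
  shows "(T has_real_derivative deriv T y) (at y)" "deriv T y \<noteq> 0"
proof -
  have P: "open (P \<omega>)" "T \<in> C_k 3 (P \<omega>)" using assms by (auto simp: full_branch_map_def)
  then have "T differentiable (at y within P \<omega>)"
    using assms(3) unfolding C_k_def by (force dest: spec[of _ "0 :: nat"])
  then have "T differentiable (at y)"
    using P(1) assms(3) at_within_open by metis
  then show "(T has_real_derivative deriv T y) (at y)"
    by (simp add: DERIV_deriv_iff_real_differentiable)
  obtain \<kappa> where "\<kappa> > 1" "\<bar>deriv T y\<bar> \<ge> \<kappa>"
    using assms unfolding full_branch_map_def by blast
  then show "deriv T y \<noteq> 0" by auto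
qed

text \<open>By the mean value theorem a repeated value would produce a zero of the derivative, which
  expansion excludes.\<close>

lemma full_branch_inj:
  assumes "full_branch_map \<Delta> \<Omega> T P g" "\<omega> \<in> \<Omega>"
  shows "inj_on T (P \<omega>)"
proof (rule linorder_inj_onI')
  fix a b assume ab: "a \<in> P \<omega>" "b \<in> P \<omega>" "a < b"
  have P: "is_interval (P \<omega>)" using assms by (auto simp: full_branch_map_def)
  have sub: "x \<in> P \<omega>" if "a \<le> x" "x \<le> b" for x
    using mem_is_interval_1_I[OF P ab(1,2) that] .
  obtain z where z: "a < z" "z < b" "T b - T a = (b - a) * deriv T z"
    using MVT2[OF ab(3), of T "deriv T"] full_branch_derivative(1)[OF assms] sub by blast
  then have "deriv T z \<noteq> 0" using full_branch_derivative(2)[OF assms sub] by auto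
  then show "T a \<noteq> T b" using z ab by auto
qed

lemma full_branch_image:
  assumes fb: "full_branch_map \<Delta> \<Omega> T P g" and w: "\<omega> \<in> \<Omega>"
  shows "g \<omega> ` interior \<Delta> = P \<omega>"
proof (intro equalityI subsetI)
  have g: "g \<omega> x \<in> P \<omega>" "T (g \<omega> x) = x" if "x \<in> interior \<Delta>" for x
    using fb w that unfolding full_branch_map_def by blast+
  show "y \<in> P \<omega>" if "y \<in> g \<omega> ` interior \<Delta>" for y using g that by auto
  fix y assume y: "y \<in> P \<omega>"
  then have Ty: "T y \<in> interior \<Delta>" using fb w unfolding full_branch_map_def by blast
  have "g \<omega> (T y) = y"
    using full_branch_inj[OF fb w] g[OF Ty] y by (auto dest: inj_onD)
  then show "y \<in> g \<omega> ` interior \<Delta>" using Ty by (metis image_eqI)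
qed

lemma full_branch_has_derivative:
  assumes "full_branch_map \<Delta> \<Omega> T P g" "\<omega> \<in> \<Omega>" "x \<in> \<Delta>"
  shows "(g \<omega> has_real_derivative dx \<Delta> (g \<omega>) x) (at x within \<Delta>)"
proof -
  have "g \<omega> \<in> C_k 3 \<Delta>" using assms by (auto simp: full_branch_map_def)
  from C_k_has_derivative[OF this, of 0 x] show ?thesis using assms by simp
qed

lemma branch_change_of_variables:
  assumes fb: "full_branch_map \<Delta> \<Omega> T P g" and w: "\<omega> \<in> \<Omega>"
    and f: "f \<in> borel_measurable (lebesgue_on \<Delta>)" "\<And>x. x \<in> \<Delta> \<Longrightarrow> \<bar>f x\<bar> \<le> (B :: real)"
  shows "integrable (lebesgue_on \<Delta>) (\<lambda>x. f (g \<omega> x) * \<bar>dx \<Delta> (g \<omega>) x\<bar>)"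
    and "(LINT x|lebesgue_on \<Delta>. f (g \<omega> x) * \<bar>dx \<Delta> (g \<omega>) x\<bar>) = (LINT x|lebesgue_on \<Delta>. indicator (P \<omega>) x * f x)"
    and "integrable (lebesgue_on \<Delta>) (\<lambda>x. indicator (P \<omega>) x * f x)"
proof -
  let ?U = "interior \<Delta>" and ?F = "\<lambda>x. \<bar>dx \<Delta> (g \<omega>) x\<bar> * f (g \<omega> x)"
  have P: "open (P \<omega>)" "P \<omega> \<subseteq> \<Delta>" using fb w by (auto simp: full_branch_map_def)
  have Ps: "P \<omega> \<in> sets lebesgue" using P(1) by (simp add: borel_open sets_completionI_sets)
  have fD: "f absolutely_integrable_on \<Delta>"
    using integrable_bounded[OF f] by (simp add: integrable_iff_absolutely_integrable)
  have fP: "f absolutely_integrable_on P \<omega>"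
    by (rule set_integrable_subset[OF fD Ps P(2)])
  have inj: "inj_on (g \<omega>) ?U"
  proof (rule inj_on_inverseI)
    show "T (g \<omega> x) = x" if "x \<in> ?U" for x
      using fb w that unfolding full_branch_map_def by blast
  qed
  have der: "(g \<omega> has_real_derivative dx \<Delta> (g \<omega>) x) (at x within ?U)" if "x \<in> ?U" for x
    by (rule has_field_derivative_subset[OF full_branch_has_derivative[OF fb w] interior_subset])
      (rule interior_subset'[OF that])
  have cov: "?F absolutely_integrable_on ?U" "integral ?U ?F = integral (P \<omega>) f"
    using has_absolute_integral_change_of_variables_1'[OF sets_interior der inj, of f "integral (P \<omega>) f"] fP
    by (simp_all add: full_branch_image[OF fb w])
  have neg: "negligible {x \<in> ?U - \<Delta>. ?F x \<noteq> 0}" "negligible {x \<in> \<Delta> - ?U. ?F x \<noteq> 0}"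
    using interior_subset by (auto intro: negligible_subset[OF negligible_boundary])
  have D: "?F absolutely_integrable_on \<Delta>"
    using cov(1) absolutely_integrable_spike_set_eq[OF neg] by simp
  then have int: "integrable (lebesgue_on \<Delta>) ?F" by (simp add: integrable_iff_absolutely_integrable)
  then show "integrable (lebesgue_on \<Delta>) (\<lambda>x. f (g \<omega> x) * \<bar>dx \<Delta> (g \<omega>) x\<bar>)" by (simp add: mult.commute)
  have "(LINT x|lebesgue_on \<Delta>. ?F x) = integral \<Delta> ?F"
    by (rule lebesgue_integral_eq_integral[OF int sets_dom])
  also have "\<dots> = integral ?U ?F"
    by (rule integral_spike_set[OF neg(2,1)])
  also have "\<dots> = integral (P \<omega>) f" by (rule cov(2))
  also have "\<dots> = (LINT x|lebesgue_on (P \<omega>). f x)"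
    using fP Ps by (intro lebesgue_integral_eq_integral[symmetric]) (simp_all add: integrable_iff_absolutely_integrable)
  also have "\<dots> = (LINT x|lebesgue_on \<Delta>. indicator (P \<omega>) x * f x)"
    by (rule integral_indicator_subset[OF Ps P(2), symmetric])
  finally show "(LINT x|lebesgue_on \<Delta>. f (g \<omega> x) * \<bar>dx \<Delta> (g \<omega>) x\<bar>) = (LINT x|lebesgue_on \<Delta>. indicator (P \<omega>) x * f x)"
    by (simp add: mult.commute)
  have "P \<omega> \<in> sets (lebesgue_on \<Delta>)" using Ps P(2) by (simp add: sets_restrict_space_iff)
  from integrable_mult_indicator[OF this integrable_bounded[OF f]]
  show "integrable (lebesgue_on \<Delta>) (\<lambda>x. indicator (P \<omega>) x * f x)" by simp
qed

text \<open>Every branch contributes the integral of \<open>f\<close> over its own domain, and the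
  domains partition \<Delta> up to a null set. The summable weights dominate the L^1 norms, which
  justifies exchanging sum and integral.\<close>

lemma full_branch_integral_PF:
  assumes fb: "full_branch_map \<Delta> \<Omega> T P g" and \<Omega>: "countable \<Omega>"
    and s: "s summable_on \<Omega>" "\<And>\<omega> x. \<omega> \<in> \<Omega> \<Longrightarrow> x \<in> \<Delta> \<Longrightarrow> \<bar>dx \<Delta> (g \<omega>) x\<bar> \<le> s \<omega>"
    and f: "f \<in> borel_measurable (lebesgue_on \<Delta>)" "\<And>x. x \<in> \<Delta> \<Longrightarrow> \<bar>f x\<bar> \<le> (B :: real)"
  shows "integrable (lebesgue_on \<Delta>) (PF \<Delta> \<Omega> g f)"
    and "(LINT x|lebesgue_on \<Delta>. PF \<Delta> \<Omega> g f x) = (LINT x|lebesgue_on \<Delta>. f x)"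
proof -
  let ?M = "lebesgue_on \<Delta>" and ?F = "\<lambda>\<omega> x. f (g \<omega> x) * \<bar>dx \<Delta> (g \<omega>) x\<bar>"
    and ?I = "\<lambda>\<omega> x. indicator (P \<omega>) x * f x"
  have g_in: "g \<omega> x \<in> \<Delta>" if "\<omega> \<in> \<Omega>" "x \<in> \<Delta>" for \<omega> x
    using fb that unfolding full_branch_map_def by blast
  have absf: "(\<lambda>x. \<bar>f x\<bar>) \<in> borel_measurable ?M" "\<And>x. x \<in> \<Delta> \<Longrightarrow> \<bar>\<bar>f x\<bar>\<bar> \<le> B" using f by auto
  note cov = branch_change_of_variables[OF fb _ f] and cov' = branch_change_of_variables[OF fb _ absf]
  have Fb: "\<bar>?F \<omega> x\<bar> \<le> B * s \<omega>" if "\<omega> \<in> \<Omega>" "x \<in> \<Delta>" for \<omega> x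
    unfolding abs_mult abs_abs
    by (rule mult_mono[OF f(2)[OF g_in[OF that]] s(2)[OF that]])
      (use f(2)[OF g_in[OF that]] in auto)
  have bs: "(\<lambda>\<omega>. B * s \<omega> * len) summable_on \<Omega>" "(\<lambda>\<omega>. B * s \<omega>) summable_on \<Omega>"
    using summable_on_cmult_right[OF s(1), of B] summable_on_cmult_left[of "\<lambda>\<omega>. B * s \<omega>" \<Omega> len] by auto
  have b1: "(LINT x|?M. \<bar>?F \<omega> x\<bar>) \<le> B * s \<omega> * len" if "\<omega> \<in> \<Omega>" for \<omega>
    by (rule abs_integral_le[OF borel_measurable_integrable[OF cov(1)[OF that]] Fb[OF that]])
  have sF: "(\<lambda>\<omega>. ?F \<omega> x) summable_on \<Omega>" if "x \<in> space ?M" for x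
    by (rule summable_on_dominated[OF bs(2) Fb]) (use that in auto)
  have PFeq: "PF \<Delta> \<Omega> g f = (\<lambda>x. \<Sum>\<^sub>\<infinity>\<omega>\<in>\<Omega>. ?F \<omega> x)"
    by (rule ext) (simp add: PF_def)
  note PFint = integral_infsum[OF \<Omega> cov(1) bs(1) b1 sF]
  show "integrable ?M (PF \<Delta> \<Omega> g f)" unfolding PFeq by (rule PFint(1))
  \<comment> \<open>Changing variables for the absolute value of \<open>f\<close> shows that the
    indicator term has the same L^1 norm as the branch term, so one majorant serves both
    sums.\<close>
  have b2: "(LINT x|?M. \<bar>?I \<omega> x\<bar>) \<le> B * s \<omega> * len" if w: "\<omega> \<in> \<Omega>" for \<omega>
  proof -
    have "(LINT x|?M. \<bar>?I \<omega> x\<bar>) = (LINT x|?M. indicator (P \<omega>) x * \<bar>f x\<bar>)"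
      by (simp add: abs_mult)
    also have "\<dots> = (LINT x|?M. \<bar>?F \<omega> x\<bar>)"
      using cov'(2)[OF w] by (simp add: abs_mult)
    finally show ?thesis using b1[OF w] by simp
  qed
  have disj: "disjoint_family_on P \<Omega>" using fb by (simp add: full_branch_map_def)
  have single: "?I \<omega>' x = 0" if "\<omega> \<in> \<Omega>" "x \<in> P \<omega>" "\<omega>' \<in> \<Omega>" "\<omega>' \<noteq> \<omega>" for \<omega> \<omega>' x
    using disj that by (auto simp: disjoint_family_on_def indicator_def)
  have sI: "(\<lambda>\<omega>. ?I \<omega> x) summable_on \<Omega>" for x
  proof (cases "\<exists>\<omega>\<in>\<Omega>. x \<in> P \<omega>")
    case True
    then obtain \<omega> where w: "\<omega> \<in> \<Omega>" "x \<in> P \<omega>" by blast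
    have "(\<lambda>\<omega>. ?I \<omega> x) summable_on \<Omega> \<longleftrightarrow> (\<lambda>\<omega>. ?I \<omega> x) summable_on {\<omega>}"
      by (rule summable_on_cong_neutral) (use w single[OF w] in auto)
    then show ?thesis by simp
  next
    case False
    then have "(\<lambda>\<omega>. ?I \<omega> x) summable_on \<Omega> \<longleftrightarrow> (\<lambda>_. 0 :: real) summable_on \<Omega>"
      by (intro summable_on_cong) (auto simp: indicator_def)
    then show ?thesis by simp
  qed
  note Iint = integral_infsum[OF \<Omega> cov(3) bs(1) b2 sI]
  have "\<Delta> - (\<Union>\<omega>\<in>\<Omega>. P \<omega>) \<in> null_sets lebesgue" using fb by (simp add: full_branch_map_def)
  then have "AE x in lebesgue. x \<notin> \<Delta> - (\<Union>\<omega>\<in>\<Omega>. P \<omega>)" by (rule AE_not_in)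
  then have "AE x in ?M. x \<in> (\<Union>\<omega>\<in>\<Omega>. P \<omega>)"
    by (auto simp: AE_restrict_space_iff)
  then have "AE x in ?M. f x = (\<Sum>\<^sub>\<infinity>\<omega>\<in>\<Omega>. ?I \<omega> x)"
  proof eventually_elim
    case (elim x)
    then obtain \<omega> where w: "\<omega> \<in> \<Omega>" "x \<in> P \<omega>" by blast
    have "(\<Sum>\<^sub>\<infinity>\<omega>\<in>\<Omega>. ?I \<omega> x) = (\<Sum>\<^sub>\<infinity>\<omega>\<in>{\<omega>}. ?I \<omega> x)"
      by (rule infsum_cong_neutral) (use w single[OF w] in auto)
    then show ?case using w by simp
  qed
  then have "(LINT x|?M. f x) = (LINT x|?M. (\<Sum>\<^sub>\<infinity>\<omega>\<in>\<Omega>. ?I \<omega> x))"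
    using f(1) borel_measurable_integrable[OF Iint(1)] by (intro integral_cong_AE) simp_all
  also have "\<dots> = (\<Sum>\<^sub>\<infinity>\<omega>\<in>\<Omega>. LINT x|?M. ?I \<omega> x)" by (rule Iint(2))
  also have "\<dots> = (\<Sum>\<^sub>\<infinity>\<omega>\<in>\<Omega>. LINT x|?M. ?F \<omega> x)"
    by (rule infsum_cong) (simp only: cov(2))
  also have "\<dots> = (LINT x|?M. PF \<Delta> \<Omega> g f x)" unfolding PFeq by (rule PFint(2)[symmetric])
  finally show "(LINT x|?M. PF \<Delta> \<Omega> g f x) = (LINT x|?M. f x)" ..
qed

text \<open>Preservation of the integral is applied to \<open>f\<close> times the indicator of the
  preimage of \<open>A\<close>; since \<open>T (g \<omega> x) = x\<close> in the interior, that
  factor leaves the sum over branches as the indicator of \<open>A\<close>.\<close>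

lemma full_branch_koopman:
  assumes fb: "full_branch_map \<Delta> \<Omega> T P g" and \<Omega>: "countable \<Omega>"
    and s: "s summable_on \<Omega>" "\<And>\<omega> x. \<omega> \<in> \<Omega> \<Longrightarrow> x \<in> \<Delta> \<Longrightarrow> \<bar>dx \<Delta> (g \<omega>) x\<bar> \<le> s \<omega>"
    and f: "f \<in> borel_measurable (lebesgue_on \<Delta>)" "\<And>x. x \<in> \<Delta> \<Longrightarrow> \<bar>f x\<bar> \<le> (B :: real)"
    and T: "T \<in> lebesgue_on \<Delta> \<rightarrow>\<^sub>M lebesgue_on \<Delta>" and A: "A \<in> sets (lebesgue_on \<Delta>)"
  shows "(LINT x|lebesgue_on \<Delta>. indicator A (T x) * f x) = (LINT x|lebesgue_on \<Delta>. indicator A x * PF \<Delta> \<Omega> g f x)"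
proof -
  let ?M = "lebesgue_on \<Delta>" and ?F = "\<lambda>x. indicator A (T x) * f x"
  have F: "?F \<in> borel_measurable ?M"
    using f(1) measurable_compose[OF T borel_measurable_indicator[OF A]] by (rule borel_measurable_times[rotated])
  have FB: "\<bar>?F x\<bar> \<le> B" if "x \<in> \<Delta>" for x
    using f(2)[OF that] by (auto simp: indicator_def)
  have "PF \<Delta> \<Omega> g ?F x = indicator A x * PF \<Delta> \<Omega> g f x" if x: "x \<in> interior \<Delta>" for x
  proof -
    have "T (g \<omega> x) = x" if "\<omega> \<in> \<Omega>" for \<omega>
      using fb x that unfolding full_branch_map_def by blast
    then have "PF \<Delta> \<Omega> g ?F x = (\<Sum>\<^sub>\<infinity>\<omega>\<in>\<Omega>. indicator A x * (f (g \<omega> x) * \<bar>dx \<Delta> (g \<omega>) x\<bar>))"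
      unfolding PF_def by (intro infsum_cong) (simp add: mult.assoc)
    then show ?thesis by (simp add: PF_def infsum_cmult_right')
  qed
  then have AE: "AE x in ?M. PF \<Delta> \<Omega> g ?F x = indicator A x * PF \<Delta> \<Omega> g f x"
    using AE_interior by (auto elim: AE_mp)
  have "(LINT x|?M. ?F x) = (LINT x|?M. PF \<Delta> \<Omega> g ?F x)"
    by (rule full_branch_integral_PF(2)[OF fb \<Omega> s F FB, symmetric])
  also have "\<dots> = (LINT x|?M. indicator A x * PF \<Delta> \<Omega> g f x)"
    using full_branch_integral_PF(1)[OF fb \<Omega> s F FB] full_branch_integral_PF(1)[OF fb \<Omega> s f] A
    by (intro integral_cong_AE[OF _ _ AE] borel_measurable_times borel_measurable_indicator) auto
  finally show ?thesis .
qed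

end

subsection \<open>Linear response of a uniform family\<close>

lemma abs_mult_le: "\<bar>a\<bar> \<le> A \<Longrightarrow> \<bar>b\<bar> \<le> B \<Longrightarrow> \<bar>a * b\<bar> \<le> A * B" for a b :: real
  unfolding abs_mult by (rule mult_mono) auto

context contracting_branches begin

lemma PF_funpow_scale: "(L ^^ n) (\<lambda>x. c * f x) = (\<lambda>x. c * (L ^^ n) f x)"
  by (induction n) (simp_all add: PF_def fun_eq_iff mult.assoc infsum_cmult_right')

text \<open>Iteration leaves \<open>f\<close> unchanged although the iterates decay; this is the
  injectivity of I - L on functions of mean zero.\<close>

lemma PF_fixed_point_zero:
  assumes "K-lipschitz_on \<Delta> f" "(LINT x|lebesgue_on \<Delta>. f x) = 0" "\<And>x. x \<in> \<Delta> \<Longrightarrow> L f x = f x" "x \<in> \<Delta>"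
  shows "f x = 0"
proof -
  have iter: "(L ^^ n) f y = f y" if "y \<in> \<Delta>" for n y
    using that
  proof (induction n arbitrary: y)
    case (Suc n)
    then show ?case using PF_cong[OF Suc.IH Suc.prems] assms(3)[OF Suc.prems] by simp
  qed simp
  have "(\<lambda>n. dconst * rate ^ n * K) \<longlonglongrightarrow> dconst * 0 * K"
    by (intro tendsto_mult tendsto_const LIMSEQ_realpow_zero rate_nonneg rate_less)
  moreover have "\<forall>n. \<bar>f x\<bar> \<le> dconst * rate ^ n * K"
    using PF_decay(2)[OF assms(1,2,4)] iter[OF assms(4)] by simp
  ultimately have "\<bar>f x\<bar> \<le> dconst * 0 * K"
    using LIMSEQ_le_const by blast
  then show ?thesis by simp
qed

end

text \<open>\<open>s\<close> majorizes g', while \<open>c1\<close> and \<open>c2\<close> majorize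
  the variation of g' and g'' per unit of \<epsilon>; \<open>K\<close> does so for g and is not
  summed. \<sigma> is the orientation of a branch, independent of \<epsilon> and x: it turns the
  absolute value in the operator into a differentiable expression. \<gamma> is the velocity of a
  branch at \<epsilon> = 0.\<close>

locale uniform_family = bounded_interval +
  fixes \<Omega> :: "'w set" and g :: "real \<Rightarrow> 'w \<Rightarrow> real \<Rightarrow> real" and r l D K :: real
    and s c1 c2 \<sigma> :: "'w \<Rightarrow> real"
  assumes r_pos: "0 < r"
    and contracting: "\<bar>e\<bar> < r \<Longrightarrow> contracting_branches \<Delta> \<Omega> (g e) s l D"
    and der1: "\<bar>e\<bar> < r \<Longrightarrow> \<omega> \<in> \<Omega> \<Longrightarrow> x \<in> \<Delta> \<Longrightarrow>
      (g e \<omega> has_real_derivative dx \<Delta> (g e \<omega>) x) (at x within \<Delta>)"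
    and der2: "\<bar>e\<bar> < r \<Longrightarrow> \<omega> \<in> \<Omega> \<Longrightarrow> x \<in> \<Delta> \<Longrightarrow>
      (dx \<Delta> (g e \<omega>) has_real_derivative dx \<Delta> (dx \<Delta> (g e \<omega>)) x) (at x within \<Delta>)"
    and cont2: "\<bar>e\<bar> < r \<Longrightarrow> \<omega> \<in> \<Omega> \<Longrightarrow> continuous_on \<Delta> (dx \<Delta> (dx \<Delta> (g e \<omega>)))"
    and sign: "\<bar>e\<bar> < r \<Longrightarrow> \<omega> \<in> \<Omega> \<Longrightarrow> x \<in> \<Delta> \<Longrightarrow> \<bar>dx \<Delta> (g e \<omega>) x\<bar> = \<sigma> \<omega> * dx \<Delta> (g e \<omega>) x"
    and abs_sign: "\<omega> \<in> \<Omega> \<Longrightarrow> \<bar>\<sigma> \<omega>\<bar> = 1"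
    and second_le: "\<bar>e\<bar> < r \<Longrightarrow> \<omega> \<in> \<Omega> \<Longrightarrow> x \<in> \<Delta> \<Longrightarrow>
      \<bar>dx \<Delta> (dx \<Delta> (g e \<omega>)) x\<bar> \<le> D * \<bar>dx \<Delta> (g e \<omega>) x\<bar>"
    and vary0: "\<bar>e\<bar> < r \<Longrightarrow> \<omega> \<in> \<Omega> \<Longrightarrow> x \<in> \<Delta> \<Longrightarrow> \<bar>g e \<omega> x - g 0 \<omega> x\<bar> \<le> K * \<bar>e\<bar>"
    and vary1: "\<bar>e\<bar> < r \<Longrightarrow> \<omega> \<in> \<Omega> \<Longrightarrow> x \<in> \<Delta> \<Longrightarrow> \<bar>dx \<Delta> (g e \<omega>) x - dx \<Delta> (g 0 \<omega>) x\<bar> \<le> c1 \<omega> * \<bar>e\<bar>"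
    and vary2: "\<bar>e\<bar> < r \<Longrightarrow> \<omega> \<in> \<Omega> \<Longrightarrow> x \<in> \<Delta> \<Longrightarrow>
      \<bar>dx \<Delta> (dx \<Delta> (g e \<omega>)) x - dx \<Delta> (dx \<Delta> (g 0 \<omega>)) x\<bar> \<le> c2 \<omega> * \<bar>e\<bar>"
    and c_summable: "c1 summable_on \<Omega>" "c2 summable_on \<Omega>"
  fixes \<gamma> :: "'w \<Rightarrow> real \<Rightarrow> real"
  assumes eps0: "\<omega> \<in> \<Omega> \<Longrightarrow> x \<in> \<Delta> \<Longrightarrow> ((\<lambda>e. g e \<omega> x) has_real_derivative \<gamma> \<omega> x) (at 0)"
    and eps1: "\<omega> \<in> \<Omega> \<Longrightarrow> x \<in> \<Delta> \<Longrightarrow> ((\<lambda>e. dx \<Delta> (g e \<omega>) x) has_real_derivative dx \<Delta> (\<gamma> \<omega>) x) (at 0)"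
    and gamma1: "\<omega> \<in> \<Omega> \<Longrightarrow> x \<in> \<Delta> \<Longrightarrow> (\<gamma> \<omega> has_real_derivative dx \<Delta> (\<gamma> \<omega>) x) (at x within \<Delta>)"
    and gamma2: "\<omega> \<in> \<Omega> \<Longrightarrow> x \<in> \<Delta> \<Longrightarrow>
      (dx \<Delta> (\<gamma> \<omega>) has_real_derivative dx \<Delta> (dx \<Delta> (\<gamma> \<omega>)) x) (at x within \<Delta>)"
    and gamma2_cont: "\<omega> \<in> \<Omega> \<Longrightarrow> continuous_on \<Delta> (dx \<Delta> (dx \<Delta> (\<gamma> \<omega>)))"
    and gamma_le: "\<omega> \<in> \<Omega> \<Longrightarrow> x \<in> \<Delta> \<Longrightarrow> \<bar>\<gamma> \<omega> x\<bar> \<le> K"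
      "\<omega> \<in> \<Omega> \<Longrightarrow> x \<in> \<Delta> \<Longrightarrow> \<bar>dx \<Delta> (\<gamma> \<omega>) x\<bar> \<le> c1 \<omega>"
      "\<omega> \<in> \<Omega> \<Longrightarrow> x \<in> \<Delta> \<Longrightarrow> \<bar>dx \<Delta> (dx \<Delta> (\<gamma> \<omega>)) x\<bar> \<le> c2 \<omega>"
begin

abbreviation "g1 e \<omega> \<equiv> dx \<Delta> (g e \<omega>)"
abbreviation "g2 e \<omega> \<equiv> dx \<Delta> (dx \<Delta> (g e \<omega>))"
abbreviation "S \<equiv> infsum s \<Omega>"

sublocale base: contracting_branches \<Delta> \<Omega> "g 0" s l D
  using contracting[of 0] r_pos by simp

lemma branch_in: "\<bar>e\<bar> < r \<Longrightarrow> \<omega> \<in> \<Omega> \<Longrightarrow> x \<in> \<Delta> \<Longrightarrow> g e \<omega> x \<in> \<Delta>"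
  by (rule contracting_branches.branch_in[OF contracting])

lemma g1_le: "\<bar>e\<bar> < r \<Longrightarrow> \<omega> \<in> \<Omega> \<Longrightarrow> x \<in> \<Delta> \<Longrightarrow> \<bar>g1 e \<omega> x\<bar> \<le> s \<omega>"
  by (rule contracting_branches.weight_le[OF contracting])

lemma s_nonneg: "\<omega> \<in> \<Omega> \<Longrightarrow> 0 \<le> s \<omega>"
  using base.weight_le dom_ne abs_ge_zero order_trans by blast

lemma s_le_S: "\<omega> \<in> \<Omega> \<Longrightarrow> s \<omega> \<le> S"
  using finite_sum_le_infsum[OF base.weight_summable, of "{\<omega>}"] s_nonneg by simp

lemma S_nonneg: "0 \<le> S"
  by (rule infsum_nonneg) (rule s_nonneg)

lemma g1_le_S: "\<bar>e\<bar> < r \<Longrightarrow> \<omega> \<in> \<Omega> \<Longrightarrow> x \<in> \<Delta> \<Longrightarrow> \<bar>g1 e \<omega> x\<bar> \<le> S"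
  using g1_le s_le_S order_trans by blast

lemma g2_le: "\<bar>e\<bar> < r \<Longrightarrow> \<omega> \<in> \<Omega> \<Longrightarrow> x \<in> \<Delta> \<Longrightarrow> \<bar>g2 e \<omega> x\<bar> \<le> D * s \<omega>"
  using second_le mult_left_mono[OF g1_le base.D_nonneg] order_trans by blast

lemma PF_signed:
  "\<bar>e\<bar> < r \<Longrightarrow> x \<in> \<Delta> \<Longrightarrow> PF \<Delta> \<Omega> (g e) f x = (\<Sum>\<^sub>\<infinity>\<omega>\<in>\<Omega>. \<sigma> \<omega> * (f (g e \<omega> x) * g1 e \<omega> x))"
  unfolding PF_def by (rule infsum_cong) (simp add: sign mult_ac)

section \<open>C^1 regularity of the unperturbed operator and inversion of I - L\<close>

lemma g_chain:
  assumes "x \<in> \<Delta>" "\<bar>e\<bar> < r" "\<omega> \<in> \<Omega>" "\<And>x. x \<in> \<Delta> \<Longrightarrow> (f has_real_derivative f' x) (at x within \<Delta>)"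
  shows "((\<lambda>x. f (g e \<omega> x)) has_real_derivative f' (g e \<omega> x) * g1 e \<omega> x) (at x within \<Delta>)"
proof -
  have "(f has_real_derivative f' (g e \<omega> x)) (at (g e \<omega> x) within g e \<omega> ` \<Delta>)"
    by (rule has_field_derivative_subset[OF assms(4)]) (use branch_in assms in auto)
  from DERIV_image_chain[OF this der1[OF assms(2,3,1)]] show ?thesis by (simp add: o_def)
qed

lemma abs_sign_mult: "\<omega> \<in> \<Omega> \<Longrightarrow> \<bar>\<sigma> \<omega> * a\<bar> = \<bar>a\<bar>"
  by (simp add: abs_mult abs_sign)

lemma branch_term_derivative:
  assumes "\<bar>e\<bar> < r" "\<omega> \<in> \<Omega>" "x \<in> \<Delta>" "\<And>x. x \<in> \<Delta> \<Longrightarrow> (f has_real_derivative f' x) (at x within \<Delta>)"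
  shows "((\<lambda>x. \<sigma> \<omega> * (f (g e \<omega> x) * g1 e \<omega> x)) has_real_derivative
    \<sigma> \<omega> * (f' (g e \<omega> x) * (g1 e \<omega> x)\<^sup>2 + f (g e \<omega> x) * g2 e \<omega> x)) (at x within \<Delta>)"
  by (rule DERIV_cong[OF DERIV_cmult[OF DERIV_mult[OF g_chain[OF assms(3,1,2,4)] der2[OF assms(1-3)]]]])
    (simp_all add: algebra_simps power2_eq_square)

lemma continuous_comp_g:
  assumes "\<bar>e\<bar> < r" "\<omega> \<in> \<Omega>" "continuous_on \<Delta> f"
  shows "continuous_on \<Delta> (\<lambda>x. f (g e \<omega> x))"
proof (rule continuous_on_compose2[OF assms(3)])
  show "continuous_on \<Delta> (g e \<omega>)" by (rule DERIV_continuous_on[OF der1[OF assms(1,2)]])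
qed (use branch_in assms in auto)

lemma continuous_g1: "\<bar>e\<bar> < r \<Longrightarrow> \<omega> \<in> \<Omega> \<Longrightarrow> continuous_on \<Delta> (g1 e \<omega>)"
  by (rule DERIV_continuous_on[OF der2])

text \<open>Termwise differentiation: g'' is bounded by \<open>D * s\<close>, and one of the two
  factors g' is bounded by \<open>S\<close>, so the differentiated series has a summable
  majorant.\<close>

lemma PF_C_b_1:
  assumes f: "f \<in> C_b 1 \<Delta>"
  shows "base.L f \<in> C_b 1 \<Delta>"
proof -
  obtain K0 where "K0-lipschitz_on \<Delta> f" using C_b_1D(3)[OF f] by blast
  then obtain B0 where B0: "0 \<le> B0" "\<And>x. x \<in> \<Delta> \<Longrightarrow> \<bar>f x\<bar> \<le> B0" using lipschitz_bounded by metis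
  obtain B1 where B1: "\<And>x. x \<in> \<Delta> \<Longrightarrow> \<bar>dx \<Delta> f x\<bar> \<le> B1" using C_b_1D(4)[OF f] by blast
  have "0 \<le> B1" using B1 dom_ne abs_ge_zero order_trans by blast
  define F where "F \<omega> x = \<sigma> \<omega> * (f (g 0 \<omega> x) * g1 0 \<omega> x)" for \<omega> x
  define F' where "F' \<omega> x = \<sigma> \<omega> * (dx \<Delta> f (g 0 \<omega> x) * (g1 0 \<omega> x)\<^sup>2 + f (g 0 \<omega> x) * g2 0 \<omega> x)" for \<omega> x
  define b where "b \<omega> = B0 * s \<omega>" for \<omega>
  define b' where "b' \<omega> = (B1 * S + B0 * D) * s \<omega>" for \<omega>
  have sm: "b summable_on \<Omega>" "b' summable_on \<Omega>"
    unfolding b_def b'_def by (intro summable_on_cmult_right base.weight_summable)+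
  have Fb: "\<bar>F \<omega> x\<bar> \<le> b \<omega>" if "\<omega> \<in> \<Omega>" "x \<in> \<Delta>" for \<omega> x
    unfolding F_def b_def abs_mult abs_sign[OF that(1)] mult_1
    using B0 base.branch_in[OF that] base.weight_le[OF that] by (intro mult_mono) auto
  have F'b: "\<bar>F' \<omega> x\<bar> \<le> b' \<omega>" if "\<omega> \<in> \<Omega>" "x \<in> \<Delta>" for \<omega> x
  proof -
    have "\<bar>dx \<Delta> f (g 0 \<omega> x) * (g1 0 \<omega> x)\<^sup>2\<bar> \<le> B1 * (S * s \<omega>)"
      unfolding abs_mult power2_eq_square
      using B1 base.branch_in[OF that] g1_le[OF _ that] g1_le_S[OF _ that] r_pos S_nonneg \<open>0 \<le> B1\<close>
      by (intro mult_mono) auto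
    moreover have "\<bar>f (g 0 \<omega> x) * g2 0 \<omega> x\<bar> \<le> B0 * (D * s \<omega>)"
      unfolding abs_mult
      using B0 base.branch_in[OF that] g2_le[OF _ that] r_pos by (intro mult_mono) auto
    ultimately show ?thesis
      using abs_triangle_ineq[of "dx \<Delta> f (g 0 \<omega> x) * (g1 0 \<omega> x)\<^sup>2" "f (g 0 \<omega> x) * g2 0 \<omega> x"]
      unfolding F'_def b'_def abs_sign_mult[OF that(1)] by (simp add: distrib_right mult.assoc)
  qed
  have der: "(F \<omega> has_real_derivative F' \<omega> x) (at x within \<Delta>)" if "\<omega> \<in> \<Omega>" "x \<in> \<Delta>" for \<omega> x
    unfolding F_def F'_def using r_pos that C_b_1D(1)[OF f] by (intro branch_term_derivative) auto
  have contF': "continuous_on \<Delta> (F' \<omega>)" if "\<omega> \<in> \<Omega>" for \<omega>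
    unfolding F'_def using r_pos that C_b_1D(2)[OF f] lipschitz_on_continuous_on[OF \<open>K0-lipschitz_on \<Delta> f\<close>]
    by (intro continuous_on_mult continuous_on_add continuous_on_const continuous_on_power
        continuous_comp_g continuous_g1 cont2) auto
  have cont: "continuous_on \<Delta> (\<lambda>x. \<Sum>\<^sub>\<infinity>\<omega>\<in>\<Omega>. F' \<omega> x)"
    by (rule continuous_on_infsum[OF sm(2) F'b contF'])
  have "(\<lambda>x. \<Sum>\<^sub>\<infinity>\<omega>\<in>\<Omega>. F \<omega> x) \<in> C_b 1 \<Delta>"
  proof (rule C_b_1I)
    show "((\<lambda>x. \<Sum>\<^sub>\<infinity>\<omega>\<in>\<Omega>. F \<omega> x) has_real_derivative (\<Sum>\<^sub>\<infinity>\<omega>\<in>\<Omega>. F' \<omega> x)) (at x within \<Delta>)" if "x \<in> \<Delta>" for x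
      by (rule has_real_derivative_infsum[OF base.countable_index sm convex_dom Fb F'b der that])
    show "\<bar>\<Sum>\<^sub>\<infinity>\<omega>\<in>\<Omega>. F' \<omega> x\<bar> \<le> infsum b' \<Omega>" if "x \<in> \<Delta>" for x
      by (rule abs_infsum_le[OF sm(2) F'b[OF _ that]])
  qed (rule cont)
  then show ?thesis
    using C_b_cong[of "base.L f" "\<lambda>x. \<Sum>\<^sub>\<infinity>\<omega>\<in>\<Omega>. F \<omega> x" 1] PF_signed[of 0] r_pos by (simp add: F_def)
qed

lemma PF_funpow_C_b_1: "f \<in> C_b 1 \<Delta> \<Longrightarrow> (base.L ^^ n) f \<in> C_b 1 \<Delta>"
  by (induction n) (auto simp del: One_nat_def intro: PF_C_b_1)

text \<open>The derivative of each iterate is bounded by its Lipschitz constant, so the decay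
  theorem also provides a geometric majorant for the differentiated series.\<close>

lemma neumann_C_b_1:
  assumes f: "f \<in> C_b 1 \<Delta>" and zero: "(LINT x|lebesgue_on \<Delta>. f x) = 0"
  shows "(\<lambda>x. \<Sum>n. (base.L ^^ n) f x) \<in> C_b 1 \<Delta>"
proof -
  obtain K0 where K0: "K0-lipschitz_on \<Delta> f" using C_b_1D(3)[OF f] by blast
  define b where "b n = base.dconst * base.rate ^ n * K0" for n
  have "summable b" unfolding b_def
    using base.rate_nonneg base.rate_less by (intro summable_mult2 summable_mult summable_geometric) simp
  moreover have "0 \<le> b n" for n
    using base.dconst_nonneg base.rate_nonneg lipschitz_on_nonneg[OF K0] by (simp add: b_def)
  ultimately have b: "b summable_on UNIV" by (rule summable_nonneg_imp_summable_on)
  note C1 = PF_funpow_C_b_1[OF f]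
  have fb: "\<bar>(base.L ^^ n) f x\<bar> \<le> b n" if "x \<in> \<Delta>" for n x
    unfolding b_def by (rule base.PF_decay(2)[OF K0 zero that])
  have f'b: "\<bar>dx \<Delta> ((base.L ^^ n) f) x\<bar> \<le> b n" if "x \<in> \<Delta>" for n x
    unfolding b_def
    by (rule derivative_le_lipschitz[OF base.PF_decay(1)[OF K0 zero] that C_b_1D(1)[OF C1 that]])
  have "(\<lambda>x. \<Sum>\<^sub>\<infinity>n\<in>UNIV. (base.L ^^ n) f x) \<in> C_b 1 \<Delta>"
  proof (rule C_b_1I)
    show "((\<lambda>x. \<Sum>\<^sub>\<infinity>n\<in>UNIV. (base.L ^^ n) f x) has_real_derivative
        (\<Sum>\<^sub>\<infinity>n\<in>UNIV. dx \<Delta> ((base.L ^^ n) f) x)) (at x within \<Delta>)" if "x \<in> \<Delta>" for x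
      by (rule has_real_derivative_infsum[OF _ b b convex_dom fb f'b C_b_1D(1)[OF C1] that]) auto
    show "continuous_on \<Delta> (\<lambda>x. \<Sum>\<^sub>\<infinity>n\<in>UNIV. dx \<Delta> ((base.L ^^ n) f) x)"
      by (rule continuous_on_infsum[OF b f'b C_b_1D(2)[OF C1]])
    show "\<bar>\<Sum>\<^sub>\<infinity>n\<in>UNIV. dx \<Delta> ((base.L ^^ n) f) x\<bar> \<le> infsum b UNIV" if "x \<in> \<Delta>" for x
      by (rule abs_infsum_le[OF b f'b[OF that]])
  qed
  moreover have "(\<Sum>\<^sub>\<infinity>n\<in>UNIV. (base.L ^^ n) f x) = (\<Sum>n. (base.L ^^ n) f x)" if "x \<in> \<Delta>" for x
  proof -
    have "(\<lambda>n. (base.L ^^ n) f x) summable_on UNIV"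
      by (rule summable_on_dominated[OF b fb[OF that]])
    from has_sum_imp_sums[OF has_sum_infsum[OF this]] show ?thesis by (rule sums_unique)
  qed
  ultimately show ?thesis using C_b_cong by (metis (no_types, lifting))
qed

lemma C1_zeroI:
  assumes "f \<in> C_b 1 \<Delta>" "(LINT x|lebesgue_on \<Delta>. f x) = 0"
  shows "restrict f \<Delta> \<in> C1_zero \<Delta>"
proof -
  have "restrict f \<Delta> \<in> C_b 1 \<Delta>" using C_b_cong[of "restrict f \<Delta>" f 1] assms(1) by simp
  moreover have "(LINT x|lebesgue_on \<Delta>. restrict f \<Delta> x) = 0"
    by (rule trans[OF integral_cong_dom assms(2)]) simp
  ultimately show ?thesis
    using restrict_extensional unfolding C1_zero_def by blast
qed

lemma I_minus_neumann:
  assumes f: "f \<in> C1_zero \<Delta>"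
  defines "u \<equiv> restrict (\<lambda>x. \<Sum>n. (base.L ^^ n) f x) \<Delta>"
  shows "u \<in> C1_zero \<Delta>" "I_minus \<Delta> base.L u = f"
proof -
  have f': "f \<in> C_b 1 \<Delta>" "(LINT x|lebesgue_on \<Delta>. f x) = 0" "f \<in> extensional \<Delta>"
    using f by (auto simp: C1_zero_def)
  obtain K0 where K0: "K0-lipschitz_on \<Delta> f" using C_b_1D(3)[OF f'(1)] by blast
  show "u \<in> C1_zero \<Delta>" unfolding u_def
    by (rule C1_zeroI[OF neumann_C_b_1[OF f'(1,2)] base.PF_neumann_mean[OF K0 f'(2)]])
  show "I_minus \<Delta> base.L u = f"
  proof
    fix x show "I_minus \<Delta> base.L u x = f x"
    proof (cases "x \<in> \<Delta>")
      case True
      have "base.L u x = base.L (\<lambda>x. \<Sum>n. (base.L ^^ n) f x) x"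
        by (rule base.PF_cong[OF _ True]) (simp add: u_def)
      also have "\<dots> = (\<Sum>n. (base.L ^^ n) f x) - f x"
        by (rule base.PF_neumann_eq[OF K0 f'(2) True])
      finally show ?thesis using True by (simp add: I_minus_def u_def)
    next
      case False
      then show ?thesis using f'(3) by (simp add: I_minus_def extensional_def)
    qed
  qed
qed

text \<open>Surjectivity is the Neumann series; injectivity is
  \<open>base.PF_fixed_point_zero\<close> for the difference, and extensionality upgrades equality
  on \<Delta> to equality of functions.\<close>

lemma bij_I_minus: "bij_betw (I_minus \<Delta> base.L) (C1_zero \<Delta>) (C1_zero \<Delta>)"
proof (rule bij_betwI')
  fix f assume f: "f \<in> C1_zero \<Delta>"
  then have f': "f \<in> C_b 1 \<Delta>" "(LINT x|lebesgue_on \<Delta>. f x) = 0" by (auto simp: C1_zero_def)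
  obtain K0 where K0: "K0-lipschitz_on \<Delta> f" using C_b_1D(3)[OF f'(1)] by blast
  obtain K1 where K1: "K1-lipschitz_on \<Delta> (base.L f)" using C_b_1D(3)[OF PF_C_b_1[OF f'(1)]] by blast
  obtain B0 where B0: "\<And>x. x \<in> \<Delta> \<Longrightarrow> \<bar>dx \<Delta> f x\<bar> \<le> B0" using C_b_1D(4)[OF f'(1)] by blast
  obtain B1 where B1: "\<And>x. x \<in> \<Delta> \<Longrightarrow> \<bar>dx \<Delta> (base.L f) x\<bar> \<le> B1" using C_b_1D(4)[OF PF_C_b_1[OF f'(1)]] by blast
  have "(\<lambda>x. f x - base.L f x) \<in> C_b 1 \<Delta>"
  proof (rule C_b_1I)
    show "((\<lambda>x. f x - base.L f x) has_real_derivative dx \<Delta> f x - dx \<Delta> (base.L f) x) (at x within \<Delta>)"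
      if "x \<in> \<Delta>" for x
      by (rule DERIV_diff[OF C_b_1D(1)[OF f'(1) that] C_b_1D(1)[OF PF_C_b_1[OF f'(1)] that]])
    show "continuous_on \<Delta> (\<lambda>x. dx \<Delta> f x - dx \<Delta> (base.L f) x)"
      by (rule continuous_on_diff[OF C_b_1D(2)[OF f'(1)] C_b_1D(2)[OF PF_C_b_1[OF f'(1)]]])
    show "\<bar>dx \<Delta> f x - dx \<Delta> (base.L f) x\<bar> \<le> B0 + B1" if "x \<in> \<Delta>" for x
      using B0[OF that] B1[OF that] by linarith
  qed
  moreover have "(LINT x|lebesgue_on \<Delta>. f x - base.L f x) = 0"
    using lipschitz_integrable[OF K0] lipschitz_integrable[OF K1] base.integral_PF[OF K0] by simp
  ultimately show "I_minus \<Delta> base.L f \<in> C1_zero \<Delta>"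
    unfolding I_minus_def by (rule C1_zeroI)
next
  fix f f' assume f: "f \<in> C1_zero \<Delta>" and f': "f' \<in> C1_zero \<Delta>"
  obtain K0 K1 where K: "K0-lipschitz_on \<Delta> f" "K1-lipschitz_on \<Delta> f'"
    using C_b_1D(3) f f' unfolding C1_zero_def by blast
  obtain B0 B1 where B: "\<And>x. x \<in> \<Delta> \<Longrightarrow> \<bar>f x\<bar> \<le> B0" "\<And>x. x \<in> \<Delta> \<Longrightarrow> \<bar>f' x\<bar> \<le> B1"
    using lipschitz_bounded[OF K(1)] lipschitz_bounded[OF K(2)] by metis
  show "I_minus \<Delta> base.L f = I_minus \<Delta> base.L f' \<longleftrightarrow> f = f'"
  proof
    assume eq: "I_minus \<Delta> base.L f = I_minus \<Delta> base.L f'"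
    have "f x = f' x" if x: "x \<in> \<Delta>" for x
    proof -
      have "f x - f' x = 0"
      proof (rule base.PF_fixed_point_zero[OF lipschitz_on_diff[OF K] _ _ x])
        show "(LINT x|lebesgue_on \<Delta>. f x - f' x) = 0"
          using lipschitz_integrable[OF K(1)] lipschitz_integrable[OF K(2)] f f' by (simp add: C1_zero_def)
        show "base.L (\<lambda>x. f x - f' x) y = f y - f' y" if "y \<in> \<Delta>" for y
          using fun_cong[OF eq, of y] base.PF_diff[OF B that] that by (simp add: I_minus_def)
      qed
      then show ?thesis by simp
    qed
    then show "f = f'"
      using f f' by (intro extensionalityI[of f \<Delta> f']) (auto simp: C1_zero_def)
  qed simp
next
  fix f assume "f \<in> C1_zero \<Delta>"
  then show "\<exists>u\<in>C1_zero \<Delta>. f = I_minus \<Delta> base.L u"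
    using I_minus_neumann by metis
qed

text \<open>The \<open>\<epsilon>\<close>-derivative of \<open>L\<^sub>\<epsilon> u\<close> at \<open>\<epsilon> = 0\<close>, one summand for each branch.\<close>
definition response_term :: "(real \<Rightarrow> real) \<Rightarrow> 'w \<Rightarrow> real \<Rightarrow> real" where
  "response_term u \<omega> x = \<sigma> \<omega> * (dx \<Delta> u (g 0 \<omega> x) * \<gamma> \<omega> x * g1 0 \<omega> x + u (g 0 \<omega> x) * dx \<Delta> (\<gamma> \<omega>) x)"

definition response_source :: "(real \<Rightarrow> real) \<Rightarrow> real \<Rightarrow> real" where
  "response_source u x = (\<Sum>\<^sub>\<infinity>\<omega>\<in>\<Omega>. response_term u \<omega> x)"

text \<open>The derivative of \<open>response_term\<close> in x. The factor 2 arises because the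
  product of u', g' and \<gamma>' comes from both summands.\<close>

definition response_term' :: "(real \<Rightarrow> real) \<Rightarrow> 'w \<Rightarrow> real \<Rightarrow> real" where
  "response_term' u \<omega> x = \<sigma> \<omega> *
    (dx \<Delta> (dx \<Delta> u) (g 0 \<omega> x) * (g1 0 \<omega> x)\<^sup>2 * \<gamma> \<omega> x + 2 * (dx \<Delta> u (g 0 \<omega> x) * g1 0 \<omega> x * dx \<Delta> (\<gamma> \<omega>) x)
      + dx \<Delta> u (g 0 \<omega> x) * \<gamma> \<omega> x * g2 0 \<omega> x + u (g 0 \<omega> x) * dx \<Delta> (dx \<Delta> (\<gamma> \<omega>)) x)"

text \<open>Together with \<open>bound1\<close>, a majorant per unit of \<epsilon> both for the
  increments of a branch term and for its \<epsilon>-derivative, here for values and there for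
  slopes in x. Sharing them gives the difference quotients and their limit the same Lipschitz
  constant.\<close>

definition bound0 :: "real \<Rightarrow> 'w \<Rightarrow> real" where
  "bound0 M \<omega> = M * K * s \<omega> + M * c1 \<omega>"

definition bound1 :: "real \<Rightarrow> 'w \<Rightarrow> real" where
  "bound1 M \<omega> = M * K * S * s \<omega> + 2 * (M * S * c1 \<omega>) + M * K * (D * s \<omega>) + M * c2 \<omega>"

lemma bound_summable: "bound0 M summable_on \<Omega>" "bound1 M summable_on \<Omega>"
  unfolding bound0_def[abs_def] bound1_def[abs_def]
  by (intro summable_on_add summable_on_cmult_right base.weight_summable c_summable)+

lemma comp_branch_variation:
  assumes der: "\<And>x. x \<in> \<Delta> \<Longrightarrow> (f has_real_derivative f' x) (at x within \<Delta>)"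
    and f': "\<And>x. x \<in> \<Delta> \<Longrightarrow> \<bar>f' x\<bar> \<le> M" "0 \<le> M" and x: "\<bar>e\<bar> < r" "\<omega> \<in> \<Omega>" "x \<in> \<Delta>"
  shows "\<bar>f (g e \<omega> x) - f (g 0 \<omega> x)\<bar> \<le> M * (K * \<bar>e\<bar>)"
proof -
  have "\<bar>f (g e \<omega> x) - f (g 0 \<omega> x)\<bar> \<le> M * \<bar>g e \<omega> x - g 0 \<omega> x\<bar>"
    using lipschitz_onD[OF lipschitz_from_derivative[OF der f'(1)] branch_in[OF x] base.branch_in[OF x(2,3)]]
    by (simp add: dist_real_def)
  also have "\<dots> \<le> M * (K * \<bar>e\<bar>)" by (rule mult_left_mono[OF vary0[OF x] f'(2)])
  finally show ?thesis .
qed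

context
  fixes u :: "real \<Rightarrow> real" and M :: real
  assumes u: "u \<in> C_b 2 \<Delta>" and M_nonneg: "0 \<le> M"
    and M: "\<And>x. x \<in> \<Delta> \<Longrightarrow> \<bar>u x\<bar> \<le> M" "\<And>x. x \<in> \<Delta> \<Longrightarrow> \<bar>dx \<Delta> u x\<bar> \<le> M"
      "\<And>x. x \<in> \<Delta> \<Longrightarrow> \<bar>dx \<Delta> (dx \<Delta> u) x\<bar> \<le> M"
begin

lemma response_term_le:
  assumes "\<omega> \<in> \<Omega>" "x \<in> \<Delta>"
  shows "\<bar>response_term u \<omega> x\<bar> \<le> bound0 M \<omega>"
proof -
  note [simp] = base.branch_in[OF assms]
  have "\<bar>dx \<Delta> u (g 0 \<omega> x) * \<gamma> \<omega> x * g1 0 \<omega> x\<bar> \<le> M * K * s \<omega>"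
    by (intro abs_mult_le M gamma_le base.weight_le assms) simp
  moreover have "\<bar>u (g 0 \<omega> x) * dx \<Delta> (\<gamma> \<omega>) x\<bar> \<le> M * c1 \<omega>"
    by (intro abs_mult_le M gamma_le assms) simp
  ultimately show ?thesis
    unfolding response_term_def abs_sign_mult[OF assms(1)] bound0_def by linarith
qed

lemma response_term'_le:
  assumes "\<omega> \<in> \<Omega>" "x \<in> \<Delta>"
  shows "\<bar>response_term' u \<omega> x\<bar> \<le> bound1 M \<omega>"
proof -
  note [simp] = base.branch_in[OF assms]
  have r0: "\<bar>0\<bar> < r" using r_pos by simp
  have "\<bar>dx \<Delta> (dx \<Delta> u) (g 0 \<omega> x) * (g1 0 \<omega> x * g1 0 \<omega> x) * \<gamma> \<omega> x\<bar> \<le> M * (S * s \<omega>) * K"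
    by (intro abs_mult_le M gamma_le base.weight_le g1_le_S r0 assms) simp
  moreover have "\<bar>dx \<Delta> u (g 0 \<omega> x) * g1 0 \<omega> x * dx \<Delta> (\<gamma> \<omega>) x\<bar> \<le> M * S * c1 \<omega>"
    by (intro abs_mult_le M gamma_le g1_le_S r0 assms) simp
  moreover have "\<bar>dx \<Delta> u (g 0 \<omega> x) * \<gamma> \<omega> x * g2 0 \<omega> x\<bar> \<le> M * K * (D * s \<omega>)"
    by (intro abs_mult_le M gamma_le g2_le r0 assms) simp
  moreover have "\<bar>u (g 0 \<omega> x) * dx \<Delta> (dx \<Delta> (\<gamma> \<omega>)) x\<bar> \<le> M * c2 \<omega>"
    by (intro abs_mult_le M gamma_le assms) simp
  moreover have "M * (S * s \<omega>) * K = M * K * S * s \<omega>" by simp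
  ultimately show ?thesis
    unfolding response_term'_def abs_sign_mult[OF assms(1)] bound1_def power2_eq_square by linarith
qed

lemma response_term_derivative:
  assumes "\<omega> \<in> \<Omega>" "x \<in> \<Delta>"
  shows "(response_term u \<omega> has_real_derivative response_term' u \<omega> x) (at x within \<Delta>)"
proof -
  have r0: "\<bar>0\<bar> < r" using r_pos by simp
  note d = DERIV_cmult[OF DERIV_add[OF
      DERIV_mult[OF DERIV_mult[OF g_chain[OF assms(2) r0 assms(1) C_b_2D(2)[OF u]] gamma1[OF assms]] der2[OF r0 assms]]
      DERIV_mult[OF g_chain[OF assms(2) r0 assms(1) C_b_2D(1)[OF u]] gamma2[OF assms]]]]
  show ?thesis
    unfolding response_term_def[abs_def] response_term'_def
    by (rule DERIV_cong[OF d]) (simp_all add: algebra_simps power2_eq_square)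
qed

lemma response_source_lipschitz: "(infsum (bound1 M) \<Omega>)-lipschitz_on \<Delta> (response_source u)"
  and response_source_C_b_1: "response_source u \<in> C_b 1 \<Delta>"
proof -
  have r0: "\<bar>0\<bar> < r" using r_pos by simp
  have der: "(response_source u has_real_derivative (\<Sum>\<^sub>\<infinity>\<omega>\<in>\<Omega>. response_term' u \<omega> x)) (at x within \<Delta>)"
    if "x \<in> \<Delta>" for x
    unfolding response_source_def[abs_def]
    by (rule has_real_derivative_infsum[OF base.countable_index bound_summable convex_dom
          response_term_le response_term'_le response_term_derivative that])
  have bnd: "\<bar>\<Sum>\<^sub>\<infinity>\<omega>\<in>\<Omega>. response_term' u \<omega> x\<bar> \<le> infsum (bound1 M) \<Omega>" if "x \<in> \<Delta>" for x
    by (rule abs_infsum_le[OF bound_summable(2) response_term'_le[OF _ that]])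
  show "(infsum (bound1 M) \<Omega>)-lipschitz_on \<Delta> (response_source u)"
    by (rule lipschitz_from_derivative[OF der bnd])
  have cont: "continuous_on \<Delta> (response_term' u \<omega>)" if "\<omega> \<in> \<Omega>" for \<omega>
    unfolding response_term'_def[abs_def]
    using r0 that C_b_2D(3)[OF u] DERIV_continuous_on[OF C_b_2D(1)[OF u]] DERIV_continuous_on[OF C_b_2D(2)[OF u]]
      DERIV_continuous_on[OF gamma1] DERIV_continuous_on[OF gamma2]
    by (intro continuous_on_mult continuous_on_add continuous_on_const continuous_on_power
        continuous_comp_g continuous_g1 cont2 gamma2_cont) auto
  have cont': "continuous_on \<Delta> (\<lambda>x. \<Sum>\<^sub>\<infinity>\<omega>\<in>\<Omega>. response_term' u \<omega> x)"
    by (rule continuous_on_infsum[OF bound_summable(2) response_term'_le cont])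
  show "response_source u \<in> C_b 1 \<Delta>"
    by (rule C_b_1I[OF der cont' bnd])
qed

text \<open>Products are changed one factor at a time. For the slope this compares u' at two nearby
  points, and the bound for u'' makes their difference of order \<epsilon>: here the C^2 regularity
  of the density enters.\<close>

lemma branch_term_variation:
  assumes e: "\<bar>e\<bar> < r" and w: "\<omega> \<in> \<Omega>"
  shows "x \<in> \<Delta> \<Longrightarrow> \<bar>\<sigma> \<omega> * (u (g e \<omega> x) * g1 e \<omega> x) - \<sigma> \<omega> * (u (g 0 \<omega> x) * g1 0 \<omega> x)\<bar> \<le> bound0 M \<omega> * \<bar>e\<bar>"
    and "(bound1 M \<omega> * \<bar>e\<bar>)-lipschitz_on \<Delta>
      (\<lambda>x. \<sigma> \<omega> * (u (g e \<omega> x) * g1 e \<omega> x) - \<sigma> \<omega> * (u (g 0 \<omega> x) * g1 0 \<omega> x))"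
proof -
  have r0: "\<bar>0\<bar> < r" using r_pos by simp
  have in_dom: "g e \<omega> x \<in> \<Delta>" "g 0 \<omega> x \<in> \<Delta>" if "x \<in> \<Delta>" for x
    using branch_in e r0 w that by auto
  have u_var: "\<bar>u (g e \<omega> x) - u (g 0 \<omega> x)\<bar> \<le> M * (K * \<bar>e\<bar>)" if "x \<in> \<Delta>" for x
    by (rule comp_branch_variation[OF C_b_2D(1)[OF u] M(2) M_nonneg e w that])
  have u'_var: "\<bar>dx \<Delta> u (g e \<omega> x) - dx \<Delta> u (g 0 \<omega> x)\<bar> \<le> M * (K * \<bar>e\<bar>)" if "x \<in> \<Delta>" for x
    by (rule comp_branch_variation[OF C_b_2D(2)[OF u] M(3) M_nonneg e w that])
  show "\<bar>\<sigma> \<omega> * (u (g e \<omega> x) * g1 e \<omega> x) - \<sigma> \<omega> * (u (g 0 \<omega> x) * g1 0 \<omega> x)\<bar> \<le> bound0 M \<omega> * \<bar>e\<bar>" if x: "x \<in> \<Delta>"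
  proof -
    have eq: "\<sigma> \<omega> * (u (g e \<omega> x) * g1 e \<omega> x) - \<sigma> \<omega> * (u (g 0 \<omega> x) * g1 0 \<omega> x)
      = \<sigma> \<omega> * ((u (g e \<omega> x) - u (g 0 \<omega> x)) * g1 e \<omega> x + u (g 0 \<omega> x) * (g1 e \<omega> x - g1 0 \<omega> x))"
      by (simp add: algebra_simps)
    have "\<bar>(u (g e \<omega> x) - u (g 0 \<omega> x)) * g1 e \<omega> x\<bar> \<le> M * (K * \<bar>e\<bar>) * s \<omega>"
      by (intro abs_mult_le u_var x g1_le e w)
    moreover have "\<bar>u (g 0 \<omega> x) * (g1 e \<omega> x - g1 0 \<omega> x)\<bar> \<le> M * (c1 \<omega> * \<bar>e\<bar>)"
      by (intro abs_mult_le M in_dom x vary1 e w)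
    moreover have "M * (K * \<bar>e\<bar>) * s \<omega> + M * (c1 \<omega> * \<bar>e\<bar>) = bound0 M \<omega> * \<bar>e\<bar>"
      by (simp add: bound0_def algebra_simps)
    ultimately show ?thesis unfolding eq abs_sign_mult[OF w] by linarith
  qed
  define d where "d x = \<sigma> \<omega> * (dx \<Delta> u (g e \<omega> x) * (g1 e \<omega> x)\<^sup>2 + u (g e \<omega> x) * g2 e \<omega> x)
      - \<sigma> \<omega> * (dx \<Delta> u (g 0 \<omega> x) * (g1 0 \<omega> x)\<^sup>2 + u (g 0 \<omega> x) * g2 0 \<omega> x)" for x
  show "(bound1 M \<omega> * \<bar>e\<bar>)-lipschitz_on \<Delta>
      (\<lambda>x. \<sigma> \<omega> * (u (g e \<omega> x) * g1 e \<omega> x) - \<sigma> \<omega> * (u (g 0 \<omega> x) * g1 0 \<omega> x))"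
  proof (rule lipschitz_from_derivative)
    fix x assume x: "x \<in> \<Delta>"
    show "((\<lambda>x. \<sigma> \<omega> * (u (g e \<omega> x) * g1 e \<omega> x) - \<sigma> \<omega> * (u (g 0 \<omega> x) * g1 0 \<omega> x)) has_real_derivative d x) (at x within \<Delta>)"
      unfolding d_def
      by (intro DERIV_diff branch_term_derivative[OF e w x] branch_term_derivative[OF r0 w x] C_b_2D(1)[OF u])
    \<comment> \<open>The difference of the squares of g' is split into two products, each with one
      factor bounded by \<open>S\<close> and one increment bounded through
      \<open>c1\<close>.\<close>
    have eq: "d x = \<sigma> \<omega> * ((dx \<Delta> u (g e \<omega> x) - dx \<Delta> u (g 0 \<omega> x)) * (g1 e \<omega> x * g1 e \<omega> x)
        + dx \<Delta> u (g 0 \<omega> x) * ((g1 e \<omega> x - g1 0 \<omega> x) * g1 e \<omega> x)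
        + dx \<Delta> u (g 0 \<omega> x) * ((g1 e \<omega> x - g1 0 \<omega> x) * g1 0 \<omega> x)
        + (u (g e \<omega> x) - u (g 0 \<omega> x)) * g2 e \<omega> x + u (g 0 \<omega> x) * (g2 e \<omega> x - g2 0 \<omega> x))"
      by (simp add: d_def algebra_simps power2_eq_square)
    have "\<bar>(dx \<Delta> u (g e \<omega> x) - dx \<Delta> u (g 0 \<omega> x)) * (g1 e \<omega> x * g1 e \<omega> x)\<bar> \<le> M * (K * \<bar>e\<bar>) * (S * s \<omega>)"
      by (intro abs_mult_le u'_var x g1_le g1_le_S e w)
    moreover have "\<bar>dx \<Delta> u (g 0 \<omega> x) * ((g1 e \<omega> x - g1 0 \<omega> x) * g1 e \<omega> x)\<bar> \<le> M * (c1 \<omega> * \<bar>e\<bar> * S)"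
      "\<bar>dx \<Delta> u (g 0 \<omega> x) * ((g1 e \<omega> x - g1 0 \<omega> x) * g1 0 \<omega> x)\<bar> \<le> M * (c1 \<omega> * \<bar>e\<bar> * S)"
      by (intro abs_mult_le M in_dom x vary1 g1_le_S e r0 w)+
    moreover have "\<bar>(u (g e \<omega> x) - u (g 0 \<omega> x)) * g2 e \<omega> x\<bar> \<le> M * (K * \<bar>e\<bar>) * (D * s \<omega>)"
      by (intro abs_mult_le u_var x g2_le e w)
    moreover have "\<bar>u (g 0 \<omega> x) * (g2 e \<omega> x - g2 0 \<omega> x)\<bar> \<le> M * (c2 \<omega> * \<bar>e\<bar>)"
      by (intro abs_mult_le M in_dom x vary2 e w)
    moreover have "M * (K * \<bar>e\<bar>) * (S * s \<omega>) + M * (c1 \<omega> * \<bar>e\<bar> * S) + M * (c1 \<omega> * \<bar>e\<bar> * S)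
        + M * (K * \<bar>e\<bar>) * (D * s \<omega>) + M * (c2 \<omega> * \<bar>e\<bar>) = bound1 M \<omega> * \<bar>e\<bar>"
      by (simp add: bound1_def algebra_simps)
    ultimately show "\<bar>d x\<bar> \<le> bound1 M \<omega> * \<bar>e\<bar>"
      unfolding eq abs_sign_mult[OF w] by linarith
  qed
qed

lemma PF_variation_lipschitz:
  assumes e: "\<bar>e\<bar> < r"
  shows "(infsum (bound1 M) \<Omega> * \<bar>e\<bar>)-lipschitz_on \<Delta> (\<lambda>x. PF \<Delta> \<Omega> (g e) u x - base.L u x)"
proof -
  have r0: "\<bar>0\<bar> < r" using r_pos by simp
  define H where "H e \<omega> x = \<sigma> \<omega> * (u (g e \<omega> x) * g1 e \<omega> x)" for e \<omega> x
  have sm: "(\<lambda>\<omega>. H e \<omega> x) summable_on \<Omega>" if "\<bar>e\<bar> < r" "x \<in> \<Delta>" for e x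
    unfolding H_def
  proof (rule summable_on_dominated[OF summable_on_cmult_right[OF base.weight_summable, of M]])
    show "\<bar>\<sigma> \<omega> * (u (g e \<omega> x) * g1 e \<omega> x)\<bar> \<le> M * s \<omega>" if "\<omega> \<in> \<Omega>" for \<omega>
      unfolding abs_sign_mult[OF that]
      by (intro abs_mult_le M branch_in g1_le \<open>\<bar>e\<bar> < r\<close> \<open>x \<in> \<Delta>\<close> that)
  qed
  have eq: "PF \<Delta> \<Omega> (g e) u x - base.L u x = (\<Sum>\<^sub>\<infinity>\<omega>\<in>\<Omega>. H e \<omega> x - H 0 \<omega> x)" if "x \<in> \<Delta>" for x
    using infsum_diff_real[OF sm[OF e that] sm[OF r0 that]] PF_signed[OF e that] PF_signed[OF r0 that]
    by (simp add: H_def)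
  show ?thesis
  proof (rule lipschitz_onI)
    fix x y assume xy: "x \<in> \<Delta>" "y \<in> \<Delta>"
    have d: "(\<lambda>\<omega>. H e \<omega> x - H 0 \<omega> x) summable_on \<Omega>" "(\<lambda>\<omega>. H e \<omega> y - H 0 \<omega> y) summable_on \<Omega>"
      by (rule summable_on_diff_real[OF sm[OF e xy(1)] sm[OF r0 xy(1)]])
        (rule summable_on_diff_real[OF sm[OF e xy(2)] sm[OF r0 xy(2)]])
    have "\<bar>\<Sum>\<^sub>\<infinity>\<omega>\<in>\<Omega>. (H e \<omega> x - H 0 \<omega> x) - (H e \<omega> y - H 0 \<omega> y)\<bar> \<le> (\<Sum>\<^sub>\<infinity>\<omega>\<in>\<Omega>. bound1 M \<omega> * (\<bar>e\<bar> * \<bar>x - y\<bar>))"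
    proof (rule abs_infsum_le[OF summable_on_cmult_left[OF bound_summable(2)]])
      show "\<bar>(H e \<omega> x - H 0 \<omega> x) - (H e \<omega> y - H 0 \<omega> y)\<bar> \<le> bound1 M \<omega> * (\<bar>e\<bar> * \<bar>x - y\<bar>)" if "\<omega> \<in> \<Omega>" for \<omega>
        using lipschitz_onD[OF branch_term_variation(2)[OF e that] xy] by (simp add: H_def dist_real_def mult.assoc)
    qed
    then show "dist (PF \<Delta> \<Omega> (g e) u x - base.L u x) (PF \<Delta> \<Omega> (g e) u y - base.L u y)
        \<le> infsum (bound1 M) \<Omega> * \<bar>e\<bar> * dist x y"
      unfolding eq[OF xy(1)] eq[OF xy(2)] infsum_diff_real[OF d] infsum_cmult_left'
      by (simp add: dist_real_def mult.assoc)
  next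
    show "0 \<le> infsum (bound1 M) \<Omega> * \<bar>e\<bar>"
      using lipschitz_on_nonneg[OF response_source_lipschitz] by simp
  qed
qed

text \<open>\<open>bound0\<close> dominates the difference quotients of all branches simultaneously,
  so the limit may be taken termwise.\<close>

lemma PF_variation_tendsto:
  assumes x: "x \<in> \<Delta>"
  shows "((\<lambda>e. (PF \<Delta> \<Omega> (g e) u x - base.L u x) / e) \<longlongrightarrow> response_source u x) (at 0)"
proof -
  have r0: "\<bar>0\<bar> < r" using r_pos by simp
  define H where "H e \<omega> = \<sigma> \<omega> * (u (g e \<omega> x) * g1 e \<omega> x)" for e \<omega>
  have near: "\<forall>\<^sub>F e in at 0. \<bar>e\<bar> < r \<and> e \<noteq> 0"
    using r_pos by (auto simp: eventually_at dist_real_def)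
  have sm: "(\<lambda>\<omega>. H e \<omega>) summable_on \<Omega>" if "\<bar>e\<bar> < r" for e
    unfolding H_def
  proof (rule summable_on_dominated[OF summable_on_cmult_right[OF base.weight_summable, of M]])
    show "\<bar>\<sigma> \<omega> * (u (g e \<omega> x) * g1 e \<omega> x)\<bar> \<le> M * s \<omega>" if "\<omega> \<in> \<Omega>" for \<omega>
      unfolding abs_sign_mult[OF that]
      by (intro abs_mult_le M branch_in g1_le \<open>\<bar>e\<bar> < r\<close> x that)
  qed
  have lim: "((\<lambda>e. (H e \<omega> - H 0 \<omega>) / e) \<longlongrightarrow> response_term u \<omega> x) (at 0)" if w: "\<omega> \<in> \<Omega>" for \<omega>
  proof -
    let ?I = "{-r<..<r}"
    have I: "(0::real) \<in> ?I" "open ?I" using r_pos by auto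
    have at: "at (0::real) within ?I = at 0" by (rule at_within_open[OF I])
    \<comment> \<open>\<open>u\<close> is differentiable only within \<Delta>; the chain rule still
      applies since the path of branch values stays in \<Delta> for small \<epsilon>.\<close>
    have "(u has_real_derivative dx \<Delta> u (g 0 \<omega> x)) (at (g 0 \<omega> x) within (\<lambda>e. g e \<omega> x) ` ?I)"
      by (rule has_field_derivative_subset[OF C_b_2D(1)[OF u base.branch_in[OF w x]]])
        (use branch_in w x in auto)
    from DERIV_image_chain[OF this, of "\<gamma> \<omega> x"] eps0[OF w x]
    have "((\<lambda>e. u (g e \<omega> x)) has_real_derivative dx \<Delta> u (g 0 \<omega> x) * \<gamma> \<omega> x) (at 0)"
      by (simp add: at o_def)
    from DERIV_cmult[OF DERIV_mult[OF this eps1[OF w x]], of "\<sigma> \<omega>"]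
    have "((\<lambda>e. H e \<omega>) has_real_derivative response_term u \<omega> x) (at 0)"
      by (simp add: H_def response_term_def algebra_simps)
    then show ?thesis by (simp add: has_field_derivative_iff)
  qed
  have bnd: "\<forall>\<^sub>F e in at 0. \<forall>\<omega>\<in>\<Omega>. \<bar>(H e \<omega> - H 0 \<omega>) / e\<bar> \<le> bound0 M \<omega>"
    using near
  proof eventually_elim
    case (elim e)
    then show ?case
      using branch_term_variation(1)[of e _ x] x by (simp add: H_def abs_divide divide_le_eq)
  qed
  have "((\<lambda>e. \<Sum>\<^sub>\<infinity>\<omega>\<in>\<Omega>. (H e \<omega> - H 0 \<omega>) / e) \<longlongrightarrow> response_source u x) (at 0)"
    unfolding response_source_def
    by (rule tendsto_infsum[OF base.countable_index bound_summable(1) lim bnd])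
  moreover have "\<forall>\<^sub>F e in at 0. (\<Sum>\<^sub>\<infinity>\<omega>\<in>\<Omega>. (H e \<omega> - H 0 \<omega>) / e) = (PF \<Delta> \<Omega> (g e) u x - base.L u x) / e"
    using near
  proof eventually_elim
    case (elim e)
    then show ?case
      using infsum_diff_real[OF sm sm[OF r0], of e] PF_signed[OF _ x, of e] PF_signed[OF r0 x]
      by (simp add: divide_inverse infsum_cmult_left' H_def)
  qed
  ultimately show ?thesis by (simp add: tendsto_cong)
qed

end

text \<open>Operator and argument vary together. As \<open>F e\<close> is evaluated at the moving
  point \<open>g e \<omega> x\<close>, pointwise convergence is not enough; the common Lipschitz
  constant brings the point back to \<open>g 0 \<omega> x\<close>.\<close>

lemma PF_tendsto:
  assumes lip: "\<forall>\<^sub>F e in at 0. C-lipschitz_on \<Delta> (F e)"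
    and bnd: "\<forall>\<^sub>F e in at 0. \<forall>x\<in>\<Delta>. \<bar>F e x\<bar> \<le> B"
    and lim: "\<And>x. x \<in> \<Delta> \<Longrightarrow> ((\<lambda>e. F e x) \<longlongrightarrow> f x) (at 0)" and x: "x \<in> \<Delta>"
  shows "((\<lambda>e. PF \<Delta> \<Omega> (g e) (F e) x) \<longlongrightarrow> base.L f x) (at 0)"
  unfolding PF_def
proof (rule tendsto_infsum[OF base.countable_index summable_on_cmult_right[OF base.weight_summable, of B]])
  have near: "\<forall>\<^sub>F e in at 0. \<bar>e\<bar> < r"
    using r_pos by (auto simp: eventually_at dist_real_def)
  show "\<forall>\<^sub>F e in at 0. \<forall>\<omega>\<in>\<Omega>. \<bar>F e (g e \<omega> x) * \<bar>g1 e \<omega> x\<bar>\<bar> \<le> B * s \<omega>"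
    using near bnd by eventually_elim (use branch_in g1_le x in \<open>auto intro!: abs_mult_le\<close>)
  fix \<omega> assume w: "\<omega> \<in> \<Omega>"
  have "((\<lambda>e. F e (g e \<omega> x) - F e (g 0 \<omega> x)) \<longlongrightarrow> 0) (at 0)"
  proof (rule Lim_null_comparison)
    show "\<forall>\<^sub>F e in at 0. norm (F e (g e \<omega> x) - F e (g 0 \<omega> x)) \<le> C * (K * \<bar>e\<bar>)"
      using near lip
    proof eventually_elim
      case (elim e)
      have "dist (F e (g e \<omega> x)) (F e (g 0 \<omega> x)) \<le> C * dist (g e \<omega> x) (g 0 \<omega> x)"
        by (rule lipschitz_onD[OF elim(2) branch_in[OF elim(1) w x] base.branch_in[OF w x]])
      also have "\<dots> \<le> C * (K * \<bar>e\<bar>)"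
        using vary0[OF elim(1) w x] lipschitz_on_nonneg[OF elim(2)]
        by (intro mult_left_mono) (auto simp: dist_real_def)
      finally show ?case by (simp add: dist_real_def)
    qed
    have "((\<lambda>e::real. C * (K * \<bar>e\<bar>)) \<longlongrightarrow> C * (K * \<bar>0\<bar>)) (at 0)"
      by (intro tendsto_intros)
    then show "((\<lambda>e::real. C * (K * \<bar>e\<bar>)) \<longlongrightarrow> 0) (at 0)" by simp
  qed
  from tendsto_add[OF this lim[OF base.branch_in[OF w x]]]
  have "((\<lambda>e. F e (g e \<omega> x)) \<longlongrightarrow> f (g 0 \<omega> x)) (at 0)" by simp
  moreover have "((\<lambda>e. g1 e \<omega> x) \<longlongrightarrow> g1 0 \<omega> x) (at 0)"
    using DERIV_isCont[OF eps1[OF w x]] by (simp add: isCont_def)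
  ultimately show "((\<lambda>e. F e (g e \<omega> x) * \<bar>g1 e \<omega> x\<bar>) \<longlongrightarrow> f (g 0 \<omega> x) * \<bar>g1 0 \<omega> x\<bar>) (at 0)"
    by (intro tendsto_intros)
qed

text \<open>The densities are given by Neumann series around \<open>u\<close>: the operators in the
  summands are perturbed, but they all start from the smooth function \<open>u\<close>.\<close>

theorem linear_response:
  assumes u: "u \<in> C_b 2 \<Delta>" and fixed: "\<And>x. x \<in> \<Delta> \<Longrightarrow> base.L u x = u x"
    and h: "\<And>e x. \<bar>e\<bar> < r \<Longrightarrow> x \<in> \<Delta> \<Longrightarrow>
      h e x = u x + (\<Sum>n. (PF \<Delta> \<Omega> (g e) ^^ n) (\<lambda>x. PF \<Delta> \<Omega> (g e) u x - u x) x)"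
  defines "\<Phi> \<equiv> response_source u"
  shows "\<Phi> \<in> C_b 1 \<Delta>" "(LINT x|lebesgue_on \<Delta>. \<Phi> x) = 0"
    and "uniform_limit \<Delta> (\<lambda>e x. (h e x - u x) / e) (\<lambda>x. \<Sum>n. (base.L ^^ n) \<Phi> x) (at 0)"
proof -
  let ?L = "\<lambda>e. PF \<Delta> \<Omega> (g e)"
  obtain M where M: "0 \<le> M" "\<And>x. x \<in> \<Delta> \<Longrightarrow> \<bar>u x\<bar> \<le> M" "\<And>x. x \<in> \<Delta> \<Longrightarrow> \<bar>dx \<Delta> u x\<bar> \<le> M"
      "\<And>x. x \<in> \<Delta> \<Longrightarrow> \<bar>dx \<Delta> (dx \<Delta> u) x\<bar> \<le> M"
    using C_b_2D(4)[OF u] by blast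
  define b where "b = infsum (bound1 M) \<Omega>"
  have near: "\<forall>\<^sub>F e in at 0. \<bar>e\<bar> < r \<and> e \<noteq> 0"
    using r_pos by (auto simp: eventually_at dist_real_def)
  show C1: "\<Phi> \<in> C_b 1 \<Delta>" unfolding \<Phi>_def by (rule response_source_C_b_1[OF u M])
  have lip\<Phi>: "b-lipschitz_on \<Delta> \<Phi>" unfolding \<Phi>_def b_def by (rule response_source_lipschitz[OF u M])
  have ulip: "M-lipschitz_on \<Delta> u" by (rule lipschitz_from_derivative[OF C_b_2D(1)[OF u] M(3)])
  define \<psi> where "\<psi> e x = (?L e u x - u x) / e" for e x
  have \<psi>_lip: "b-lipschitz_on \<Delta> (\<psi> e)" if "\<bar>e\<bar> < r" "e \<noteq> 0" for e
  proof -
    have "(\<bar>1 / e\<bar> * (b * \<bar>e\<bar>))-lipschitz_on \<Delta> (\<lambda>x. 1 / e * (?L e u x - base.L u x))"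
      using lipschitz_on_cmult_real[OF PF_variation_lipschitz[OF u M that(1)], of "1 / e"] by (simp add: b_def)
    then have "b-lipschitz_on \<Delta> (\<lambda>x. 1 / e * (?L e u x - base.L u x))" using that by simp
    then show ?thesis by (rule lipschitz_on_transform) (simp add: \<psi>_def fixed)
  qed
  have \<psi>_mean: "(LINT x|lebesgue_on \<Delta>. \<psi> e x) = 0" if "\<bar>e\<bar> < r" for e
  proof -
    interpret e: contracting_branches \<Delta> \<Omega> "g e" s l D by (rule contracting[OF that])
    obtain K' where "K'-lipschitz_on \<Delta> (e.L u)" using e.PF_lipschitz_ex[OF ulip] by blast
    then have "(LINT x|lebesgue_on \<Delta>. e.L u x - u x) = 0"
      using lipschitz_integrable lipschitz_integrable[OF ulip] e.integral_PF[OF ulip] by simp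
    then show ?thesis by (simp add: \<psi>_def)
  qed
  have \<psi>_lim: "((\<lambda>e. \<psi> e x) \<longlongrightarrow> \<Phi> x) (at 0)" if "x \<in> \<Delta>" for x
    using PF_variation_tendsto[OF u M that] by (simp add: \<psi>_def \<Phi>_def fixed[OF that])
  \<comment> \<open>The decay constants are the same for all small \<open>e\<close> because
    \<open>contracting_branches\<close> holds with common \<open>s\<close>, \<open>l\<close> and
    \<open>D\<close>.\<close>
  have dec: "(base.dconst * base.rate ^ n * b)-lipschitz_on \<Delta> ((?L e ^^ n) (\<psi> e))"
      "x \<in> \<Delta> \<Longrightarrow> \<bar>(?L e ^^ n) (\<psi> e) x\<bar> \<le> base.dconst * base.rate ^ n * b"
    if "\<bar>e\<bar> < r" "e \<noteq> 0" for e n x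
    using contracting_branches.PF_decay[OF contracting[OF that(1)] \<psi>_lip[OF that] \<psi>_mean[OF that(1)]] by auto
  have iter_lim: "((\<lambda>e. (?L e ^^ n) (\<psi> e) x) \<longlongrightarrow> (base.L ^^ n) \<Phi> x) (at 0)" if "x \<in> \<Delta>" for n x
    using that
  proof (induction n arbitrary: x)
    case 0
    then show ?case using \<psi>_lim by simp
  next
    case (Suc n)
    have "((\<lambda>e. ?L e ((?L e ^^ n) (\<psi> e)) x) \<longlongrightarrow> base.L ((base.L ^^ n) \<Phi>) x) (at 0)"
    proof (rule PF_tendsto[OF _ _ Suc.IH Suc.prems])
      show "\<forall>\<^sub>F e in at 0. (base.dconst * base.rate ^ n * b)-lipschitz_on \<Delta> ((?L e ^^ n) (\<psi> e))"
        using near by eventually_elim (use dec in auto)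
      show "\<forall>\<^sub>F e in at 0. \<forall>x\<in>\<Delta>. \<bar>(?L e ^^ n) (\<psi> e) x\<bar> \<le> base.dconst * base.rate ^ n * b"
        using near by eventually_elim (use dec in auto)
    qed
    then show ?case by simp
  qed
  show mean: "(LINT x|lebesgue_on \<Delta>. \<Phi> x) = 0"
  proof -
    \<comment> \<open>Uniform convergence carries the vanishing mean of the quotients over to the
      limit.\<close>
    have u_lim: "uniform_limit \<Delta> \<psi> \<Phi> (at 0)"
      by (rule uniform_limit_lipschitz[OF _ lip\<Phi> \<psi>_lim]) (use near \<psi>_lip in \<open>auto elim: eventually_mono\<close>)
    have "\<bar>LINT x|lebesgue_on \<Delta>. \<Phi> x\<bar> \<le> d" if d: "d > 0" for d
    proof -
      have "\<forall>\<^sub>F e in at 0. (\<forall>x\<in>\<Delta>. dist (\<psi> e x) (\<Phi> x) < d / len) \<and> \<bar>e\<bar> < r \<and> e \<noteq> 0"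
        using uniform_limitD[OF u_lim, of "d / len"] near d len_pos by (simp add: eventually_conj_iff)
      then obtain e where e: "\<And>x. x \<in> \<Delta> \<Longrightarrow> dist (\<psi> e x) (\<Phi> x) < d / len" "\<bar>e\<bar> < r" "e \<noteq> 0"
        using eventually_happens[of _ "at (0::real)"] by fastforce
      have int: "integrable (lebesgue_on \<Delta>) (\<psi> e)" "integrable (lebesgue_on \<Delta>) \<Phi>"
        using lipschitz_integrable \<psi>_lip[OF e(2,3)] lip\<Phi> by blast+
      have "\<bar>LINT x|lebesgue_on \<Delta>. \<Phi> x\<bar> = \<bar>LINT x|lebesgue_on \<Delta>. \<psi> e x - \<Phi> x\<bar>"
        using int \<psi>_mean[OF e(2)] by simp
      also have "\<dots> \<le> (LINT x|lebesgue_on \<Delta>. \<bar>\<psi> e x - \<Phi> x\<bar>)" by (rule integral_abs_bound)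
      also have "\<dots> \<le> d / len * len"
      proof (rule abs_integral_le)
        show "(\<lambda>x. \<psi> e x - \<Phi> x) \<in> borel_measurable (lebesgue_on \<Delta>)" using int by simp
        show "\<bar>\<psi> e x - \<Phi> x\<bar> \<le> d / len" if "x \<in> \<Delta>" for x using e(1)[OF that] by (simp add: dist_real_def)
      qed
      finally show ?thesis using len_pos by simp
    qed
    then have "\<bar>LINT x|lebesgue_on \<Delta>. \<Phi> x\<bar> \<le> 0" by (rule field_le_epsilon[where y = 0, simplified])
    then show ?thesis by simp
  qed
  let ?q = "base.dconst * b / (1 - base.rate)"
  have quot: "(h e x - u x) / e = (\<Sum>n. (?L e ^^ n) (\<psi> e) x)" if "\<bar>e\<bar> < r" "e \<noteq> 0" "x \<in> \<Delta>" for e x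
  proof -
    interpret e: contracting_branches \<Delta> \<Omega> "g e" s l D by (rule contracting[OF that(1)])
    have "(\<lambda>x. e.L u x - u x) = (\<lambda>x. e * \<psi> e x)" using that(2) by (simp add: \<psi>_def)
    then have "h e x - u x = (\<Sum>n. e * (e.L ^^ n) (\<psi> e) x)"
      using h[OF that(1,3)] e.PF_funpow_scale[of _ e "\<psi> e"] by simp
    also have "\<dots> = e * (\<Sum>n. (e.L ^^ n) (\<psi> e) x)"
      by (rule suminf_mult[OF e.PF_neumann_summable[OF \<psi>_lip[OF that(1,2)] \<psi>_mean[OF that(1)] that(3)]])
    finally show ?thesis using that(2) by simp
  qed
  show "uniform_limit \<Delta> (\<lambda>e x. (h e x - u x) / e) (\<lambda>x. \<Sum>n. (base.L ^^ n) \<Phi> x) (at 0)"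
  proof (rule uniform_limit_lipschitz)
    show "?q-lipschitz_on \<Delta> (\<lambda>x. \<Sum>n. (base.L ^^ n) \<Phi> x)"
      by (rule base.PF_neumann_lipschitz[OF lip\<Phi> mean])
    show "\<forall>\<^sub>F e in at 0. ?q-lipschitz_on \<Delta> (\<lambda>x. (h e x - u x) / e)"
      using near
    proof eventually_elim
      case (elim e)
      have "?q-lipschitz_on \<Delta> (\<lambda>x. \<Sum>n. (?L e ^^ n) (\<psi> e) x)"
        using contracting_branches.PF_neumann_lipschitz[OF contracting \<psi>_lip \<psi>_mean] elim by blast
      then show ?case by (rule lipschitz_on_transform) (use quot elim in auto)
    qed
    fix x assume x: "x \<in> \<Delta>"
    \<comment> \<open>The geometric majorants exchange the limit with the series; a pointwise limit
      suffices, since the Lipschitz bounds already make it uniform.\<close>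
    have "((\<lambda>e. \<Sum>n. (?L e ^^ n) (\<psi> e) x) \<longlongrightarrow> (\<Sum>n. (base.L ^^ n) \<Phi> x)) (at 0)"
    proof (rule tannerys_theorem[THEN conjunct2, THEN conjunct2])
      show "((\<lambda>e. (?L e ^^ n) (\<psi> e) x) \<longlongrightarrow> (base.L ^^ n) \<Phi> x) (at 0)" for n by (rule iter_lim[OF x])
      show "summable (\<lambda>n. base.dconst * base.rate ^ n * b)"
        using base.rate_nonneg base.rate_less by (intro summable_mult2 summable_mult summable_geometric) simp
      have "\<forall>\<^sub>F e in at 0. \<forall>n. norm ((?L e ^^ n) (\<psi> e) x) \<le> base.dconst * base.rate ^ n * b"
        using near by eventually_elim (use dec(2)[OF _ _ x] in auto)
      then show "\<forall>\<^sub>F (n, e) in at_top \<times>\<^sub>F at 0. norm ((?L e ^^ n) (\<psi> e) x) \<le> base.dconst * base.rate ^ n * b"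
        unfolding eventually_prod_filter
        by (intro exI[of _ "\<lambda>_. True"] exI[of _ "\<lambda>e. \<forall>n. norm ((?L e ^^ n) (\<psi> e) x) \<le> base.dconst * base.rate ^ n * b"])
           auto
    qed simp
    moreover have "\<forall>\<^sub>F e in at 0. (\<Sum>n. (?L e ^^ n) (\<psi> e) x) = (h e x - u x) / e"
      using near by eventually_elim (use quot x in auto)
    ultimately show "((\<lambda>e. (h e x - u x) / e) \<longlongrightarrow> (\<Sum>n. (base.L ^^ n) \<Phi> x)) (at 0)"
      by (simp add: tendsto_cong)
  qed
qed

end

subsection \<open>Full-branch families are uniform\<close>

lemma sgn_constant:
  fixes f :: "real \<Rightarrow> real"
  assumes "connected S" "continuous_on S f" "\<And>x. x \<in> S \<Longrightarrow> f x \<noteq> 0" "x \<in> S" "y \<in> S"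
  shows "sgn (f x) = sgn (f y)"
proof (rule ccontr)
  assume ne: "sgn (f x) \<noteq> sgn (f y)"
  have iv: "is_interval (f ` S)"
    using connected_continuous_image[OF assms(2,1)] by (simp add: is_interval_connected_1)
  have "f x \<noteq> 0" "f y \<noteq> 0" using assms by auto
  then consider "f x < 0" "0 < f y" | "f y < 0" "0 < f x"
    using ne by (auto simp: sgn_if split: if_splits)
  then have "0 \<in> f ` S"
  proof cases
    case 1
    then show ?thesis using mem_is_interval_1_I[OF iv, of "f x" "f y" 0] assms(4,5) by auto
  next
    case 2
    then show ?thesis using mem_is_interval_1_I[OF iv, of "f y" "f x" 0] assms(4,5) by auto
  qed
  then show False using assms(3) by force
qed

lemma infsum_SUP_boundE:
  fixes F :: "real \<Rightarrow> 'w \<Rightarrow> real \<Rightarrow> real"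
  assumes "(\<Sum>\<^sub>\<infinity>\<omega>\<in>\<Omega>. SUP \<epsilon>\<in>V. SUP x\<in>\<Delta>. ennreal \<bar>F \<epsilon> \<omega> x\<bar>) < \<infinity>"
  obtains b where "b summable_on \<Omega>"
    "\<And>\<epsilon> \<omega> x. \<epsilon> \<in> V \<Longrightarrow> \<omega> \<in> \<Omega> \<Longrightarrow> x \<in> \<Delta> \<Longrightarrow> \<bar>F \<epsilon> \<omega> x\<bar> \<le> b \<omega>"
proof -
  define G where "G \<omega> = (SUP \<epsilon>\<in>V. SUP x\<in>\<Delta>. ennreal \<bar>F \<epsilon> \<omega> x\<bar>)" for \<omega>
  have fin: "infsum G \<Omega> < \<infinity>" using assms by (simp add: G_def[abs_def])
  have "\<bar>F \<epsilon> \<omega> x\<bar> \<le> enn2real (G \<omega>)" if "\<epsilon> \<in> V" "\<omega> \<in> \<Omega>" "x \<in> \<Delta>" for \<epsilon> \<omega> x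
  proof -
    have "ennreal \<bar>F \<epsilon> \<omega> x\<bar> \<le> (SUP x\<in>\<Delta>. ennreal \<bar>F \<epsilon> \<omega> x\<bar>)" by (rule SUP_upper[OF that(3)])
    also have "\<dots> \<le> G \<omega>" unfolding G_def by (rule SUP_upper[OF that(1)])
    finally have "ennreal \<bar>F \<epsilon> \<omega> x\<bar> \<le> ennreal (enn2real (G \<omega>))"
      using ennreal_infsum_finiteD(2)[OF fin that(2)] by simp
    then show ?thesis by (simp add: ennreal_le_iff)
  qed
  with ennreal_infsum_finiteD(1)[OF fin] show ?thesis by (rule that)
qed

text \<open>The data of the theorem with sums and suprema in \<open>ennreal\<close> replaced by real
  majorants. The radius \<open>r\<close> singles out an interval of parameters inside
  \<open>V\<close>, which need not be connected, for mean value and sign arguments.\<close>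

locale branch_family = bounded_interval +
  fixes V :: "real set" and \<Omega> :: "'w set" and T :: "real \<Rightarrow> real \<Rightarrow> real"
    and P :: "real \<Rightarrow> 'w \<Rightarrow> real set" and g :: "real \<Rightarrow> 'w \<Rightarrow> real \<Rightarrow> real"
    and r D :: real and s c1 c2 :: "'w \<Rightarrow> real"
  assumes countable_branches: "countable \<Omega>"
    and full_branch: "\<epsilon> \<in> V \<Longrightarrow> full_branch_map \<Delta> \<Omega> (T \<epsilon>) (P \<epsilon>) (g \<epsilon>)"
    and commute: "eps_derivs_commute \<Delta> V \<Omega> g"
    and s: "s summable_on \<Omega>"
      "\<epsilon> \<in> V \<Longrightarrow> \<omega> \<in> \<Omega> \<Longrightarrow> x \<in> \<Delta> \<Longrightarrow> \<bar>dx \<Delta> (g \<epsilon> \<omega>) x\<bar> \<le> s \<omega>"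
    and D: "0 \<le> D" "\<epsilon> \<in> V \<Longrightarrow> \<omega> \<in> \<Omega> \<Longrightarrow> x \<in> \<Delta> \<Longrightarrow>
      \<bar>dx \<Delta> (dx \<Delta> (g \<epsilon> \<omega>)) x / dx \<Delta> (g \<epsilon> \<omega>) x\<bar> \<le> D"
    and c1: "c1 summable_on \<Omega>" "\<epsilon> \<in> V \<Longrightarrow> \<omega> \<in> \<Omega> \<Longrightarrow> x \<in> \<Delta> \<Longrightarrow>
      \<bar>deriv (\<lambda>e. dx \<Delta> (g e \<omega>) x) \<epsilon>\<bar> \<le> c1 \<omega>"
    and c2: "c2 summable_on \<Omega>" "\<epsilon> \<in> V \<Longrightarrow> \<omega> \<in> \<Omega> \<Longrightarrow> x \<in> \<Delta> \<Longrightarrow>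
      \<bar>deriv (\<lambda>e. dx \<Delta> (dx \<Delta> (g e \<omega>)) x) \<epsilon>\<bar> \<le> c2 \<omega>"
    and r: "0 < r" "\<And>e. \<bar>e\<bar> < r \<Longrightarrow> e \<in> V"
begin

abbreviation "g1 e \<omega> \<equiv> dx \<Delta> (g e \<omega>)"
abbreviation "g2 e \<omega> \<equiv> dx \<Delta> (dx \<Delta> (g e \<omega>))"

lemma zero_in_V: "0 \<in> V" using r by simp

lemma g_in: "\<epsilon> \<in> V \<Longrightarrow> \<omega> \<in> \<Omega> \<Longrightarrow> x \<in> \<Delta> \<Longrightarrow> g \<epsilon> \<omega> x \<in> \<Delta>"
  using full_branch[of \<epsilon>] unfolding full_branch_map_def by blast

lemma g_interior: "\<epsilon> \<in> V \<Longrightarrow> \<omega> \<in> \<Omega> \<Longrightarrow> x \<in> interior \<Delta> \<Longrightarrow> g \<epsilon> \<omega> x \<in> P \<epsilon> \<omega>"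
  and T_g: "\<epsilon> \<in> V \<Longrightarrow> \<omega> \<in> \<Omega> \<Longrightarrow> x \<in> interior \<Delta> \<Longrightarrow> T \<epsilon> (g \<epsilon> \<omega> x) = x"
  using full_branch[of \<epsilon>] unfolding full_branch_map_def by blast+

lemma g_C3: "\<epsilon> \<in> V \<Longrightarrow> \<omega> \<in> \<Omega> \<Longrightarrow> g \<epsilon> \<omega> \<in> C_k 3 \<Delta>"
  using full_branch[of \<epsilon>] unfolding full_branch_map_def by blast

lemma g_der:
  assumes "\<epsilon> \<in> V" "\<omega> \<in> \<Omega>" "x \<in> \<Delta>"
  shows "(g \<epsilon> \<omega> has_real_derivative g1 \<epsilon> \<omega> x) (at x within \<Delta>)"
    and "(g1 \<epsilon> \<omega> has_real_derivative g2 \<epsilon> \<omega> x) (at x within \<Delta>)"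
  using C_k_has_derivative[OF g_C3[OF assms(1,2)], of 0 x] C_k_has_derivative[OF g_C3[OF assms(1,2)], of 1 x] assms(3)
  by simp_all

lemma g2_cont: "\<epsilon> \<in> V \<Longrightarrow> \<omega> \<in> \<Omega> \<Longrightarrow> continuous_on \<Delta> (g2 \<epsilon> \<omega>)"
  using C_k_continuous[OF g_C3, of \<epsilon> \<omega> 2] by (simp add: numeral_2_eq_2)

lemma g_cont: "\<epsilon> \<in> V \<Longrightarrow> \<omega> \<in> \<Omega> \<Longrightarrow> continuous_on \<Delta> (g \<epsilon> \<omega>)"
  and g1_cont: "\<epsilon> \<in> V \<Longrightarrow> \<omega> \<in> \<Omega> \<Longrightarrow> continuous_on \<Delta> (g1 \<epsilon> \<omega>)"
  by (rule DERIV_continuous_on, erule (2) g_der)+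

definition \<gamma> :: "'w \<Rightarrow> real \<Rightarrow> real" where
  "\<gamma> \<omega> x = deriv (\<lambda>e. g e \<omega> x) 0"

lemma eps_der_funpow:
  assumes "\<epsilon> \<in> V" "\<omega> \<in> \<Omega>" "x \<in> \<Delta>" "j \<le> 2"
  shows "((\<lambda>e. (dx \<Delta> ^^ j) (g e \<omega>) x) has_real_derivative deriv (\<lambda>e. (dx \<Delta> ^^ j) (g e \<omega>) x) \<epsilon>) (at \<epsilon>)"
  using commute assms unfolding eps_derivs_commute_def DERIV_deriv_iff_real_differentiable by blast

lemma eps_der:
  assumes "\<epsilon> \<in> V" "\<omega> \<in> \<Omega>" "x \<in> \<Delta>"
  shows "((\<lambda>e. g e \<omega> x) has_real_derivative deriv (\<lambda>e. g e \<omega> x) \<epsilon>) (at \<epsilon>)"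
    and "((\<lambda>e. g1 e \<omega> x) has_real_derivative deriv (\<lambda>e. g1 e \<omega> x) \<epsilon>) (at \<epsilon>)"
    and "((\<lambda>e. g2 e \<omega> x) has_real_derivative deriv (\<lambda>e. g2 e \<omega> x) \<epsilon>) (at \<epsilon>)"
  using eps_der_funpow[OF assms, of 0] eps_der_funpow[OF assms, of 1] eps_der_funpow[OF assms, of 2]
  by (simp_all add: numeral_2_eq_2)

lemma gamma_C2: "\<omega> \<in> \<Omega> \<Longrightarrow> \<gamma> \<omega> \<in> C_k 2 \<Delta>"
  using commute zero_in_V unfolding eps_derivs_commute_def \<gamma>_def[abs_def] by blast

lemma gamma_commute:
  assumes "\<omega> \<in> \<Omega>" "x \<in> \<Delta>"
  shows "deriv (\<lambda>e. g1 e \<omega> x) 0 = dx \<Delta> (\<gamma> \<omega>) x"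
    and "deriv (\<lambda>e. g2 e \<omega> x) 0 = dx \<Delta> (dx \<Delta> (\<gamma> \<omega>)) x"
proof -
  have "\<forall>j\<le>2. deriv (\<lambda>e. (dx \<Delta> ^^ j) (g e \<omega>) x) 0 = (dx \<Delta> ^^ j) (\<gamma> \<omega>) x"
    using commute assms zero_in_V unfolding eps_derivs_commute_def \<gamma>_def[abs_def] by blast
  from this[rule_format, of 1] this[rule_format, of 2]
  show "deriv (\<lambda>e. g1 e \<omega> x) 0 = dx \<Delta> (\<gamma> \<omega>) x"
    "deriv (\<lambda>e. g2 e \<omega> x) 0 = dx \<Delta> (dx \<Delta> (\<gamma> \<omega>)) x"
    by (simp_all add: numeral_2_eq_2)
qed

lemma eps_lipschitz:
  fixes F :: "real \<Rightarrow> real"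
  assumes "\<And>e. e \<in> V \<Longrightarrow> (F has_real_derivative F' e) (at e)" "\<And>e. e \<in> V \<Longrightarrow> \<bar>F' e\<bar> \<le> c" "\<bar>e\<bar> < r"
  shows "\<bar>F e - F 0\<bar> \<le> c * \<bar>e\<bar>"
proof -
  have "norm (F e - F 0) \<le> c * norm (e - 0)"
  proof (rule field_differentiable_bound[of "{-r<..<r}"])
    show "(F has_real_derivative F' z) (at z within {-r<..<r})" if "z \<in> {-r<..<r}" for z
      using has_field_derivative_at_within[OF assms(1)[OF r(2)]] that by (simp add: abs_less_iff)
    show "norm (F' z) \<le> c" if "z \<in> {-r<..<r}" for z
      using assms(2)[OF r(2)] that by (simp add: abs_less_iff)
  qed (use assms(3) r(1) in \<open>auto simp: abs_less_iff\<close>)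
  then show ?thesis by simp
qed

lemma eps_continuous: "\<omega> \<in> \<Omega> \<Longrightarrow> x \<in> \<Delta> \<Longrightarrow> continuous_on {-r<..<r} (\<lambda>e. g e \<omega> x)"
  and eps_continuous1: "\<omega> \<in> \<Omega> \<Longrightarrow> x \<in> \<Delta> \<Longrightarrow> continuous_on {-r<..<r} (\<lambda>e. g1 e \<omega> x)"
  by (rule DERIV_continuous_on, rule has_field_derivative_at_within, rule eps_der;
      use r(2) in \<open>simp add: abs_less_iff\<close>)+

lemma g1_vary: "\<bar>e\<bar> < r \<Longrightarrow> \<omega> \<in> \<Omega> \<Longrightarrow> x \<in> \<Delta> \<Longrightarrow> \<bar>g1 e \<omega> x - g1 0 \<omega> x\<bar> \<le> c1 \<omega> * \<bar>e\<bar>"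
  by (rule eps_lipschitz[OF eps_der(2) c1(2)])

lemma g2_vary: "\<bar>e\<bar> < r \<Longrightarrow> \<omega> \<in> \<Omega> \<Longrightarrow> x \<in> \<Delta> \<Longrightarrow>
    \<bar>g2 e \<omega> x - g2 0 \<omega> x\<bar> \<le> c2 \<omega> * \<bar>e\<bar>"
  by (rule eps_lipschitz[OF eps_der(3) c2(2)])

section \<open>Expansion, orientation and distortion of the inverse branches\<close>

lemma T_der_mult:
  assumes "\<epsilon> \<in> V" "\<omega> \<in> \<Omega>" "x \<in> interior \<Delta>"
  shows "deriv (T \<epsilon>) (g \<epsilon> \<omega> x) * g1 \<epsilon> \<omega> x = 1"
proof -
  have x: "x \<in> \<Delta>" by (rule interior_subset'[OF assms(3)])
  have "(g \<epsilon> \<omega> has_real_derivative g1 \<epsilon> \<omega> x) (at x)"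
    using g_der(1)[OF assms(1,2) x] at_within_interior[OF assms(3)] by simp
  from DERIV_chain2[OF full_branch_derivative(1)[OF full_branch[OF assms(1)] assms(2) g_interior[OF assms]] this]
  have "((\<lambda>x. T \<epsilon> (g \<epsilon> \<omega> x)) has_real_derivative deriv (T \<epsilon>) (g \<epsilon> \<omega> x) * g1 \<epsilon> \<omega> x) (at x)" .
  moreover have "((\<lambda>x. T \<epsilon> (g \<epsilon> \<omega> x)) has_real_derivative 1) (at x)"
    by (rule has_field_derivative_transform_within_open[OF DERIV_ident open_interior assms(3)])
      (simp add: T_g assms)
  ultimately show ?thesis by (rule DERIV_unique)
qed

lemma g1_nonzero: "\<epsilon> \<in> V \<Longrightarrow> \<omega> \<in> \<Omega> \<Longrightarrow> x \<in> interior \<Delta> \<Longrightarrow> g1 \<epsilon> \<omega> x \<noteq> 0"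
  using T_der_mult by fastforce

text \<open>The reciprocal of the expansion constant works. It belongs to one parameter; uniformity
  near 0 comes later from the variation of g'.\<close>

lemma g1_expansion:
  assumes "\<epsilon> \<in> V"
  shows "\<exists>\<theta><1. 0 \<le> \<theta> \<and> (\<forall>\<omega>\<in>\<Omega>. \<forall>x\<in>\<Delta>. \<bar>g1 \<epsilon> \<omega> x\<bar> \<le> \<theta>)"
proof -
  have "\<exists>\<kappa>>1. \<forall>\<omega>\<in>\<Omega>. \<forall>y\<in>P \<epsilon> \<omega>. \<kappa> \<le> \<bar>deriv (T \<epsilon>) y\<bar>"
    using full_branch[OF assms] unfolding full_branch_map_def by (elim conjE)
  then obtain \<kappa> where \<kappa>: "\<kappa> > 1" "\<And>\<omega> y. \<omega> \<in> \<Omega> \<Longrightarrow> y \<in> P \<epsilon> \<omega> \<Longrightarrow> \<kappa> \<le> \<bar>deriv (T \<epsilon>) y\<bar>"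
    by blast
  have "\<bar>g1 \<epsilon> \<omega> x\<bar> \<le> 1 / \<kappa>" if w: "\<omega> \<in> \<Omega>" and x: "x \<in> \<Delta>" for \<omega> x
  proof -
    have "0 \<le> 1 / \<kappa> - \<bar>g1 \<epsilon> \<omega> x\<bar>"
    proof (rule nonneg_from_interior[OF _ _ x])
      show "continuous_on \<Delta> (\<lambda>x. 1 / \<kappa> - \<bar>g1 \<epsilon> \<omega> x\<bar>)"
        by (intro continuous_intros g1_cont assms w)
      fix y assume y: "y \<in> interior \<Delta>"
      have "\<bar>deriv (T \<epsilon>) (g \<epsilon> \<omega> y)\<bar> * \<bar>g1 \<epsilon> \<omega> y\<bar> = 1"
        using T_der_mult[OF assms w y] by (metis abs_mult abs_one)
      moreover have "\<kappa> * \<bar>g1 \<epsilon> \<omega> y\<bar> \<le> \<bar>deriv (T \<epsilon>) (g \<epsilon> \<omega> y)\<bar> * \<bar>g1 \<epsilon> \<omega> y\<bar>"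
        using \<kappa>(2)[OF w g_interior[OF assms w y]] by (rule mult_right_mono) simp
      ultimately show "0 \<le> 1 / \<kappa> - \<bar>g1 \<epsilon> \<omega> y\<bar>" using \<kappa>(1) by (simp add: field_simps)
    qed
    then show ?thesis by simp
  qed
  then show ?thesis using \<kappa>(1) by (intro exI[of _ "1 / \<kappa>"]) auto
qed

definition x0 :: real where "x0 = (SOME x. x \<in> interior \<Delta>)"

lemma x0: "x0 \<in> interior \<Delta>"
  unfolding x0_def using interior_ne by (rule some_in_eq[THEN iffD2])

definition \<sigma> :: "'w \<Rightarrow> real" where "\<sigma> \<omega> = sgn (g1 0 \<omega> x0)"

lemma abs_sigma: "\<omega> \<in> \<Omega> \<Longrightarrow> \<bar>\<sigma> \<omega>\<bar> = 1"
  using g1_nonzero[OF zero_in_V _ x0] by (simp add: \<sigma>_def abs_sgn_eq)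

text \<open>g' has no zero in the interior, so its sign is constant in x; at the fixed point
  \<open>x0\<close> it is also constant in the parameter. The weak inequality extends to the end
  points by continuity.\<close>

lemma g1_sign:
  assumes "\<bar>e\<bar> < r" "\<omega> \<in> \<Omega>" "x \<in> \<Delta>"
  shows "\<bar>g1 e \<omega> x\<bar> = \<sigma> \<omega> * g1 e \<omega> x"
proof -
  have e: "e \<in> V" by (rule r(2)[OF assms(1)])
  have int: "sgn (g1 e \<omega> y) = \<sigma> \<omega>" if y: "y \<in> interior \<Delta>" for y
  proof -
    have "sgn (g1 e \<omega> y) = sgn (g1 e \<omega> x0)"
      by (rule sgn_constant[OF _ continuous_on_subset[OF g1_cont[OF e assms(2)] interior_subset] _ y x0])
        (use g1_nonzero[OF e assms(2)] convex_interior[OF convex_dom] in \<open>auto intro: convex_connected\<close>)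
    also have "\<dots> = sgn (g1 0 \<omega> x0)"
      by (rule sgn_constant[OF _ eps_continuous1[OF assms(2) interior_subset'[OF x0]]])
        (use g1_nonzero[OF r(2) assms(2) x0] assms(1) r(1) in \<open>auto simp: abs_less_iff\<close>)
    finally show ?thesis by (simp add: \<sigma>_def)
  qed
  have "0 \<le> \<sigma> \<omega> * g1 e \<omega> x"
  proof (rule nonneg_from_interior[OF _ _ assms(3)])
    show "continuous_on \<Delta> (\<lambda>x. \<sigma> \<omega> * g1 e \<omega> x)"
      by (intro continuous_intros g1_cont e assms)
    show "0 \<le> \<sigma> \<omega> * g1 e \<omega> y" if "y \<in> interior \<Delta>" for y
      unfolding int[OF that, symmetric] by (simp add: sgn_if)
  qed
  then show ?thesis using abs_sigma[OF assms(2)] by (metis abs_mult abs_of_nonneg mult_1)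
qed

text \<open>A Gronwall argument: for the absolute value G of g', the bound on g''/g' says that G' is
  at most D G in size, so G times exp (D x) increases and G times exp (-D x) decreases.\<close>

lemma g1_distortion:
  assumes e: "\<bar>e\<bar> < r" and w: "\<omega> \<in> \<Omega>" and xy: "x \<in> \<Delta>" "y \<in> \<Delta>"
  shows "\<bar>g1 e \<omega> x\<bar> \<le> exp (D * \<bar>x - y\<bar>) * \<bar>g1 e \<omega> y\<bar>"
proof -
  have V: "e \<in> V" by (rule r(2)[OF e])
  define G where "G x = \<sigma> \<omega> * g1 e \<omega> x" for x
  have G_abs: "G x = \<bar>g1 e \<omega> x\<bar>" if "x \<in> \<Delta>" for x
    using g1_sign[OF e w that] by (simp add: G_def)
  have der: "(G has_real_derivative \<sigma> \<omega> * g2 e \<omega> z) (at z)"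
    and le: "\<bar>\<sigma> \<omega> * g2 e \<omega> z\<bar> \<le> D * G z" if z: "z \<in> interior \<Delta>" for z
  proof -
    have "(g1 e \<omega> has_real_derivative g2 e \<omega> z) (at z)"
      using g_der(2)[OF V w interior_subset'[OF z]] at_within_interior[OF z] by simp
    then show "(G has_real_derivative \<sigma> \<omega> * g2 e \<omega> z) (at z)"
      unfolding G_def[abs_def] by (rule DERIV_cmult)
    show "\<bar>\<sigma> \<omega> * g2 e \<omega> z\<bar> \<le> D * G z"
      using D(2)[OF V w interior_subset'[OF z]] g1_nonzero[OF V w z]
      by (simp add: abs_mult abs_sigma[OF w] G_abs[OF interior_subset'[OF z]] divide_le_eq)
  qed
  have contG: "continuous_on S G" if "S \<subseteq> \<Delta>" for S
    unfolding G_def[abs_def] using that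
    by (intro continuous_intros continuous_on_subset[OF g1_cont[OF V w]])
  have key: "G a \<le> exp (D * (b - a)) * G b \<and> G b \<le> exp (D * (b - a)) * G a" if ab: "a \<in> \<Delta>" "b \<in> \<Delta>" "a \<le> b" for a b
  proof
    have sub: "{a..b} \<subseteq> \<Delta>" by (rule segment_subset[OF ab(1,2)])
    have int: "z \<in> interior \<Delta>" if "a < z" "z < b" for z
      using open_segment_interior[OF ab(1,2)] that by auto
    have "G a * exp (D * a) \<le> G b * exp (D * b)"
    proof (rule DERIV_nonneg_imp_increasing_open[OF ab(3)])
      fix z assume "a < z" "z < b"
      then have z: "z \<in> interior \<Delta>" by (rule int)
      have "((\<lambda>z. G z * exp (D * z)) has_real_derivative
          (\<sigma> \<omega> * g2 e \<omega> z + D * G z) * exp (D * z)) (at z)"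
        by (rule derivative_eq_intros der[OF z] refl)+ (simp add: algebra_simps)
      moreover have "0 \<le> (\<sigma> \<omega> * g2 e \<omega> z + D * G z) * exp (D * z)"
        using le[OF z] by (intro mult_nonneg_nonneg) (auto simp: abs_le_iff)
      ultimately show "\<exists>y. ((\<lambda>z. G z * exp (D * z)) has_real_derivative y) (at z) \<and> 0 \<le> y" by blast
    qed (intro continuous_intros contG sub)
    then have "exp (- (D * a)) * (G a * exp (D * a)) \<le> exp (- (D * a)) * (G b * exp (D * b))"
      by (intro mult_left_mono) auto
    then show "G a \<le> exp (D * (b - a)) * G b"
      by (simp add: exp_minus exp_diff right_diff_distrib field_simps)
    have "G b * exp (- (D * b)) \<le> G a * exp (- (D * a))"
    proof (rule DERIV_nonpos_imp_decreasing_open[OF ab(3)])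
      fix z assume "a < z" "z < b"
      then have z: "z \<in> interior \<Delta>" by (rule int)
      have "((\<lambda>z. G z * exp (- (D * z))) has_real_derivative
          (\<sigma> \<omega> * g2 e \<omega> z - D * G z) * exp (- (D * z))) (at z)"
        by (rule derivative_eq_intros der[OF z] refl)+ (simp add: algebra_simps)
      moreover have "(\<sigma> \<omega> * g2 e \<omega> z - D * G z) * exp (- (D * z)) \<le> 0"
        using le[OF z] by (intro mult_nonpos_nonneg) (auto simp: abs_le_iff)
      ultimately show "\<exists>y. ((\<lambda>z. G z * exp (- (D * z))) has_real_derivative y) (at z) \<and> y \<le> 0" by blast
    qed (intro continuous_intros contG sub)
    then have "exp (D * b) * (G b * exp (- (D * b))) \<le> exp (D * b) * (G a * exp (- (D * a)))"
      by (intro mult_left_mono) auto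
    then show "G b \<le> exp (D * (b - a)) * G a"
      by (simp add: exp_minus exp_diff right_diff_distrib field_simps)
  qed
  show ?thesis
    unfolding G_abs[OF xy(1), symmetric] G_abs[OF xy(2), symmetric]
    using key[of x y] key[of y x] xy by (cases "x \<le> y") (auto simp: abs_if)
qed

text \<open>If g' vanished at an end point, the quotient g''/g' would be 0 by the convention for
  division and its bound would say nothing. Distortion against the interior point \<open>x0\<close>
  excludes this.\<close>

lemma g1_nonzero': 
  assumes "\<bar>e\<bar> < r" "\<omega> \<in> \<Omega>" "x \<in> \<Delta>"
  shows "g1 e \<omega> x \<noteq> 0"
  using g1_distortion[OF assms(1,2) interior_subset'[OF x0] assms(3)]
    g1_nonzero[OF r(2)[OF assms(1)] assms(2) x0] by auto

lemma g2_le_g1: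
  assumes "\<bar>e\<bar> < r" "\<omega> \<in> \<Omega>" "x \<in> \<Delta>"
  shows "\<bar>g2 e \<omega> x\<bar> \<le> D * \<bar>g1 e \<omega> x\<bar>"
  using D(2)[OF r(2)[OF assms(1)] assms(2,3)] g1_nonzero'[OF assms] by (simp add: divide_le_eq)

text \<open>The mass of \<open>\<Delta>\<close> to the left of \<open>g\<^sub>\<epsilon>\<^sub>,\<^sub>\<omega> x\<close> is, by the change of variables, a sum of integrals of
  \<open>|g'|\<close> over sets which do not depend on \<open>\<epsilon>\<close>, because branches cannot cross.\<close>
lemma g_vary_interior:
  assumes e: "\<bar>e\<bar> < r" and w: "\<omega> \<in> \<Omega>" and x: "x \<in> interior \<Delta>"
  shows "\<bar>g e \<omega> x - g 0 \<omega> x\<bar> \<le> len * infsum c1 \<Omega> * \<bar>e\<bar>"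
proof -
  let ?M = "lebesgue_on \<Delta>"
  have xD: "x \<in> \<Delta>" by (rule interior_subset'[OF x])
  have e0: "\<bar>0\<bar> < r" using r(1) by simp
  \<comment> \<open>Its integral is the length of \<Delta> to the left of the moving point, so the
    displacement of that point becomes a difference of integrals.\<close>
  define F where "F e = (indicator {..<g e \<omega> x} :: real \<Rightarrow> real)" for e
  have F_meas: "F e \<in> borel_measurable ?M" for e
    unfolding F_def by (intro measurable_restrict_space1 borel_measurable_indicator) simp
  have F_le: "\<bar>F e y\<bar> \<le> 1" for e y by (simp add: F_def indicator_def)
  have F_comp: "F e (g e \<omega>' y) = F 0 (g 0 \<omega>' y)" if e: "\<bar>e\<bar> < r" and w': "\<omega>' \<in> \<Omega>" and y: "y \<in> interior \<Delta>" for e \<omega>' y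
  proof (cases "\<omega>' = \<omega> \<and> y = x")
    case True
    then show ?thesis by (simp add: F_def)
  next
    case False
    \<comment> \<open>Two image points can meet only if they lie in the same branch domain, by
      disjointness, and come from the same point, by \<open>T_g\<close>. Continuity in the parameter
      then preserves their order.\<close>
    have ne: "g e \<omega>' y - g e \<omega> x \<noteq> 0" if "\<bar>e\<bar> < r" for e
    proof
      assume "g e \<omega>' y - g e \<omega> x = 0"
      then have eq: "g e \<omega>' y = g e \<omega> x" by simp
      have V: "e \<in> V" by (rule r(2)[OF that])
      have "g e \<omega> x \<in> P e \<omega>" "g e \<omega> x \<in> P e \<omega>'"
        using g_interior[OF V w x] g_interior[OF V w' y] eq by auto
      moreover have "disjoint_family_on (P e) \<Omega>" using full_branch[OF V] by (simp add: full_branch_map_def)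
      ultimately have "\<omega>' = \<omega>" using w w' by (auto simp: disjoint_family_on_def)
      moreover have "y = x" using T_g[OF V w x] T_g[OF V w' y] eq by simp
      ultimately show False using False by simp
    qed
    have "sgn (g e \<omega>' y - g e \<omega> x) = sgn (g 0 \<omega>' y - g 0 \<omega> x)"
    proof (rule sgn_constant[of "{-r<..<r}" "\<lambda>e. g e \<omega>' y - g e \<omega> x"])
      show "continuous_on {-r<..<r} (\<lambda>e. g e \<omega>' y - g e \<omega> x)"
        by (intro continuous_on_diff eps_continuous w w' xD interior_subset'[OF y])
    qed (use ne e r(1) in \<open>auto simp: abs_less_iff\<close>)
    then have "g e \<omega>' y < g e \<omega> x \<longleftrightarrow> g 0 \<omega>' y < g 0 \<omega> x" by (auto simp: sgn_if split: if_splits)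
    then show ?thesis by (simp add: F_def indicator_def)
  qed
  have PF: "integrable ?M (PF \<Delta> \<Omega> (g e) (F e))" "(LINT x|?M. PF \<Delta> \<Omega> (g e) (F e) x) = (LINT x|?M. F e x)"
    if "\<bar>e\<bar> < r" for e
    using full_branch_integral_PF[OF full_branch[OF r(2)[OF that]] countable_branches s(1) s(2)[OF r(2)[OF that]] F_meas F_le]
    by auto
  have sm: "(\<lambda>\<omega>'. F 0 (g 0 \<omega>' y) * \<bar>g1 e \<omega>' y\<bar>) summable_on \<Omega>" if "\<bar>e\<bar> < r" "y \<in> \<Delta>" for e y
  proof (rule summable_on_dominated[OF s(1)])
    show "\<bar>F 0 (g 0 \<omega>' y) * \<bar>g1 e \<omega>' y\<bar>\<bar> \<le> s \<omega>'" if "\<omega>' \<in> \<Omega>" for \<omega>'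
      using s(2)[OF r(2)[OF \<open>\<bar>e\<bar> < r\<close>] that \<open>y \<in> \<Delta>\<close>]
      by (auto simp: F_def indicator_def intro: order_trans[OF abs_ge_zero])
  qed
  \<comment> \<open>With the indicator frozen, only the weights depend on the parameter, and their
    variation is summable over the branches.\<close>
  have diff: "\<bar>PF \<Delta> \<Omega> (g e) (F e) y - PF \<Delta> \<Omega> (g 0) (F 0) y\<bar> \<le> infsum c1 \<Omega> * \<bar>e\<bar>" if y: "y \<in> interior \<Delta>" for y
  proof -
    have yD: "y \<in> \<Delta>" by (rule interior_subset'[OF y])
    have "PF \<Delta> \<Omega> (g e) (F e) y = (\<Sum>\<^sub>\<infinity>\<omega>'\<in>\<Omega>. F 0 (g 0 \<omega>' y) * \<bar>g1 e \<omega>' y\<bar>)"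
      unfolding PF_def by (intro infsum_cong) (simp add: F_comp[OF e _ y])
    then have "PF \<Delta> \<Omega> (g e) (F e) y - PF \<Delta> \<Omega> (g 0) (F 0) y
      = (\<Sum>\<^sub>\<infinity>\<omega>'\<in>\<Omega>. F 0 (g 0 \<omega>' y) * \<bar>g1 e \<omega>' y\<bar> - F 0 (g 0 \<omega>' y) * \<bar>g1 0 \<omega>' y\<bar>)"
      using infsum_diff_real[OF sm[OF e yD] sm[OF e0 yD]] by (simp add: PF_def)
    also have "\<bar>\<dots>\<bar> \<le> (\<Sum>\<^sub>\<infinity>\<omega>'\<in>\<Omega>. c1 \<omega>' * \<bar>e\<bar>)"
    proof (rule abs_infsum_le[OF summable_on_cmult_left[OF c1(1)]])
      show "\<bar>F 0 (g 0 \<omega>' y) * \<bar>g1 e \<omega>' y\<bar> - F 0 (g 0 \<omega>' y) * \<bar>g1 0 \<omega>' y\<bar>\<bar> \<le> c1 \<omega>' * \<bar>e\<bar>"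
        if "\<omega>' \<in> \<Omega>" for \<omega>'
        using g1_vary[OF e that yD] by (auto simp: F_def indicator_def)
    qed
    finally show ?thesis by (simp add: infsum_cmult_left')
  qed
  have "\<bar>(LINT y|?M. F e y) - (LINT y|?M. F 0 y)\<bar>
      = \<bar>LINT y|?M. PF \<Delta> \<Omega> (g e) (F e) y - PF \<Delta> \<Omega> (g 0) (F 0) y\<bar>"
    using PF[OF e] PF[OF e0] by simp
  also have "\<dots> \<le> (LINT y|?M. \<bar>PF \<Delta> \<Omega> (g e) (F e) y - PF \<Delta> \<Omega> (g 0) (F 0) y\<bar>)"
    by (rule integral_abs_bound)
  also have "\<dots> \<le> (LINT y|?M. infsum c1 \<Omega> * \<bar>e\<bar>)"
  proof (rule integral_mono_AE)
    show "AE y in ?M. \<bar>PF \<Delta> \<Omega> (g e) (F e) y - PF \<Delta> \<Omega> (g 0) (F 0) y\<bar> \<le> infsum c1 \<Omega> * \<bar>e\<bar>"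
      using AE_interior by eventually_elim (rule diff)
    show "integrable ?M (\<lambda>y. \<bar>PF \<Delta> \<Omega> (g e) (F e) y - PF \<Delta> \<Omega> (g 0) (F 0) y\<bar>)"
      using PF(1)[OF e] PF(1)[OF e0] by auto
    show "integrable ?M (\<lambda>y. infsum c1 \<Omega> * \<bar>e\<bar>)"
      by (rule finite_measure.integrable_const[OF finite_measure_dom])
  qed
  also have "\<dots> = infsum c1 \<Omega> * \<bar>e\<bar> * len" by (rule integral_const)
  finally have *: "\<bar>(LINT y|?M. F e y) - (LINT y|?M. F 0 y)\<bar> \<le> len * infsum c1 \<Omega> * \<bar>e\<bar>"
    by (simp add: mult_ac)
  have half: "(LINT y|?M. indicat_real {..<b} y) - (LINT y|?M. indicat_real {..<a} y) = b - (a :: real)"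
    if "a \<in> \<Delta>" "b \<in> \<Delta>" "a \<le> b" for a b
  proof -
    have int: "integrable ?M (indicat_real {..<c} :: real \<Rightarrow> real)" for c :: real
      by (rule integrable_bounded[OF measurable_restrict_space1[OF borel_measurable_indicator], of _ 1])
        (auto simp: indicator_def)
    have "(LINT y|?M. indicat_real {..<b} y) - (LINT y|?M. indicat_real {..<a} y)
      = (LINT y|?M. indicat_real {..<b} y - indicat_real {..<a} y)"
      by (rule Bochner_Integration.integral_diff[OF int int, symmetric])
    also have "\<dots> = (LINT y|?M. indicat_real {a..<b} y * 1)"
      by (rule integral_cong_dom) (use that(3) in \<open>auto simp: indicator_def\<close>)
    also have "\<dots> = (LINT y|lebesgue_on {a..<b}. 1)"
      by (rule integral_indicator_subset) (use segment_subset[OF that(1,2)] in auto)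
    also have "\<dots> = b - a" using that(3) by (simp add: measure_restrict_space)
    finally show ?thesis .
  qed
  have "\<bar>(LINT y|?M. F e y) - (LINT y|?M. F 0 y)\<bar> = \<bar>g e \<omega> x - g 0 \<omega> x\<bar>"
    using half[OF g_in[OF zero_in_V w xD] g_in[OF r(2)[OF e] w xD]]
      half[OF g_in[OF r(2)[OF e] w xD] g_in[OF zero_in_V w xD]]
    unfolding F_def by (cases "g 0 \<omega> x \<le> g e \<omega> x") auto
  with * show ?thesis by simp
qed

abbreviation "K \<equiv> len * infsum c1 \<Omega>"

lemma g_vary:
  assumes e: "\<bar>e\<bar> < r" and w: "\<omega> \<in> \<Omega>" and x: "x \<in> \<Delta>"
  shows "\<bar>g e \<omega> x - g 0 \<omega> x\<bar> \<le> K * \<bar>e\<bar>"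
proof -
  have "0 \<le> K * \<bar>e\<bar> - \<bar>g e \<omega> x - g 0 \<omega> x\<bar>"
  proof (rule nonneg_from_interior[OF _ _ x])
    show "continuous_on \<Delta> (\<lambda>x. K * \<bar>e\<bar> - \<bar>g e \<omega> x - g 0 \<omega> x\<bar>)"
      by (intro continuous_intros g_cont r(2) e zero_in_V w)
  qed (use g_vary_interior[OF e w] in auto)
  then show ?thesis by simp
qed

lemma is_uniform_family:
  assumes l: "l < 1" "0 \<le> l" "\<And>e \<omega> x. \<bar>e\<bar> < r \<Longrightarrow> \<omega> \<in> \<Omega> \<Longrightarrow> x \<in> \<Delta> \<Longrightarrow> \<bar>g1 e \<omega> x\<bar> \<le> l"
  shows "uniform_family \<Delta> \<Omega> g r l D K s c1 c2 \<sigma> \<gamma>"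
proof (intro uniform_family.intro uniform_family_axioms.intro)
  show "bounded_interval \<Delta>" by (rule bounded_interval_axioms)
  show "contracting_branches \<Delta> \<Omega> (g e) s l D" if e: "\<bar>e\<bar> < r" for e
  proof (intro contracting_branches.intro contracting_branches_axioms.intro)
    show "bounded_interval \<Delta>" by (rule bounded_interval_axioms)
    have V: "e \<in> V" by (rule r(2)[OF e])
    show "\<bar>g e \<omega> x - g e \<omega> y\<bar> \<le> l * \<bar>x - y\<bar>" if "\<omega> \<in> \<Omega>" "x \<in> \<Delta>" "y \<in> \<Delta>" for \<omega> x y
      using lipschitz_onD[OF lipschitz_from_derivative[OF g_der(1)[OF V that(1)] l(3)[OF e that(1)]] that(2,3)]
      by (simp add: dist_real_def)
    show "(LINT x|lebesgue_on \<Delta>. PF \<Delta> \<Omega> (g e) f x) = (LINT x|lebesgue_on \<Delta>. f x)"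
      if "f \<in> borel_measurable (lebesgue_on \<Delta>)" "\<And>x. x \<in> \<Delta> \<Longrightarrow> \<bar>f x\<bar> \<le> B" for f B
      by (rule full_branch_integral_PF(2)[OF full_branch[OF V] countable_branches s(1) s(2)[OF V] that])
  qed (use countable_branches g_in[OF r(2)[OF e]] l D(1) s(1) s(2)[OF r(2)[OF e]] g1_distortion[OF e] in auto)
  show "((\<lambda>e. g e \<omega> x) has_real_derivative \<gamma> \<omega> x) (at 0)" if "\<omega> \<in> \<Omega>" "x \<in> \<Delta>" for \<omega> x
    using eps_der(1)[OF zero_in_V that] by (simp add: \<gamma>_def)
  then show "\<bar>\<gamma> \<omega> x\<bar> \<le> K" if "\<omega> \<in> \<Omega>" "x \<in> \<Delta>" for \<omega> x
  proof -
    \<comment> \<open>The displacement bound of \<open>g_vary\<close> passes to the limit of the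
      difference quotients.\<close>
    have "((\<lambda>e. \<bar>(g e \<omega> x - g 0 \<omega> x) / (e - 0)\<bar>) \<longlongrightarrow> \<bar>\<gamma> \<omega> x\<bar>) (at 0)"
      using eps_der(1)[OF zero_in_V that]
      by (intro tendsto_rabs) (simp add: has_field_derivative_iff \<gamma>_def)
    moreover have "\<forall>\<^sub>F e in at 0. \<bar>(g e \<omega> x - g 0 \<omega> x) / (e - 0)\<bar> \<le> K"
    proof -
      have "\<forall>\<^sub>F e in at (0::real). \<bar>e\<bar> < r \<and> e \<noteq> 0"
        using r(1) by (auto simp: eventually_at dist_real_def)
      then show ?thesis
        by eventually_elim (use g_vary that in \<open>auto simp: abs_divide divide_le_eq\<close>)
    qed
    ultimately show ?thesis by (rule tendsto_upperbound) simp
  qed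
  show "((\<lambda>e. g1 e \<omega> x) has_real_derivative dx \<Delta> (\<gamma> \<omega>) x) (at 0)" if "\<omega> \<in> \<Omega>" "x \<in> \<Delta>" for \<omega> x
    using eps_der(2)[OF zero_in_V that] gamma_commute(1)[OF that] by simp
  show "\<bar>dx \<Delta> (\<gamma> \<omega>) x\<bar> \<le> c1 \<omega>" if "\<omega> \<in> \<Omega>" "x \<in> \<Delta>" for \<omega> x
    using c1(2)[OF zero_in_V that] gamma_commute(1)[OF that] by simp
  show "\<bar>dx \<Delta> (dx \<Delta> (\<gamma> \<omega>)) x\<bar> \<le> c2 \<omega>" if "\<omega> \<in> \<Omega>" "x \<in> \<Delta>" for \<omega> x
    using c2(2)[OF zero_in_V that] gamma_commute(2)[OF that] by simp
  show "(\<gamma> \<omega> has_real_derivative dx \<Delta> (\<gamma> \<omega>) x) (at x within \<Delta>)" if "\<omega> \<in> \<Omega>" "x \<in> \<Delta>" for \<omega> x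
    using C_k_has_derivative[OF gamma_C2[OF that(1)], of 0 x] that by simp
  show "(dx \<Delta> (\<gamma> \<omega>) has_real_derivative dx \<Delta> (dx \<Delta> (\<gamma> \<omega>)) x) (at x within \<Delta>)" if "\<omega> \<in> \<Omega>" "x \<in> \<Delta>" for \<omega> x
    using C_k_has_derivative[OF gamma_C2[OF that(1)], of 1 x] that by simp
  show "continuous_on \<Delta> (dx \<Delta> (dx \<Delta> (\<gamma> \<omega>)))" if "\<omega> \<in> \<Omega>" for \<omega>
    using C_k_continuous[OF gamma_C2[OF that], of 2] by (simp add: numeral_2_eq_2)
  show "\<bar>g e \<omega> x - g 0 \<omega> x\<bar> \<le> K * \<bar>e\<bar>" if "\<bar>e\<bar> < r" "\<omega> \<in> \<Omega>" "x \<in> \<Delta>" for e \<omega> x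
    by (rule g_vary[OF that])
qed (use r(1) g_der[OF r(2)] g2_cont[OF r(2)] g1_sign abs_sigma g2_le_g1 g1_vary g2_vary c1(1) c2(1) in auto)

end

subsection \<open>The coefficients of the response formula\<close>

text \<open>A mixed second difference of order \<open>\<bar>e\<bar> * \<bar>X e - x\<bar>\<close> is
  o(e) once \<open>X e\<close> tends to \<open>x\<close>. This makes a chain rule for
  \<open>F e (X e)\<close> available when only partial derivatives are known to exist.\<close>

lemma two_variable_remainder:
  fixes F :: "real \<Rightarrow> real \<Rightarrow> real" and X :: "real \<Rightarrow> real"
  assumes X: "isCont X 0" "X 0 = x"
    and bound: "\<forall>\<^sub>F e in at 0. \<bar>(F e (X e) - F e x) - (F 0 (X e) - F 0 x)\<bar> \<le> c * \<bar>e\<bar> * \<bar>X e - x\<bar>"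
  shows "((\<lambda>e. (F e (X e) - F e x) - (F 0 (X e) - F 0 x)) has_real_derivative 0) (at 0)"
proof -
  have "((\<lambda>e. ((F e (X e) - F e x) - (F 0 (X e) - F 0 x)) / e) \<longlongrightarrow> 0) (at 0)"
  proof (rule Lim_null_comparison)
    have "\<forall>\<^sub>F e in at (0::real). e \<noteq> 0" by (simp add: eventually_at_filter)
    with bound show "\<forall>\<^sub>F e in at 0. norm (((F e (X e) - F e x) - (F 0 (X e) - F 0 x)) / e) \<le> c * \<bar>X e - x\<bar>"
      by eventually_elim (simp add: abs_divide divide_le_eq mult_ac)
    have "((\<lambda>e. c * \<bar>X e - x\<bar>) \<longlongrightarrow> c * \<bar>x - x\<bar>) (at 0)"
      using X by (intro tendsto_intros) (simp add: isCont_def)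
    then show "((\<lambda>e. c * \<bar>X e - x\<bar>) \<longlongrightarrow> 0) (at 0)" by simp
  qed
  then show ?thesis using X(2) by (simp add: has_field_derivative_iff)
qed

context branch_family begin

context
  fixes \<omega> :: 'w and x :: real
  assumes w: "\<omega> \<in> \<Omega>" and x: "x \<in> interior \<Delta>"
begin

abbreviation "y0 \<equiv> g 0 \<omega> x"
abbreviation "X \<equiv> \<lambda>e. T e y0"

lemma x_dom: "x \<in> \<Delta>" by (rule interior_subset'[OF x])

lemma X_0: "X 0 = x" by (rule T_g[OF zero_in_V w x])

lemma eventually_small: "\<forall>\<^sub>F e in nhds 0. \<bar>e\<bar> < r"
  using r(1) by (auto simp: eventually_nhds_metric dist_real_def)

text \<open>By the intermediate value theorem the moved branch still passes through \<open>y0\<close> close to \<open>x\<close>.\<close>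
lemma X_near:
  assumes "0 < \<eta>"
  shows "\<forall>\<^sub>F e in nhds 0. \<bar>e\<bar> < r \<and> X e \<in> interior \<Delta> \<and> g e \<omega> (X e) = y0 \<and> \<bar>X e - x\<bar> < \<eta>"
proof -
  obtain d0 where d0: "d0 > 0" "cball x d0 \<subseteq> interior \<Delta>"
    using open_contains_cball[of "interior \<Delta>"] x by auto
  \<comment> \<open>Half of \<eta> yields the strict inequality at the end, and \<open>d0\<close>
    keeps the segment inside the interior.\<close>
  define d where "d = min d0 (\<eta> / 2)"
  have d: "d > 0" "d < \<eta>" "d \<le> d0" using d0 assms by (auto simp: d_def)
  have int: "z \<in> interior \<Delta>" if "x - d \<le> z" "z \<le> x + d" for z
    by (rule subsetD[OF d0(2)]) (use that d(3) in \<open>auto simp: dist_real_def abs_le_iff\<close>)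
  \<comment> \<open>The factor \<sigma> makes the branch increasing, whatever its
    orientation.\<close>
  define G where "G e z = \<sigma> \<omega> * g e \<omega> z" for e z
  have Gder: "(G 0 has_real_derivative \<bar>g1 0 \<omega> z\<bar>) (at z)" if z: "z \<in> interior \<Delta>" for z
  proof -
    have "(g 0 \<omega> has_real_derivative g1 0 \<omega> z) (at z)"
      using g_der(1)[OF zero_in_V w interior_subset'[OF z]] at_within_interior[OF z] by simp
    from DERIV_cmult[OF this, of "\<sigma> \<omega>"] show ?thesis
      using g1_sign[of 0 \<omega> z] r(1) w interior_subset'[OF z] by (simp add: G_def[abs_def])
  qed
  have mono: "G 0 a < G 0 b" if "x - d \<le> a" "a < b" "b \<le> x + d" for a b
  proof (rule DERIV_pos_imp_increasing[OF that(2)])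
    fix z assume "a \<le> z" "z \<le> b"
    then have z: "z \<in> interior \<Delta>" using int that by auto
    show "\<exists>d. (G 0 has_real_derivative d) (at z) \<and> 0 < d"
      using Gder[OF z] g1_nonzero[OF zero_in_V w z] by auto
  qed
  have lim: "((\<lambda>e. G e z) \<longlongrightarrow> G 0 z) (nhds 0)" if "z \<in> \<Delta>" for z
  proof -
    have "isCont (\<lambda>e. g e \<omega> z) 0" by (rule DERIV_isCont[OF eps_der(1)[OF zero_in_V w that]])
    then have "isCont (\<lambda>e. G e z) 0" unfolding G_def by (intro continuous_intros)
    then show ?thesis by (simp add: isCont_def tendsto_at_iff_tendsto_nhds[of "\<lambda>e. G e z" 0])
  qed
  have "x - d \<in> \<Delta>" "x + d \<in> \<Delta>" using int[of "x - d"] int[of "x + d"] d(1) interior_subset' by auto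
  \<comment> \<open>Strict inequalities at the two ends of the segment persist for small parameters,
    so the value \<open>G 0 x\<close> is still taken in between.\<close>
  then have "\<forall>\<^sub>F e in nhds 0. G e (x - d) < G 0 x" "\<forall>\<^sub>F e in nhds 0. G 0 x < G e (x + d)"
    using order_tendstoD(2)[OF lim mono[of "x - d" x]] order_tendstoD(1)[OF lim mono[of x "x + d"]] d(1) by auto
  then show ?thesis
    using eventually_small
  proof eventually_elim
    case (elim e)
    have "continuous_on {x - d..x + d} (G e)"
      unfolding G_def
      by (intro continuous_intros continuous_on_subset[OF g_cont[OF r(2)[OF elim(3)] w]])
        (use int interior_subset' in auto)
    then obtain z where z: "x - d \<le> z" "z \<le> x + d" "G e z = G 0 x"
      using IVT'[of "G e" "x - d" "G 0 x" "x + d"] elim d(1) by auto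
    have zi: "z \<in> interior \<Delta>" by (rule int[OF z(1,2)])
    have "g e \<omega> z = y0" using z(3) abs_sigma[OF w] by (auto simp: G_def)
    moreover have "X e = z" using T_g[OF r(2)[OF elim(3)] w zi] calculation by simp
    ultimately show ?case using elim(3) zi z d(2) by auto
  qed
qed

lemma X_cont: "isCont X 0"
  unfolding isCont_def X_0
proof (rule tendstoI)
  fix \<eta> :: real assume "0 < \<eta>"
  from X_near[OF this] show "\<forall>\<^sub>F e in at 0. dist (X e) x < \<eta>"
    by (auto simp: eventually_at_filter dist_real_def elim: eventually_mono)
qed

lemma eventually_X:
  "\<forall>\<^sub>F e in at 0. \<bar>e\<bar> < r \<and> X e \<in> interior \<Delta> \<and> g e \<omega> (X e) = y0"
  using X_near[of 1] by (auto simp: eventually_at_filter elim: eventually_mono)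

text \<open>By \<open>g1_vary\<close> the difference of \<open>g e \<omega>\<close> and
  \<open>g 0 \<omega>\<close> has a Lipschitz constant in x of order \<open>e\<close>, which is what
  \<open>two_variable_remainder\<close> asks for.\<close>

lemma remainder0:
  "((\<lambda>e. (g e \<omega> (X e) - g e \<omega> x) - (g 0 \<omega> (X e) - g 0 \<omega> x)) has_real_derivative 0) (at 0)"
proof (rule two_variable_remainder[OF X_cont X_0, where F = "\<lambda>e. g e \<omega>"])
  show "\<forall>\<^sub>F e in at 0. \<bar>(g e \<omega> (X e) - g e \<omega> x) - (g 0 \<omega> (X e) - g 0 \<omega> x)\<bar> \<le> c1 \<omega> * \<bar>e\<bar> * \<bar>X e - x\<bar>"
    using eventually_X
  proof eventually_elim
    case (elim e)
    have V: "e \<in> V" using elim r(2) by auto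
    have "(c1 \<omega> * \<bar>e\<bar>)-lipschitz_on \<Delta> (\<lambda>z. g e \<omega> z - g 0 \<omega> z)"
      using DERIV_diff[OF g_der(1)[OF V w] g_der(1)[OF zero_in_V w]] g1_vary[OF _ w] elim
      by (intro lipschitz_from_derivative) auto
    from lipschitz_onD[OF this, of "X e" x] show ?case
      using interior_subset' elim x by (simp add: dist_real_def algebra_simps)
  qed
qed

lemma remainder1:
  "((\<lambda>e. (g1 e \<omega> (X e) - g1 e \<omega> x) - (g1 0 \<omega> (X e) - g1 0 \<omega> x))
    has_real_derivative 0) (at 0)"
proof (rule two_variable_remainder[OF X_cont X_0, where F = "\<lambda>e. g1 e \<omega>"])
  show "\<forall>\<^sub>F e in at 0. \<bar>(g1 e \<omega> (X e) - g1 e \<omega> x) - (g1 0 \<omega> (X e) - g1 0 \<omega> x)\<bar>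
      \<le> c2 \<omega> * \<bar>e\<bar> * \<bar>X e - x\<bar>"
    using eventually_X
  proof eventually_elim
    case (elim e)
    have V: "e \<in> V" using elim r(2) by auto
    have "(c2 \<omega> * \<bar>e\<bar>)-lipschitz_on \<Delta> (\<lambda>z. g1 e \<omega> z - g1 0 \<omega> z)"
      using DERIV_diff[OF g_der(2)[OF V w] g_der(2)[OF zero_in_V w]] g2_vary[OF _ w] elim
      by (intro lipschitz_from_derivative) auto
    from lipschitz_onD[OF this, of "X e" x] show ?case
      using interior_subset' elim x by (simp add: dist_real_def algebra_simps)
  qed
qed

lemma deriv_T_0: "deriv (T 0) y0 = 1 / g1 0 \<omega> x"
  using T_der_mult[OF zero_in_V w x] g1_nonzero[OF zero_in_V w x] by (simp add: field_simps)

text \<open>Implicit differentiation without prior differentiability of \<open>X\<close>: it is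
  rewritten as \<open>T 0\<close> of an expression whose parameter derivative is already
  known.\<close>

lemma X_derivative: "(X has_real_derivative - (\<gamma> \<omega> x / g1 0 \<omega> x)) (at 0)"
proof -
  have y0: "y0 \<in> P 0 \<omega>" by (rule g_interior[OF zero_in_V w x])
  let ?R = "\<lambda>e. (g e \<omega> (X e) - g e \<omega> x) - (g 0 \<omega> (X e) - g 0 \<omega> x)"
  \<comment> \<open>Because \<open>g e \<omega> (X e) = y0\<close> for small \<open>e\<close>, this
    expression equals \<open>g 0 \<omega> (X e)\<close>; \<open>2 * y0\<close> collects the values
    of the moved branch at \<open>X e\<close> and of the unmoved one at \<open>x\<close>.\<close>
  let ?Z = "\<lambda>e. 2 * y0 - g e \<omega> x - ?R e"
  have "(?Z has_real_derivative 0 - \<gamma> \<omega> x - 0) (at 0)"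
    by (intro DERIV_diff DERIV_const remainder0) (use eps_der(1)[OF zero_in_V w x_dom] in \<open>simp add: \<gamma>_def\<close>)
  moreover have "(T 0 has_real_derivative deriv (T 0) y0) (at (?Z 0))"
    using full_branch_derivative(1)[OF full_branch[OF zero_in_V] w y0] X_0 by simp
  ultimately have "((\<lambda>e. T 0 (?Z e)) has_real_derivative deriv (T 0) y0 * (0 - \<gamma> \<omega> x - 0)) (at 0)"
    by (intro DERIV_chain2)
  moreover have "\<forall>\<^sub>F e in nhds 0. T 0 (?Z e) = X e"
    using X_near[OF zero_less_one]
    by (rule eventually_mono) (use T_g[OF zero_in_V w] in auto)
  ultimately have "(X has_real_derivative deriv (T 0) y0 * (0 - \<gamma> \<omega> x - 0)) (at 0)"
    by (subst (asm) DERIV_cong_ev[OF refl _ refl])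
  then show ?thesis by (simp add: deriv_T_0)
qed

lemma deriv_eps_T: "deriv (\<lambda>e. T e y0) 0 = - (\<gamma> \<omega> x / g1 0 \<omega> x)"
  by (rule DERIV_imp_deriv[OF X_derivative])

text \<open>On the branch domain T' is the reciprocal of g' composed with T, and this expression is
  differentiated.\<close>

lemma deriv_deriv_T: "deriv (deriv (T 0)) y0 = - g2 0 \<omega> x / g1 0 \<omega> x ^ 3"
proof -
  have y0: "y0 \<in> P 0 \<omega>" by (rule g_interior[OF zero_in_V w x])
  have nz: "g1 0 \<omega> x \<noteq> 0" by (rule g1_nonzero[OF zero_in_V w x])
  have P: "open (P 0 \<omega>)" using full_branch[OF zero_in_V] w by (auto simp: full_branch_map_def)
  have d: "(g1 0 \<omega> has_real_derivative g2 0 \<omega> x) (at (T 0 y0))"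
    using g_der(2)[OF zero_in_V w x_dom] at_within_interior[OF x] X_0 by simp
  have "((\<lambda>z. g1 0 \<omega> (T 0 z)) has_real_derivative
      g2 0 \<omega> x * deriv (T 0) y0) (at y0)"
    by (rule DERIV_chain2[OF d full_branch_derivative(1)[OF full_branch[OF zero_in_V] w y0]])
  from DERIV_inverse_fun[OF this]
  have "((\<lambda>z. inverse (g1 0 \<omega> (T 0 z))) has_real_derivative
      - g2 0 \<omega> x / g1 0 \<omega> x ^ 3) (at y0)"
    using nz by (auto simp: X_0 deriv_T_0 field_simps power_numeral_reduce elim: DERIV_cong)
  then have "(deriv (T 0) has_real_derivative - g2 0 \<omega> x / g1 0 \<omega> x ^ 3) (at y0)"
  proof (rule has_field_derivative_transform_within_open[OF _ P y0])
    fix z assume "z \<in> P 0 \<omega>"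
    then obtain x' where x': "x' \<in> interior \<Delta>" "z = g 0 \<omega> x'"
      using full_branch_image[OF full_branch[OF zero_in_V] w] by blast
    show "inverse (g1 0 \<omega> (T 0 z)) = deriv (T 0) z"
      using T_der_mult[OF zero_in_V w x'(1)] g1_nonzero[OF zero_in_V w x'(1)] T_g[OF zero_in_V w x'(1)] x'(2)
      by (simp add: field_simps)
  qed
  then show ?thesis by (rule DERIV_imp_deriv)
qed

text \<open>The derivative of \<open>T e\<close> at the fixed point \<open>y0\<close> is the
  reciprocal of g' of the moved branch at the moving point \<open>X e\<close>.\<close>

lemma deriv_eps_deriv_T:
  "deriv (\<lambda>e. deriv (T e) y0) 0 =
    - (dx \<Delta> (\<gamma> \<omega>) x - g2 0 \<omega> x * (\<gamma> \<omega> x / g1 0 \<omega> x)) / (g1 0 \<omega> x)\<^sup>2"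
proof -
  have nz: "g1 0 \<omega> x \<noteq> 0" by (rule g1_nonzero[OF zero_in_V w x])
  let ?R = "\<lambda>e. (g1 e \<omega> (X e) - g1 e \<omega> x) - (g1 0 \<omega> (X e) - g1 0 \<omega> x)"
  let ?d = "dx \<Delta> (\<gamma> \<omega>) x - g2 0 \<omega> x * (\<gamma> \<omega> x / g1 0 \<omega> x)"
  have d: "(g1 0 \<omega> has_real_derivative g2 0 \<omega> x) (at (X 0))"
    using g_der(2)[OF zero_in_V w x_dom] at_within_interior[OF x] X_0 by simp
  have e1: "((\<lambda>e. g1 e \<omega> x) has_real_derivative dx \<Delta> (\<gamma> \<omega>) x) (at 0)"
    using eps_der(2)[OF zero_in_V w x_dom] gamma_commute(1)[OF w x_dom] by simp
  \<comment> \<open>The first summand is the mixed second difference, with derivative 0; the whole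
    sum telescopes to \<open>g1 e \<omega> (X e)\<close>.\<close>
  have "((\<lambda>e. ?R e + g1 e \<omega> x + g1 0 \<omega> (X e) - g1 0 \<omega> x) has_real_derivative
      0 + dx \<Delta> (\<gamma> \<omega>) x + g2 0 \<omega> x * (- (\<gamma> \<omega> x / g1 0 \<omega> x)) - 0) (at 0)"
    by (intro DERIV_diff DERIV_add remainder1 e1 DERIV_const DERIV_chain2[OF d X_derivative])
  then have "((\<lambda>e. g1 e \<omega> (X e)) has_real_derivative ?d) (at 0)" by simp
  from DERIV_inverse_fun[OF this]
  have "((\<lambda>e. inverse (g1 e \<omega> (X e))) has_real_derivative - ?d / (g1 0 \<omega> x)\<^sup>2) (at 0)"
    by (rule DERIV_cong) (use nz in \<open>simp_all add: X_0 field_simps power2_eq_square\<close>)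
  moreover have "\<forall>\<^sub>F e in nhds 0. inverse (g1 e \<omega> (X e)) = deriv (T e) y0"
    using X_near[OF zero_less_one]
  proof (rule eventually_mono)
    fix e assume e: "\<bar>e\<bar> < r \<and> X e \<in> interior \<Delta> \<and> g e \<omega> (X e) = y0 \<and> \<bar>X e - x\<bar> < 1"
    then have "deriv (T e) y0 * g1 e \<omega> (X e) = 1" using T_der_mult[OF r(2) w, of e "X e"] by simp
    then show "inverse (g1 e \<omega> (X e)) = deriv (T e) y0"
      by (metis inverse_unique mult.commute)
  qed
  ultimately have "((\<lambda>e. deriv (T e) y0) has_real_derivative - ?d / (g1 0 \<omega> x)\<^sup>2) (at 0)"
    by (subst (asm) DERIV_cong_ev[OF refl _ refl])
  then show ?thesis by (rule DERIV_imp_deriv)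
qed

lemma A0_branch: "A0 T y0 = \<gamma> \<omega> x"
  using g1_nonzero[OF zero_in_V w x] by (simp add: A0_def deriv_eps_T deriv_T_0)

text \<open>The two contributions of g'' cancel: the one from T'' and the one that the motion of
  \<open>X e\<close> adds to the parameter derivative of T'.\<close>

lemma B0_branch: "B0 T y0 = dx \<Delta> (\<gamma> \<omega>) x / g1 0 \<omega> x"
  using g1_nonzero[OF zero_in_V w x]
  unfolding B0_def deriv_eps_T deriv_T_0 deriv_deriv_T deriv_eps_deriv_T
  by (simp add: field_simps power2_eq_square power3_eq_cube)

end

end

subsection \<open>Linear response for full-branch maps\<close>

context bounded_interval begin

section \<open>Linear structure of \<open>C_b\<close> and convergence under a spectral gap\<close>

lemma C_k_linear:
  assumes "f \<in> C_k k \<Delta>" "f' \<in> C_k k \<Delta>" "j \<le> k" "x \<in> \<Delta>"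
  shows "(dx \<Delta> ^^ j) (\<lambda>x. f x + c * f' x) x = (dx \<Delta> ^^ j) f x + c * (dx \<Delta> ^^ j) f' x"
  using assms(3,4)
proof (induction j arbitrary: x)
  case (Suc j)
  have "(dx \<Delta> ^^ Suc j) (\<lambda>x. f x + c * f' x) x = dx \<Delta> (\<lambda>x. (dx \<Delta> ^^ j) f x + c * (dx \<Delta> ^^ j) f' x) x"
    using dx_cong[OF Suc.IH] Suc.prems by simp
  also have "\<dots> = (dx \<Delta> ^^ Suc j) f x + c * (dx \<Delta> ^^ Suc j) f' x"
    using Suc.prems C_k_has_derivative[OF assms(1), of j x] C_k_has_derivative[OF assms(2), of j x]
    by (intro dx_eqI DERIV_add DERIV_cmult) auto
  finally show ?case .
qed simp

lemma C_b_linear: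
  assumes f: "f \<in> C_b k \<Delta>" "f' \<in> C_b k \<Delta>"
  shows "(\<lambda>x. f x + c * f' x) \<in> C_b k \<Delta>"
proof -
  have ck: "f \<in> C_k k \<Delta>" "f' \<in> C_k k \<Delta>" using f by (auto simp: C_b_def)
  note lin = C_k_linear[OF ck, where c = c]
  have "(dx \<Delta> ^^ j) (\<lambda>x. f x + c * f' x) differentiable (at x within \<Delta>)" if "j < k" "x \<in> \<Delta>" for j x
  proof -
    have "(\<lambda>x. (dx \<Delta> ^^ j) f x + c * (dx \<Delta> ^^ j) f' x) differentiable (at x within \<Delta>)"
      using ck that by (intro differentiable_add differentiable_mult differentiable_const) (auto simp: C_k_def)
    then show ?thesis
      by (subst differentiable_cong[OF lin[OF less_imp_le[OF that(1)]] that(2)]) simp_all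
  qed
  moreover have "continuous_on \<Delta> ((dx \<Delta> ^^ j) (\<lambda>x. f x + c * f' x))" if "j \<le> k" for j
  proof -
    have "continuous_on \<Delta> (\<lambda>x. (dx \<Delta> ^^ j) f x + c * (dx \<Delta> ^^ j) f' x)"
      using ck that by (intro continuous_intros C_k_continuous)
    then show ?thesis by (subst continuous_on_cong[OF refl lin[OF that]]) simp_all
  qed
  moreover have "bounded ((dx \<Delta> ^^ j) (\<lambda>x. f x + c * f' x) ` \<Delta>)" if j: "j \<le> k" for j
  proof -
    obtain B where B: "\<And>x. x \<in> \<Delta> \<Longrightarrow> \<bar>(dx \<Delta> ^^ j) f x\<bar> \<le> B" using C_b_bounded[OF f(1) j] by metis
    obtain B' where B': "\<And>x. x \<in> \<Delta> \<Longrightarrow> \<bar>(dx \<Delta> ^^ j) f' x\<bar> \<le> B'" using C_b_bounded[OF f(2) j] by metis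
    have "\<bar>(dx \<Delta> ^^ j) (\<lambda>x. f x + c * f' x) x\<bar> \<le> B + \<bar>c\<bar> * B'" if "x \<in> \<Delta>" for x
    proof -
      have "\<bar>c * (dx \<Delta> ^^ j) f' x\<bar> \<le> \<bar>c\<bar> * B'"
        unfolding abs_mult by (intro mult_left_mono B' that) simp
      then show ?thesis unfolding lin[OF j that] using B[OF that] by linarith
    qed
    then show ?thesis by (auto simp: bounded_iff)
  qed
  ultimately show ?thesis by (simp add: C_b_def C_k_def)
qed

lemma C_b_mono: "f \<in> C_b k \<Delta> \<Longrightarrow> j \<le> k \<Longrightarrow> f \<in> C_b j \<Delta>"
  by (auto simp: C_b_def C_k_def)

lemma C_b_const: "(\<lambda>_. c) \<in> C_b k \<Delta>"
proof -
  have dc: "(dx \<Delta> ^^ j) (\<lambda>_. c) x = (if j = 0 then c else 0)" if "x \<in> \<Delta>" for j x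
    using that
  proof (induction j arbitrary: x)
    case (Suc j)
    have "dx \<Delta> ((dx \<Delta> ^^ j) (\<lambda>_. c)) x = dx \<Delta> (\<lambda>_. if j = 0 then c else 0) x"
      by (rule dx_cong[OF Suc.IH Suc.prems])
    also have "\<dots> = 0" by (rule dx_eqI[OF Suc.prems DERIV_const])
    finally show ?case by simp
  qed simp
  have "(dx \<Delta> ^^ j) (\<lambda>_. c) differentiable (at x within \<Delta>)" if "x \<in> \<Delta>" for j x
    by (subst differentiable_cong[OF dc that]) simp_all
  moreover have "continuous_on \<Delta> ((dx \<Delta> ^^ j) (\<lambda>_. c))" for j
    by (subst continuous_on_cong[OF refl dc]) simp_all
  moreover have "bounded ((dx \<Delta> ^^ j) (\<lambda>_. c) ` \<Delta>)" for j
    using dc by (auto simp: bounded_iff intro!: exI[of _ "\<bar>c\<bar>"])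
  ultimately show ?thesis by (simp add: C_b_def C_k_def)
qed

lemma abs_le_C_norm:
  assumes "f \<in> C_b k \<Delta>" "x \<in> \<Delta>"
  shows "\<bar>f x\<bar> \<le> C_norm k \<Delta> f"
proof -
  have le: "\<bar>(dx \<Delta> ^^ j) f x\<bar> \<le> (SUP x\<in>\<Delta>. \<bar>(dx \<Delta> ^^ j) f x\<bar>)" if j: "j \<le> k" for j
  proof (rule cSUP_upper[OF assms(2)])
    obtain B where "\<And>x. x \<in> \<Delta> \<Longrightarrow> \<bar>(dx \<Delta> ^^ j) f x\<bar> \<le> B" using C_b_bounded[OF assms(1) j] by metis
    then show "bdd_above ((\<lambda>x. \<bar>(dx \<Delta> ^^ j) f x\<bar>) ` \<Delta>)" by (rule bdd_aboveI2)
  qed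
  have "\<bar>(dx \<Delta> ^^ 0) f x\<bar> \<le> (SUP x\<in>\<Delta>. \<bar>(dx \<Delta> ^^ 0) f x\<bar>)" by (rule le) simp
  also have "\<dots> \<le> C_norm k \<Delta> f"
    unfolding C_norm_def
  proof (rule member_le_sum)
    show "0 \<le> (SUP x\<in>\<Delta>. \<bar>(dx \<Delta> ^^ j) f x\<bar>)" if "j \<in> {..k} - {0}" for j
      using order_trans[OF abs_ge_zero le[of j]] that by simp
  qed auto
  finally show ?thesis by simp
qed

text \<open>The norm estimate of the gap dominates pointwise differences, so the iterates converge
  to a multiple of a C^k fixed function. The multiple is left unspecified.\<close>

lemma spectral_gap_limit:
  assumes gap: "spectral_gap k \<Delta> L" and f: "f \<in> C_b k \<Delta>"
  obtains u c where "u \<in> C_b k \<Delta>" "\<And>x. x \<in> \<Delta> \<Longrightarrow> L u x = u x"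
    "\<And>x. x \<in> \<Delta> \<Longrightarrow> (\<lambda>n. (L ^^ n) f x) \<longlonglongrightarrow> c * u x"
proof -
  have L: "L F \<in> C_b k \<Delta>" if "F \<in> C_b k \<Delta>" for F using gap that by (simp add: spectral_gap_def)
  have "\<exists>u\<in>C_b k \<Delta>. \<exists>l C \<theta>. (\<forall>x\<in>\<Delta>. L u x = u x) \<and> 0 \<le> \<theta> \<and> \<theta> < 1 \<and>
      (\<forall>f\<in>C_b k \<Delta>. \<forall>n. C_norm k \<Delta> (\<lambda>x. (L ^^ n) f x - l f * u x) \<le> C * \<theta> ^ n * C_norm k \<Delta> f)"
    using gap unfolding spectral_gap_def by blast
  then obtain u l C \<theta> where u: "u \<in> C_b k \<Delta>" "\<And>x. x \<in> \<Delta> \<Longrightarrow> L u x = u x" "0 \<le> \<theta>" "\<theta> < 1"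
    "\<And>f n. f \<in> C_b k \<Delta> \<Longrightarrow> C_norm k \<Delta> (\<lambda>x. (L ^^ n) f x - l f * u x) \<le> C * \<theta> ^ n * C_norm k \<Delta> f"
    by blast
  have Ln: "(L ^^ n) f \<in> C_b k \<Delta>" for n by (induction n) (simp_all add: f L)
  have "(\<lambda>n. (L ^^ n) f x) \<longlonglongrightarrow> l f * u x" if x: "x \<in> \<Delta>" for x
  proof -
    have "(\<lambda>n. (L ^^ n) f x - l f * u x) \<longlonglongrightarrow> 0"
    proof (rule Lim_null_comparison)
      show "\<forall>\<^sub>F n in sequentially. norm ((L ^^ n) f x - l f * u x) \<le> C * \<theta> ^ n * C_norm k \<Delta> f"
      proof (intro always_eventually allI)
        fix n
        have "(\<lambda>x. (L ^^ n) f x + (- l f) * u x) \<in> C_b k \<Delta>" by (rule C_b_linear[OF Ln u(1)])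
        from abs_le_C_norm[OF this x] u(5)[OF f, of n]
        show "norm ((L ^^ n) f x - l f * u x) \<le> C * \<theta> ^ n * C_norm k \<Delta> f" by simp
      qed
      have "(\<lambda>n. C * \<theta> ^ n * C_norm k \<Delta> f) \<longlonglongrightarrow> C * 0 * C_norm k \<Delta> f"
        by (intro tendsto_mult tendsto_const LIMSEQ_realpow_zero u(3,4))
      then show "(\<lambda>n. C * \<theta> ^ n * C_norm k \<Delta> f) \<longlonglongrightarrow> 0" by simp
    qed
    then show ?thesis by (rule LIM_zero_cancel)
  qed
  with u(1,2) show ?thesis by (rule that)
qed

end

lemma sup_norm_tendsto_0:
  assumes "uniform_limit \<Delta> f l F"
  shows "((\<lambda>t. sup_norm \<Delta> (\<lambda>x. f t x - l x)) \<longlongrightarrow> 0) F"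
proof (rule order_tendstoI)
  fix a :: ennreal assume "0 < a"
  \<comment> \<open>A supremum of values below \<open>b\<close> is only known to be at most
    \<open>b\<close>; choosing \<open>b\<close> below \<open>a\<close> restores the strict
    inequality.\<close>
  then obtain b where b: "0 < b" "b < a" using dense by blast
  then obtain e where e: "b = ennreal e" "0 < e"
    by (metis ennreal_cases ennreal_less_zero_iff not_less top_greatest)
  from uniform_limitD[OF assms e(2)] show "\<forall>\<^sub>F t in F. sup_norm \<Delta> (\<lambda>x. f t x - l x) < a"
  proof eventually_elim
    case (elim t)
    have "sup_norm \<Delta> (\<lambda>x. f t x - l x) \<le> b"
      unfolding sup_norm_def e(1) by (rule SUP_least) (use elim in \<open>auto simp: dist_real_def intro!: ennreal_leI\<close>)
    then show ?case using b(2) by simp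
  qed
qed simp

text \<open>At parameter 0 the branches contract at some rate \<theta> < 1, and g' moves by at most
  a constant times the radius; shrinking the radius keeps the sum of both below 1.\<close>

lemma (in bounded_interval) uniform_family_exists:
  assumes V: "open V" "0 \<in> V" and \<Omega>: "countable \<Omega>"
    and fb: "\<And>\<epsilon>. \<epsilon> \<in> V \<Longrightarrow> full_branch_map \<Delta> \<Omega> (T \<epsilon>) (P \<epsilon>) (g \<epsilon>)"
    and comm: "eps_derivs_commute \<Delta> V \<Omega> g" and bounds: "uniform_branch_bounds \<Delta> V \<Omega> g"
  obtains r l D s c1 c2 where "branch_family \<Delta> V \<Omega> T P g r D s c1 c2" "0 \<le> l" "l < 1"
    "\<And>e \<omega> x. \<bar>e\<bar> < r \<Longrightarrow> \<omega> \<in> \<Omega> \<Longrightarrow> x \<in> \<Delta> \<Longrightarrow> \<bar>dx \<Delta> (g e \<omega>) x\<bar> \<le> l"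
proof -
  have sums: "(\<Sum>\<^sub>\<infinity>\<omega>\<in>\<Omega>. SUP \<epsilon>\<in>V. SUP x\<in>\<Delta>. ennreal \<bar>dx \<Delta> (g \<epsilon> \<omega>) x\<bar>) < \<infinity>"
    "(\<Sum>\<^sub>\<infinity>\<omega>\<in>\<Omega>. SUP \<epsilon>\<in>V. SUP x\<in>\<Delta>. ennreal \<bar>deriv (\<lambda>e. (dx \<Delta> ^^ 1) (g e \<omega>) x) \<epsilon>\<bar>) < \<infinity>"
    "(\<Sum>\<^sub>\<infinity>\<omega>\<in>\<Omega>. SUP \<epsilon>\<in>V. SUP x\<in>\<Delta>. ennreal \<bar>deriv (\<lambda>e. (dx \<Delta> ^^ 2) (g e \<omega>) x) \<epsilon>\<bar>) < \<infinity>"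
    using bounds by (simp_all only: uniform_branch_bounds_def ball_simps)
  obtain s where s: "s summable_on \<Omega>"
    "\<And>\<epsilon> \<omega> x. \<epsilon> \<in> V \<Longrightarrow> \<omega> \<in> \<Omega> \<Longrightarrow> x \<in> \<Delta> \<Longrightarrow> \<bar>dx \<Delta> (g \<epsilon> \<omega>) x\<bar> \<le> s \<omega>"
    by (rule infsum_SUP_boundE[OF sums(1)]) blast
  obtain c1 where c1: "c1 summable_on \<Omega>" "\<And>\<epsilon> \<omega> x. \<epsilon> \<in> V \<Longrightarrow> \<omega> \<in> \<Omega> \<Longrightarrow> x \<in> \<Delta> \<Longrightarrow>
      \<bar>deriv (\<lambda>e. (dx \<Delta> ^^ 1) (g e \<omega>) x) \<epsilon>\<bar> \<le> c1 \<omega>"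
    by (rule infsum_SUP_boundE[OF sums(2)]) blast
  obtain c2 where c2: "c2 summable_on \<Omega>" "\<And>\<epsilon> \<omega> x. \<epsilon> \<in> V \<Longrightarrow> \<omega> \<in> \<Omega> \<Longrightarrow> x \<in> \<Delta> \<Longrightarrow>
      \<bar>deriv (\<lambda>e. (dx \<Delta> ^^ 2) (g e \<omega>) x) \<epsilon>\<bar> \<le> c2 \<omega>"
    by (rule infsum_SUP_boundE[OF sums(3)]) blast
  let ?q = "\<lambda>\<epsilon> \<omega> x. (dx \<Delta> ^^ 2) (g \<epsilon> \<omega>) x / dx \<Delta> (g \<epsilon> \<omega>) x"
  define D where "D = enn2real (SUP \<omega>\<in>\<Omega>. SUP \<epsilon>\<in>V. SUP x\<in>\<Delta>. ennreal \<bar>?q \<epsilon> \<omega> x\<bar>)"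
  have fin: "(SUP \<omega>\<in>\<Omega>. SUP \<epsilon>\<in>V. SUP x\<in>\<Delta>. ennreal \<bar>?q \<epsilon> \<omega> x\<bar>) < top"
    using bounds by (simp add: uniform_branch_bounds_def)
  have D: "\<bar>?q \<epsilon> \<omega> x\<bar> \<le> D" if "\<epsilon> \<in> V" "\<omega> \<in> \<Omega>" "x \<in> \<Delta>" for \<epsilon> \<omega> x
  proof -
    have "ennreal \<bar>?q \<epsilon> \<omega> x\<bar> \<le> (SUP x\<in>\<Delta>. ennreal \<bar>?q \<epsilon> \<omega> x\<bar>)" by (rule SUP_upper[OF that(3)])
    also have "\<dots> \<le> (SUP \<epsilon>\<in>V. SUP x\<in>\<Delta>. ennreal \<bar>?q \<epsilon> \<omega> x\<bar>)" by (rule SUP_upper[OF that(1)])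
    also have "\<dots> \<le> (SUP \<omega>\<in>\<Omega>. SUP \<epsilon>\<in>V. SUP x\<in>\<Delta>. ennreal \<bar>?q \<epsilon> \<omega> x\<bar>)" by (rule SUP_upper[OF that(2)])
    also have "\<dots> = ennreal D" using fin by (simp add: D_def ennreal_enn2real)
    finally show ?thesis by (simp add: D_def ennreal_le_iff)
  qed
  obtain r0 where r0: "r0 > 0" "ball 0 r0 \<subseteq> V" using V open_contains_ball by blast
  \<comment> \<open>Kept general in the radius: the estimates of the family with radius
    \<open>r0\<close> are needed to choose the smaller final one.\<close>
  have fam: "branch_family \<Delta> V \<Omega> T P g r D s c1 c2" if "0 < r" "r \<le> r0" for r
  proof (intro branch_family.intro branch_family_axioms.intro)
    show "e \<in> V" if "\<bar>e\<bar> < r" for e using r0 that \<open>r \<le> r0\<close> by (auto simp: subset_iff dist_real_def)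
    show "bounded_interval \<Delta>" by (rule bounded_interval_axioms)
    show "0 \<le> D" by (simp add: D_def)
  qed (use \<Omega> fb comm s c1 c2 D that(1) in \<open>auto simp: numeral_2_eq_2\<close>)
  interpret b: branch_family \<Delta> V \<Omega> T P g r0 D s c1 c2 using fam r0(1) by simp
  obtain \<theta> where \<theta>: "\<theta> < 1" "0 \<le> \<theta>" "\<And>\<omega> x. \<omega> \<in> \<Omega> \<Longrightarrow> x \<in> \<Delta> \<Longrightarrow> \<bar>dx \<Delta> (g 0 \<omega>) x\<bar> \<le> \<theta>"
    using b.g1_expansion[OF V(2)] by blast
  have c10: "0 \<le> c1 \<omega>" if "\<omega> \<in> \<Omega>" for \<omega>
    using b.c1(2)[OF V(2) that interior_subset'[OF b.x0]] by linarith
  define C where "C = infsum c1 \<Omega>"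
  have C: "0 \<le> C" "c1 \<omega> \<le> C" if "\<omega> \<in> \<Omega>" for \<omega>
    using finite_sum_le_infsum[OF c1(1), of "{\<omega>}"] c10 that by (auto simp: C_def intro: infsum_nonneg)
  have C0: "0 \<le> C" unfolding C_def by (rule infsum_nonneg[OF c10])
  \<comment> \<open>Makes \<open>C * r\<close> at most half of the gap \<open>1 - \<theta>\<close>;
    the summand 1 covers the case that \<open>C\<close> is 0.\<close>
  define r where "r = min r0 ((1 - \<theta>) / (2 * (C + 1)))"
  have r: "0 < r" "r \<le> r0" using r0 \<theta> C0 by (auto simp: r_def)
  have "C * r \<le> (C + 1) * ((1 - \<theta>) / (2 * (C + 1)))"
    using r C0 by (intro mult_mono) (auto simp: r_def)
  also have "\<dots> = (1 - \<theta>) / 2" using C0 by (simp add: field_simps)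
  finally have Cr: "\<theta> + C * r < 1" using \<theta>(1) by (simp add: field_simps)
  show ?thesis
  proof (rule that[OF fam[OF r]])
    show "0 \<le> \<theta> + C * r" using \<theta> C0 r by simp
    show "\<theta> + C * r < 1" by (rule Cr)
    show "\<bar>dx \<Delta> (g e \<omega>) x\<bar> \<le> \<theta> + C * r" if e: "\<bar>e\<bar> < r" and "\<omega> \<in> \<Omega>" "x \<in> \<Delta>" for e \<omega> x
    proof -
      have "\<bar>dx \<Delta> (g e \<omega>) x - dx \<Delta> (g 0 \<omega>) x\<bar> \<le> c1 \<omega> * \<bar>e\<bar>"
        using b.g1_vary[of e] e r(2) that by simp
      also have "\<dots> \<le> C * r" using C[OF that(2)] e C0 by (intro mult_mono) auto
      finally show ?thesis using \<theta>(3)[OF that(2,3)] by linarith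
    qed
  qed
qed

text \<open>The coefficients are evaluated only over interior points, where \<open>g 0\<close> leads
  into the open branch domains; so the source is a \<Phi> in \<open>C1_zero\<close>, whose values at
  end points are fixed by continuity. Bijectivity of \<open>I_minus\<close> is concluded because it
  gives \<open>the_inv_into\<close> its meaning.\<close>

theorem theorem3p2:
  fixes \<Delta> V :: "real set" and \<Omega> :: "'w set"
    and T :: "real \<Rightarrow> real \<Rightarrow> real"
    and P :: "real \<Rightarrow> 'w \<Rightarrow> real set"
    and g :: "real \<Rightarrow> 'w \<Rightarrow> real \<Rightarrow> real"
    and h :: "real \<Rightarrow> real \<Rightarrow> real"
  assumes "is_interval \<Delta>" and "bounded \<Delta>" and "interior \<Delta> \<noteq> {}"
    and "open V" and "0 \<in> V"
    and "countable \<Omega>"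
    and "\<And>\<epsilon>. \<epsilon> \<in> V \<Longrightarrow> full_branch_map \<Delta> \<Omega> (T \<epsilon>) (P \<epsilon>) (g \<epsilon>)"
    and "eps_derivs_commute \<Delta> V \<Omega> g"
    and "uniform_branch_bounds \<Delta> V \<Omega> g"
    and "spectral_gap 2 \<Delta> (PF \<Delta> \<Omega> (g 0))"
    and "\<And>\<epsilon>. \<epsilon> \<in> V \<Longrightarrow> invariant_density \<Delta> (T \<epsilon>) (h \<epsilon>) \<and> continuous_on \<Delta> (h \<epsilon>)"
  shows "h 0 \<in> C_b 1 \<Delta>
    \<and> bij_betw (I_minus \<Delta> (PF \<Delta> \<Omega> (g 0))) (C1_zero \<Delta>) (C1_zero \<Delta>)
    \<and> (\<exists>hs\<in>C_b 0 \<Delta>.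
         ((\<lambda>\<epsilon>. sup_norm \<Delta> (\<lambda>x. (h \<epsilon> x - h 0 x) / \<epsilon> - hs x)) \<longlongrightarrow> 0) (at 0)
       \<and> (\<exists>\<Phi>\<in>C1_zero \<Delta>.
            (\<forall>x\<in>interior \<Delta>.
               \<Phi> x = PF \<Delta> \<Omega> (g 0) (\<lambda>y. A0 T y * dx \<Delta> (h 0) y + B0 T y * h 0 y) x)
          \<and> (\<forall>x\<in>\<Delta>. hs x = the_inv_into (C1_zero \<Delta>) (I_minus \<Delta> (PF \<Delta> \<Omega> (g 0))) \<Phi> x)))"
proof -
  interpret bounded_interval \<Delta> by unfold_locales (rule assms)+
  obtain r l D s c1 c2 where fam: "branch_family \<Delta> V \<Omega> T P g r D s c1 c2" and l: "0 \<le> l" "l < 1"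
    "\<And>e \<omega> x. \<bar>e\<bar> < r \<Longrightarrow> \<omega> \<in> \<Omega> \<Longrightarrow> x \<in> \<Delta> \<Longrightarrow> \<bar>dx \<Delta> (g e \<omega>) x\<bar> \<le> l"
    using uniform_family_exists[OF assms(4-9)] by metis
  interpret b: branch_family \<Delta> V \<Omega> T P g r D s c1 c2 by (rule fam)
  interpret u: uniform_family \<Delta> \<Omega> g r l D b.K s c1 c2 b.\<sigma> b.\<gamma> by (rule b.is_uniform_family[OF l(2,1,3)])
  let ?L = "PF \<Delta> \<Omega> (g 0)"
  \<comment> \<open>Used twice: with a constant \<open>f\<close> to compare \<open>h 0\<close> with
    the limit supplied by the spectral gap, and with \<open>f = h 0\<close> to expand the perturbed
    densities.\<close>
  have h_eq: "h e x = f x + (\<Sum>n. (PF \<Delta> \<Omega> (g e) ^^ n) (\<lambda>x. PF \<Delta> \<Omega> (g e) f x - f x) x)"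
    if e: "\<bar>e\<bar> < r" and f: "K'-lipschitz_on \<Delta> f" "(LINT x|lebesgue_on \<Delta>. f x) = 1" and x: "x \<in> \<Delta>" for e f K' x
  proof -
    interpret e: contracting_branches \<Delta> \<Omega> "g e" s l D by (rule u.contracting[OF e])
    have V: "e \<in> V" by (rule b.r(2)[OF e])
    have inv: "invariant_density \<Delta> (T e) (h e)" "continuous_on \<Delta> (h e)" using assms(11)[OF V] by auto
    have T: "T e \<in> lebesgue_on \<Delta> \<rightarrow>\<^sub>M lebesgue_on \<Delta>"
      by (rule invariant_density_measurable[OF inv(1)])
    show ?thesis
    proof (rule e.invariant_density_eq[OF inv _ f x])
      fix A and F :: "real \<Rightarrow> real" and K'' assume A: "A \<in> sets (lebesgue_on \<Delta>)" and F: "K''-lipschitz_on \<Delta> F"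
      obtain B where "\<And>x. x \<in> \<Delta> \<Longrightarrow> \<bar>F x\<bar> \<le> B" using lipschitz_bounded[OF F] by metis
      from full_branch_koopman[OF assms(7)[OF V] assms(6) b.s(1) b.s(2)[OF V]
          continuous_measurable[OF lipschitz_on_continuous_on[OF F]] this T A]
      show "(LINT x|lebesgue_on \<Delta>. indicator A (T e x) * F x) = (LINT x|lebesgue_on \<Delta>. indicator A x * e.L F x)" .
    qed
  qed
  have h0_int: "(LINT x|lebesgue_on \<Delta>. h 0 x) = 1"
    using assms(11)[OF assms(5)] by (simp add: invariant_density_def)
  have r0: "\<bar>0\<bar> < r" using b.r(1) by simp
  define f0 where "f0 = (\<lambda>_::real. 1 / len)"
  have f0: "0-lipschitz_on \<Delta> f0" "(LINT x|lebesgue_on \<Delta>. f0 x) = 1" "f0 \<in> C_b 2 \<Delta>"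
    using integral_const[of "1 / len"] len_pos by (simp_all add: f0_def lipschitz_on_constant C_b_const)
  obtain v c where v: "v \<in> C_b 2 \<Delta>" "\<And>x. x \<in> \<Delta> \<Longrightarrow> ?L v x = v x"
    "\<And>x. x \<in> \<Delta> \<Longrightarrow> (\<lambda>n. (?L ^^ n) f0 x) \<longlonglongrightarrow> c * v x"
    using spectral_gap_limit[OF assms(10) f0(3)] by metis
  \<comment> \<open>The Neumann series and the spectral gap both compute the limit of the iterates
    of the normalized constant \<open>f0\<close>; thus \<open>h 0\<close> inherits C^2 regularity
    from \<open>v\<close>.\<close>
  have h0_v: "h 0 x = c * v x" if x: "x \<in> \<Delta>" for x
  proof -
    obtain K1 where K1: "K1-lipschitz_on \<Delta> (?L f0)" using u.base.PF_lipschitz_ex[OF f0(1)] by blast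
    have "(LINT x|lebesgue_on \<Delta>. ?L f0 x - f0 x) = 0"
      using lipschitz_integrable[OF K1] lipschitz_integrable[OF f0(1)] u.base.integral_PF[OF f0(1)] by simp
    note sm = u.base.PF_neumann_summable[OF lipschitz_on_diff[OF K1 f0(1)] this x]
    have "(\<lambda>n. (?L ^^ n) f0 x) \<longlonglongrightarrow> h 0 x"
      unfolding u.base.PF_funpow_telescope[OF f0(1) x] h_eq[OF r0 f0(1,2) x]
      by (intro tendsto_add tendsto_const summable_LIMSEQ sm)
    then show ?thesis using v(3)[OF x] by (rule LIMSEQ_unique)
  qed
  have h0_C2: "h 0 \<in> C_b 2 \<Delta>"
    using C_b_cong[of "h 0" "\<lambda>x. 0 + c * v x"] h0_v C_b_linear[OF C_b_const v(1), of 0 c] by simp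
  have h0_C1: "h 0 \<in> C_b 1 \<Delta>" by (rule C_b_mono[OF h0_C2]) simp
  have h0_fixed: "?L (h 0) x = h 0 x" if "x \<in> \<Delta>" for x
  proof -
    have "?L (h 0) x = ?L (\<lambda>x. c * v x) x" by (rule u.base.PF_cong[OF h0_v that])
    also have "\<dots> = c * ?L v x" using u.base.PF_funpow_scale[of 1 c v] by simp
    finally show ?thesis using v(2)[OF that] h0_v[OF that] by simp
  qed
  obtain K0 where K0: "K0-lipschitz_on \<Delta> (h 0)" using C_b_1D(3)[OF h0_C1] by blast
  define \<Phi> where "\<Phi> = u.response_source (h 0)"
  note response = u.linear_response[where h = h, OF h0_C2 h0_fixed h_eq[OF _ K0 h0_int], folded \<Phi>_def]
  define hs where "hs = (\<lambda>x. \<Sum>n. (?L ^^ n) \<Phi> x)"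
  have \<Phi>0: "restrict \<Phi> \<Delta> \<in> C1_zero \<Delta>" by (rule u.C1_zeroI[OF response(1,2)])
  have "hs \<in> C_b 1 \<Delta>" unfolding hs_def by (rule u.neumann_C_b_1[OF response(1,2)])
  then have hs: "hs \<in> C_b 0 \<Delta>" by (rule C_b_mono) simp
  have conv: "((\<lambda>\<epsilon>. sup_norm \<Delta> (\<lambda>x. (h \<epsilon> x - h 0 x) / \<epsilon> - hs x)) \<longlongrightarrow> 0) (at 0)"
    unfolding hs_def by (rule sup_norm_tendsto_0[OF response(3)])
  \<comment> \<open>The identity holds branch by branch: the coefficients take the values \<gamma>
    and \<gamma>'/g' at the image point, which turns the response term into the summand of the
    operator.\<close>
  have source: "restrict \<Phi> \<Delta> x = ?L (\<lambda>y. A0 T y * dx \<Delta> (h 0) y + B0 T y * h 0 y) x"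
    if x: "x \<in> interior \<Delta>" for x
  proof -
    have xD: "x \<in> \<Delta>" by (rule interior_subset'[OF x])
    have "\<Phi> x = ?L (\<lambda>y. A0 T y * dx \<Delta> (h 0) y + B0 T y * h 0 y) x"
      unfolding \<Phi>_def u.response_source_def u.response_term_def PF_def
    proof (rule infsum_cong)
      fix \<omega> assume w: "\<omega> \<in> \<Omega>"
      show "b.\<sigma> \<omega> * (dx \<Delta> (h 0) (g 0 \<omega> x) * b.\<gamma> \<omega> x * dx \<Delta> (g 0 \<omega>) x + h 0 (g 0 \<omega> x) * dx \<Delta> (b.\<gamma> \<omega>) x)
        = (A0 T (g 0 \<omega> x) * dx \<Delta> (h 0) (g 0 \<omega> x) + B0 T (g 0 \<omega> x) * h 0 (g 0 \<omega> x)) * \<bar>dx \<Delta> (g 0 \<omega>) x\<bar>"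
        unfolding b.A0_branch[OF w x] b.B0_branch[OF w x] b.g1_sign[OF r0 w xD]
        using b.g1_nonzero[OF assms(5) w x] by (simp add: field_simps)
    qed
    then show ?thesis using xD by simp
  qed
  have inverse: "hs x = the_inv_into (C1_zero \<Delta>) (I_minus \<Delta> ?L) (restrict \<Phi> \<Delta>) x" if x: "x \<in> \<Delta>" for x
  proof -
    \<comment> \<open>The Neumann series is an explicit preimage, so injectivity identifies it with
      the inverse.\<close>
    have "the_inv_into (C1_zero \<Delta>) (I_minus \<Delta> ?L) (restrict \<Phi> \<Delta>) = restrict (\<lambda>x. \<Sum>n. (?L ^^ n) (restrict \<Phi> \<Delta>) x) \<Delta>"
      by (rule the_inv_into_f_eq[OF bij_betw_imp_inj_on[OF u.bij_I_minus] u.I_minus_neumann(2,1)[OF \<Phi>0]])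
    then show ?thesis
      using x u.base.PF_funpow_cong[of "restrict \<Phi> \<Delta>" \<Phi> x] by (simp add: hs_def)
  qed
  show ?thesis
    using h0_C1 u.bij_I_minus hs conv \<Phi>0 source inverse by blast
qed

end
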